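(* Let $n \geq 1$, let $f:\mathbb{R}^n \to \{0,1\}$ be measurable, let $0 \leq \rho < 1$, and let $(\mathbf{x},\mathbf{y})$ be $\rho$-correlated $n$-dimensional standard Gaussian random vectors. Let $\eta \subseteq \mathbb{R}^n$ be a halfspace such that $\mathbb{E}_{\mathbf{x} \sim \mathrm{N}(0,1)^n}[1_{\eta}(\mathbf{x})] = \mathbb{E}_{\mathbf{x} \sim \mathrm{N}(0,1)^n}[f(\mathbf{x})]$, where $1_\eta$ is the indicator function of $\eta$. Then \[ -H(f(\mathbf{x}) \mid \mathbf{y}) \leq -H(1_{\eta}(\mathbf{x}) \mid \mathbf{y}). \]
   Context: $\rho$-correlated $n$-dimensional standard Gaussian random vectors: $\mathbf{x}$ is a standard $n$-dimensional Gaussian vector and $\mathbf{y} = \rho \mathbf{x} + \sqrt{1-\rho^2}\,\mathbf{z}$ with $\mathbf{z}$ an independent standard $n$-dimensional Gaussian vector. For $\beta \in [0,1]$, $h(\beta) = \beta \log_2(1/\beta) + (1-\beta)\log_2(1/(1-\beta))$ is the binary entropy. For a $\{0,1\}$-valued function $g$, the conditional entropy is $H(g(\mathbf{x}) \mid \mathbf{y}) = \mathbb{E}_{\mathbf{y}}\big[h(\Pr[g(\mathbf{x}) = 1 \mid \mathbf{y}])\big]$; equivalently $-H(g(\mathbf{x})\mid \mathbf{y}) = \mathbb{E}_{\mathbf{x}\sim \mathrm{N}(0,1)^n}[-h(U_\rho g(\mathbf{x}))]$ where $U_\rho g(x) = \mathbb{E}[g(\mathbf{y}) \mid \mathbf{x}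 = x]$. A halfspace is a set of the form $\{x \in \mathbb{R}^n : \langle a, x\rangle \geq t\}$ with $a \neq 0$, $t \in \mathbb{R}$. *)

theory Defs
  imports "HOL-Analysis.Analysis"
begin

definition std_gauss_density :: "real ^ 'n \<Rightarrow> real" where
  "std_gauss_density x = (2 * pi) powr (- real CARD('n) / 2) * exp (- (norm x)\<^sup>2 / 2)"

definition std_gauss :: "(real ^ 'n) measure" where
  "std_gauss = density lborel (\<lambda>x. ennreal (std_gauss_density x))"

definition bin_entropy :: "real \<Rightarrow> real" where
  "bin_entropy b = (if b = 0 \<or> b = 1 then 0
     else b * log 2 (1 / b) + (1 - b) * log 2 (1 / (1 - b)))"

text \<open>Ornstein-Uhlenbeck operator: U_rho g x = E[g(y) | x], y = rho x + sqrt(1-rho^2) z.\<close>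
definition OU :: "real \<Rightarrow> (real ^ 'n \<Rightarrow> real) \<Rightarrow> real ^ 'n \<Rightarrow> real" where
  "OU \<rho> g x = (\<integral>z. g (\<rho> *\<^sub>R x + sqrt (1 - \<rho>\<^sup>2) *\<^sub>R z) \<partial>std_gauss)"

text \<open>Conditional entropy H(g(x) | y) for rho-correlated standard Gaussians (x,y),
  via the identity -H(g(x)|y) = E_x[-h(U_rho g(x))].\<close>
definition cond_entropy :: "real \<Rightarrow> (real ^ 'n \<Rightarrow> real) \<Rightarrow> real" where
  "cond_entropy \<rho> g = (\<integral>x. bin_entropy (OU \<rho> g x) \<partial>std_gauss)"

definition halfspace :: "(real ^ 'n) set \<Rightarrow> bool" where
  "halfspace S \<longleftrightarrow> (\<exists>a t. a \<noteq> 0 \<and> S = {x. a \<bullet> x \<ge> t})"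

end

(*
  Borell's theorem for two functions says that, for the law of rho-correlated Gaussians,
  E[f(x) g(y)] is at most the value B(E f, E g) attained by parallel halfspaces.  Taking for g the
  indicator of {U_rho f > c} turns it into E (U_rho f - c)^+ <= E (U_rho 1_eta - c)^+ for all c, and
  since -h is convex these hinge inequalities integrate to the claim.

  Borell's theorem is proved by interpolation: with J = B the Gaussian copula and P the heat
  semigroup, E J(P_{1-t} f(sqrt t x), P_{1-t} g(sqrt t y)) decreases in t, because both arguments
  are martingales (so first-order terms vanish) and the matrix (J_xx, rho J_xy; rho J_xy, J_yy) is
  negative semidefinite.  Instead of Ito calculus the time axis is cut into steps of length h, each
  of which costs O(h^(3/2)); this only needs second-order Taylor bounds.  Stopping at t = 1 - delta
  keeps P_{1-t} f smooth; there J(a, b) >= a b brings back E[f(x) g(y)], with the slightly smaller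
  correlation rho (1 - delta).
*)
theory Submission
  imports Defs "HOL-Probability.Probability"
begin

section \<open>The standard Gaussian measure\<close>

text \<open>For \<rho> > 0 the second derivatives of the copula are unbounded on the open unit
  square, so no uniform Taylor bound exists there. The interpolation is therefore run for functions
  with values in some \<open>{Phi (-M)..Phi M}\<close>, and the truncation is undone by an affine
  map close to the identity. The correlation lost by stopping early is regained by using a copula
  parameter R slightly larger than \<rho>, stopping at time \<rho> / R, and letting R decrease to
  \<rho>. The negative semidefiniteness is visible as a square: in quantile coordinates the three
  second derivatives share one factor \<kappa>, the bivariate normal density, and the expected
  second-order term of a step of length h is -\<kappa> \<rho> h |\<alpha> D - \<beta> D'|^2 / 2,
  where D and D' are the gradients of the two smoothed functions. N steps of length T / N cost K T
  sqrt(T / N) in total, which tends to 0. The measure is defined on every Euclidean space, products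
  included, so that two independent vectors x and z form a single Gaussian vector and the correlated
  pair is a linear image of it.\<close>

definition gauss_density :: "'a::euclidean_space \<Rightarrow> real" where
  "gauss_density x = (2 * pi) powr (- real DIM('a) / 2) * exp (- (norm x)\<^sup>2 / 2)"

definition gauss :: "'a::euclidean_space measure" where
  "gauss = density lborel (\<lambda>x. ennreal (gauss_density x))"

lemma std_gauss_eq_gauss: "(std_gauss :: (real ^ 'n) measure) = gauss"
  by (simp add: std_gauss_def gauss_def std_gauss_density_def gauss_density_def)

lemma space_gauss [simp]: "space gauss = UNIV"
  and sets_gauss [measurable_cong, simp]: "sets gauss = sets borel"
  by (simp_all add: gauss_def)

lemma gauss_density_nonneg [simp]: "gauss_density x \<ge> 0"
  by (simp add: gauss_density_def)

lemma borel_measurable_gauss_density [measurable]: "gauss_density \<in> borel_measurable borel"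
  unfolding gauss_density_def[abs_def] by measurable

lemma gauss_density_real: "gauss_density (x::real) = std_normal_density x"
  by (simp add: gauss_density_def std_normal_density_def powr_minus powr_half_sqrt inverse_eq_divide)

lemma gauss_density_eq_prod:
  "gauss_density (x :: 'a :: euclidean_space) = (\<Prod>b\<in>Basis. std_normal_density (x \<bullet> b))"
proof -
  have "(\<Prod>b\<in>(Basis::'a set). std_normal_density (x \<bullet> b))
      = (1 / sqrt (2 * pi)) ^ DIM('a) * exp (\<Sum>b\<in>Basis. - (x \<bullet> b)\<^sup>2 / 2)"
    unfolding std_normal_density_def prod.distrib exp_sum[OF finite_Basis] by simp
  also have "(\<Sum>b\<in>Basis. - (x \<bullet> b)\<^sup>2 / 2) = - (norm x)\<^sup>2 / 2"
    unfolding power2_norm_eq_inner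
    by (subst euclidean_inner) (simp add: power2_eq_square sum_negf flip: sum_divide_distrib)
  also have "(1 / sqrt (2 * pi)) ^ DIM('a) = (2 * pi) powr (- real DIM('a) / 2)"
  proof -
    have "1 / sqrt (2 * pi) = (2 * pi) powr (- 1 / 2)"
      by (simp add: powr_minus powr_half_sqrt inverse_eq_divide)
    then show ?thesis
      by (simp add: powr_powr flip: powr_realpow)
  qed
  finally show ?thesis by (simp add: gauss_density_def)
qed

lemma nn_integral_gauss:
  "f \<in> borel_measurable borel \<Longrightarrow> (\<integral>\<^sup>+x. f x \<partial>gauss) = (\<integral>\<^sup>+x. ennreal (gauss_density x) * f x \<partial>lborel)"
  unfolding gauss_def by (subst nn_integral_density) auto

lemma emeasure_gauss_real: "emeasure gauss (A::real set) = (\<integral>\<^sup>+x. ennreal (std_normal_density x) * indicator A x \<partial>lborel)"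
  if "A \<in> sets borel"
  using that unfolding gauss_def gauss_density_real by (subst emeasure_density) auto

interpretation gauss_real: prob_space "gauss :: real measure"
  using prob_space_normal_density[of 1 0] unfolding gauss_def gauss_density_real by simp

text \<open>Both the density and the indicator of a box are products over \<open>Basis\<close>, so
  the integral splits into one-dimensional ones. This gives the total mass 1 and later the
  independence of the coordinates.\<close>

lemma emeasure_gauss_box:
  assumes [measurable]: "\<And>b. A b \<in> sets borel"
  shows "emeasure gauss {x :: 'a :: euclidean_space. \<forall>b\<in>Basis. x \<bullet> b \<in> A b} = (\<Prod>b\<in>(Basis::'a set). emeasure gauss (A b))"
proof -
  have m: "{x :: 'a. \<forall>b\<in>Basis. x \<bullet> b \<in> A b} \<in> sets borel"
  proof -
    have "{x :: 'a. \<forall>b\<in>Basis. x \<bullet> b \<in> A b} = (\<Inter>b\<in>Basis. (\<lambda>x. x \<bullet> b) -` A b)" by auto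
    also have "\<dots> \<in> sets borel"
    proof (intro sets.finite_INT)
      fix b :: 'a assume "b \<in> Basis"
      have "(\<lambda>x::'a. x \<bullet> b) \<in> measurable borel borel" by simp
      from measurable_sets[OF this assms] show "(\<lambda>x. x \<bullet> b) -` A b \<in> sets borel" by simp
    qed auto
    finally show ?thesis .
  qed
  have "emeasure gauss {x :: 'a. \<forall>b\<in>Basis. x \<bullet> b \<in> A b}
      = (\<integral>\<^sup>+x. ennreal (gauss_density (x::'a)) * indicator {x :: 'a. \<forall>b\<in>Basis. x \<bullet> b \<in> A b} x \<partial>lborel)"
    unfolding gauss_def using m by (subst emeasure_density) auto
  also have "\<dots> = (\<integral>\<^sup>+x. (\<Prod>b\<in>Basis. ennreal (std_normal_density (x \<bullet> b)) * indicator (A b) (x \<bullet> b)) \<partial>(lborel::'a measure))"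
  proof (rule nn_integral_cong)
    fix x :: 'a
    have "indicator {x :: 'a. \<forall>b\<in>Basis. x \<bullet> b \<in> A b} x = (\<Prod>b\<in>Basis. indicator (A b) (x \<bullet> b) :: ennreal)"
      by (auto simp: indicator_def)
    then show "ennreal (gauss_density (x::'a)) * indicator {x :: 'a. \<forall>b\<in>Basis. x \<bullet> b \<in> A b} x
       = (\<Prod>b\<in>Basis. ennreal (std_normal_density (x \<bullet> b)) * indicator (A b) (x \<bullet> b))"
      by (simp add: prod.distrib gauss_density_eq_prod prod_ennreal)
  qed
  also have "\<dots> = (\<Prod>b\<in>(Basis::'a set). \<integral>\<^sup>+x. ennreal (std_normal_density x) * indicator (A b) x \<partial>lborel)"
    by (rule nn_integral_lborel_prod) (auto intro!: borel_measurable_times measurable_compose[OF _ measurable_ennreal])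
  finally show ?thesis by (simp add: emeasure_gauss_real)
qed

interpretation gauss: prob_space "gauss :: 'a :: euclidean_space measure"
proof
  have "emeasure gauss {x :: 'a. \<forall>b\<in>Basis. x \<bullet> b \<in> UNIV} = (\<Prod>b\<in>(Basis::'a set). emeasure (gauss::real measure) UNIV)"
    by (rule emeasure_gauss_box) auto
  also have "emeasure (gauss::real measure) UNIV = 1" using gauss_real.emeasure_space_1 by simp
  finally show "emeasure (gauss::'a measure) (space gauss) = 1" by simp
qed

section \<open>Products, rotations and sums of Gaussian vectors\<close>

lemma measurable_fst_borel [measurable]:
    "fst \<in> borel_measurable (borel :: ('a::topological_space \<times> 'b::topological_space) measure)"
  and measurable_snd_borel [measurable]:
    "snd \<in> borel_measurable (borel :: ('a \<times> 'b) measure)"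
  by (intro borel_measurable_continuous_onI continuous_intros)+

text \<open>Squared norms add in a product space, and so do the dimensions in the normalising power.
  From here on a pair of independent Gaussian vectors is one vector of a product type, and iterated
  integrals are integrals over it.\<close>

lemma gauss_pair: "(gauss :: 'a::euclidean_space measure) \<Otimes>\<^sub>M (gauss :: 'b::euclidean_space measure) = gauss"
proof -
  have "(gauss :: 'a measure) \<Otimes>\<^sub>M (gauss :: 'b measure)
     = density (lborel \<Otimes>\<^sub>M lborel) (\<lambda>(x, y). ennreal (gauss_density x) * ennreal (gauss_density y))"
    unfolding gauss_def
  proof (rule pair_measure_density)
    show "sigma_finite_measure (density lborel (\<lambda>x. ennreal (gauss_density (x::'b))))"
      using gauss.sigma_finite_measure_axioms[where 'a='b] by (simp add: gauss_def)
  qed (auto intro: lborel.sigma_finite_measure_axioms)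
  also have "\<dots> = gauss"
    unfolding gauss_def lborel_prod
  proof (intro density_cong AE_I2)
    fix z :: "'a \<times> 'b"
    obtain a b where z: "z = (a, b)" by (cases z)
    have "gauss_density a * gauss_density b
        = ((2 * pi) powr (- real DIM('a) / 2) * (2 * pi) powr (- real DIM('b) / 2))
          * (exp (- (norm a)\<^sup>2 / 2) * exp (- (norm b)\<^sup>2 / 2))"
      by (simp add: gauss_density_def)
    also have "\<dots> = gauss_density (a, b)"
      unfolding powr_add[symmetric] exp_add[symmetric]
      by (simp add: gauss_density_def norm_Pair field_simps)
    finally show "(case z of (x, y) \<Rightarrow> ennreal (gauss_density x) * ennreal (gauss_density y)) = ennreal (gauss_density z)"
      by (simp add: z flip: ennreal_mult')
  qed (auto simp: case_prod_beta')
  finally show ?thesis .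
qed

lemma nn_integral_lborel_affine:
  fixes h :: "'a::euclidean_space \<Rightarrow> ennreal"
  assumes [measurable]: "h \<in> borel_measurable borel" and "k \<noteq> 0"
  shows "(\<integral>\<^sup>+x. h x \<partial>lborel) = ennreal (\<bar>k\<bar> ^ DIM('a)) * (\<integral>\<^sup>+x. h (t + k *\<^sub>R x) \<partial>lborel)"
  by (subst lborel_affine[OF \<open>k \<noteq> 0\<close>, of t])
     (simp add: nn_integral_density nn_integral_distr nn_integral_cmult)

lemma distr_gauss_uminus: "distr gauss borel uminus = (gauss :: 'a::euclidean_space measure)"
proof (rule measure_eqI)
  fix A :: "'a set" assume "A \<in> sets (distr gauss borel uminus)"
  then have [measurable]: "A \<in> sets borel" by simp
  have "emeasure (distr gauss borel uminus) A = (\<integral>\<^sup>+x. indicator A x \<partial>distr gauss borel uminus)"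
    by simp
  also have "\<dots> = (\<integral>\<^sup>+x. ennreal (gauss_density x) * indicator A (- x) \<partial>lborel)"
    by (subst nn_integral_distr, measurable, subst nn_integral_gauss, measurable)
  also have "\<dots> = (\<integral>\<^sup>+x. ennreal (gauss_density x) * indicator A x \<partial>lborel)"
    by (subst nn_integral_lborel_affine[of _ "-1" 0]) (auto simp: gauss_density_def)
  also have "\<dots> = emeasure gauss A"
    by (subst nn_integral_gauss[symmetric]) auto
  finally show "emeasure (distr gauss borel uminus) A = emeasure gauss A" .
qed simp

lemma gauss_density_rot:
  fixes x y :: "'a::euclidean_space"
  assumes "c\<^sup>2 + s\<^sup>2 = 1"
  shows "gauss_density (c *\<^sub>R x + s *\<^sub>R y) * gauss_density (c *\<^sub>R y - s *\<^sub>R x) = gauss_density x * gauss_density y"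
proof -
  have "(norm (c *\<^sub>R x + s *\<^sub>R y))\<^sup>2 + (norm (c *\<^sub>R y - s *\<^sub>R x))\<^sup>2 = (c\<^sup>2 + s\<^sup>2) * ((norm x)\<^sup>2 + (norm y)\<^sup>2)"
    unfolding power2_norm_eq_inner by (simp add: inner_simps inner_commute power2_eq_square algebra_simps)
  then have eq: "- (norm (c *\<^sub>R x + s *\<^sub>R y))\<^sup>2 / 2 + - (norm (c *\<^sub>R y - s *\<^sub>R x))\<^sup>2 / 2
      = - (norm x)\<^sup>2 / 2 + - (norm y)\<^sup>2 / 2"
    using assms by (simp add: field_simps)
  show ?thesis
    unfolding gauss_density_def using arg_cong[OF eq, of exp] unfolding exp_add
    by (simp add: mult_ac)
qed

lemma nn_integral_gauss_pair:
  fixes F :: "'a::euclidean_space \<times> 'b::euclidean_space \<Rightarrow> ennreal"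
  assumes [measurable]: "F \<in> borel_measurable borel"
  shows "(\<integral>\<^sup>+z. F z \<partial>gauss) = (\<integral>\<^sup>+x. \<integral>\<^sup>+y. F (x, y) \<partial>gauss \<partial>gauss)"
proof -
  have "F \<in> borel_measurable (borel \<Otimes>\<^sub>M borel)"
    by (subst borel_prod) simp
  then show ?thesis
    unfolding gauss_pair[symmetric]
    by (subst gauss.nn_integral_fst[symmetric]) (auto cong: measurable_cong_sets)
qed

text \<open>The rotation is split into two affine substitutions, each acting on one block, with
  Fubini between them, so no determinant has to be computed. For fixed x, the variable y is replaced
  by u = c x + s y, with factor |1/s|^n; then for fixed u, the variable x = c u - s v is replaced by
  v, with factor |s|^n. The factors cancel, and both substitutions need
  \<open>s \<noteq> 0\<close>.\<close>

lemma distr_gauss_rot: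
  fixes c s :: real
  assumes cs: "c\<^sup>2 + s\<^sup>2 = 1" and s: "s \<noteq> 0"
  shows "distr gauss borel (\<lambda>z. (c *\<^sub>R fst z + s *\<^sub>R snd z, c *\<^sub>R snd z - s *\<^sub>R fst z))
    = (gauss :: ('a::euclidean_space \<times> 'a) measure)" (is "?D = _")
proof (rule measure_eqI)
  fix A :: "('a \<times> 'a) set" assume "A \<in> sets ?D"
  then have A [measurable]: "A \<in> sets borel" by simp
  have A' [measurable]: "A \<in> sets (borel \<Otimes>\<^sub>M borel)" by (subst borel_prod) simp
  let ?g = "\<lambda>x::'a. ennreal (gauss_density x)"
  let ?n = "DIM('a)"
  have R [measurable]: "(\<lambda>z::'a\<times>'a. (c *\<^sub>R fst z + s *\<^sub>R snd z, c *\<^sub>R snd z - s *\<^sub>R fst z)) \<in> borel_measurable borel"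
    by (intro borel_measurable_continuous_onI continuous_intros)
  have "emeasure ?D A = (\<integral>\<^sup>+z. indicator A z \<partial>?D)" by simp
  also have "\<dots> = (\<integral>\<^sup>+z. indicator A (c *\<^sub>R fst z + s *\<^sub>R snd z, c *\<^sub>R snd z - s *\<^sub>R fst z) \<partial>gauss)"
    by (subst nn_integral_distr) auto
  also have "\<dots> = (\<integral>\<^sup>+x. \<integral>\<^sup>+y. indicator A (c *\<^sub>R x + s *\<^sub>R y, c *\<^sub>R y - s *\<^sub>R x) \<partial>gauss \<partial>gauss)"
    by (subst nn_integral_gauss_pair) (auto intro!: borel_measurable_indicator' simp: pred_def)
  also have "\<dots> = (\<integral>\<^sup>+x. \<integral>\<^sup>+y. ?g x * ?g y * indicator A (c *\<^sub>R x + s *\<^sub>R y, c *\<^sub>R y - s *\<^sub>R x) \<partial>lborel \<partial>lborel)"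
    by (subst nn_integral_gauss, measurable)+ (simp add: nn_integral_gauss nn_integral_cmult mult.assoc)
  also have "\<dots> = (\<integral>\<^sup>+x. \<integral>\<^sup>+u. ennreal (\<bar>1/s\<bar> ^ ?n) * (?g u * ?g ((1/s) *\<^sub>R (c *\<^sub>R u - x)) * indicator A (u, (1/s) *\<^sub>R (c *\<^sub>R u - x))) \<partial>lborel \<partial>lborel)"
  proof (rule nn_integral_cong)
    fix x :: 'a
    have e1: "c *\<^sub>R x + s *\<^sub>R (- (c/s) *\<^sub>R x + (1/s) *\<^sub>R u) = u" for u
      using s by (simp add: algebra_simps)
    have e2: "c *\<^sub>R (- (c/s) *\<^sub>R x + (1/s) *\<^sub>R u) - s *\<^sub>R x = (1/s) *\<^sub>R (c *\<^sub>R u - x)" for u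
    proof -
      have "c *\<^sub>R (- (c/s) *\<^sub>R x + (1/s) *\<^sub>R u) - s *\<^sub>R x = (c/s) *\<^sub>R u - (c * (c/s) + s) *\<^sub>R x"
        by (simp add: algebra_simps)
      also have "c * (c/s) + s = 1/s" using s cs by (simp add: field_simps power2_eq_square)
      finally show ?thesis by (simp add: algebra_simps)
    qed
    have e3: "?g x * ?g (- (c/s) *\<^sub>R x + (1/s) *\<^sub>R u) = ?g u * ?g ((1/s) *\<^sub>R (c *\<^sub>R u - x))" for u
      using gauss_density_rot[OF cs, of x "- (c/s) *\<^sub>R x + (1/s) *\<^sub>R u"]
      unfolding e1 e2 by (simp flip: ennreal_mult')
    show "(\<integral>\<^sup>+y. ?g x * ?g y * indicator A (c *\<^sub>R x + s *\<^sub>R y, c *\<^sub>R y - s *\<^sub>R x) \<partial>lborel)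
        = (\<integral>\<^sup>+u. ennreal (\<bar>1/s\<bar> ^ ?n) * (?g u * ?g ((1/s) *\<^sub>R (c *\<^sub>R u - x)) * indicator A (u, (1/s) *\<^sub>R (c *\<^sub>R u - x))) \<partial>lborel)"
      using s
      apply (subst nn_integral_lborel_affine[of _ "1/s" "- (c/s) *\<^sub>R x"])
        apply (measurable; simp)
       apply (simp; fail)
      unfolding e1 e2 e3
      apply (subst nn_integral_cmult)
       apply measurable
      done
  qed
  also have "\<dots> = (\<integral>\<^sup>+u. \<integral>\<^sup>+x. ennreal (\<bar>1/s\<bar> ^ ?n) * (?g u * ?g ((1/s) *\<^sub>R (c *\<^sub>R u - x)) * indicator A (u, (1/s) *\<^sub>R (c *\<^sub>R u - x))) \<partial>lborel \<partial>lborel)"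
    by (rule lborel_pair.Fubini') measurable
  also have "\<dots> = (\<integral>\<^sup>+u. \<integral>\<^sup>+v. ?g u * (?g v * indicator A (u, v)) \<partial>lborel \<partial>lborel)"
  proof (rule nn_integral_cong)
    fix u :: 'a
    have e: "(1/s) *\<^sub>R (c *\<^sub>R u - (c *\<^sub>R u + (- s) *\<^sub>R v)) = v" for v using s by simp
    have k: "ennreal (\<bar>s\<bar> ^ ?n) * ennreal ((1/\<bar>s\<bar>) ^ ?n) = 1"
      using s by (simp add: power_mult_distrib[symmetric] divide_simps flip: ennreal_mult' ennreal_1)
    show "(\<integral>\<^sup>+x. ennreal (\<bar>1/s\<bar> ^ ?n) * (?g u * ?g ((1/s) *\<^sub>R (c *\<^sub>R u - x)) * indicator A (u, (1/s) *\<^sub>R (c *\<^sub>R u - x))) \<partial>lborel)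
      = (\<integral>\<^sup>+v. ?g u * (?g v * indicator A (u, v)) \<partial>lborel)"
      using s
      apply (subst nn_integral_lborel_affine[of _ "- s" "c *\<^sub>R u"])
        apply measurable
       apply simp
      unfolding e
      apply (subst nn_integral_cmult)
       apply measurable
      unfolding mult.assoc[symmetric] k by simp
  qed
  also have "\<dots> = (\<integral>\<^sup>+x. \<integral>\<^sup>+y. indicator A (x, y) \<partial>gauss \<partial>gauss)"
    by (subst nn_integral_gauss, measurable)+ (simp add: nn_integral_gauss nn_integral_cmult)
  also have "\<dots> = emeasure gauss A"
    by (subst nn_integral_gauss_pair[symmetric]) auto
  finally show "emeasure ?D A = emeasure gauss A" .
qed simp

lemma integrable_gauss_bounded:
  fixes f :: "'a::euclidean_space \<Rightarrow> real"
  assumes "f \<in> borel_measurable borel" "\<And>x. \<bar>f x\<bar> \<le> B"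
  shows "integrable gauss f"
  using assms by (intro gauss.integrable_const_bound[of _ B]) auto

lemma abs_integral_gauss_le:
  fixes f :: "'a::euclidean_space \<Rightarrow> real"
  assumes "f \<in> borel_measurable borel" "\<And>x. \<bar>f x\<bar> \<le> B"
  shows "\<bar>\<integral>x. f x \<partial>gauss\<bar> \<le> B"
proof -
  have "\<bar>\<integral>x. f x \<partial>gauss\<bar> \<le> (\<integral>x. \<bar>f x\<bar> \<partial>gauss)"
    using integral_norm_bound[of gauss f] by simp
  also have "\<dots> \<le> (\<integral>x. B \<partial>(gauss::'a measure))"
    using assms order_trans[OF abs_ge_zero assms(2)]
    by (intro integral_mono integrable_gauss_bounded[of _ B]) auto
  finally show ?thesis using gauss.prob_space[where 'a='a] by simp
qed

lemma integral_gauss_pair: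
  fixes f :: "'a::euclidean_space \<times> 'b::euclidean_space \<Rightarrow> real"
  assumes "integrable gauss f"
  shows "(\<integral>z. f z \<partial>gauss) = (\<integral>x. \<integral>y. f (x, y) \<partial>gauss \<partial>gauss)"
proof -
  interpret pair_sigma_finite "gauss :: 'a measure" "gauss :: 'b measure" ..
  show ?thesis
    using integral_fst'[of f] assms by (simp add: gauss_pair)
qed

text \<open>Divided by \<sigma>, the coefficients are a cosine and a sine, and the corresponding
  rotation turns the combination into \<sigma> times the first block. For \<beta> = 0 the rotation
  lemma does not apply, but then \<sigma> = \<alpha> because \<open>\<alpha> \<ge> 0\<close>. The
  semigroup law of \<open>heat\<close> and the computation of marginals rest on this.\<close>

lemma distr_gauss_conv:
  fixes \<alpha> \<beta> :: real
  assumes "\<alpha> \<ge> 0"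
  shows "distr gauss borel (\<lambda>z. \<alpha> *\<^sub>R fst z + \<beta> *\<^sub>R snd z)
    = distr (gauss :: 'a::euclidean_space measure) borel (\<lambda>z. sqrt (\<alpha>\<^sup>2 + \<beta>\<^sup>2) *\<^sub>R z)"
proof -
  define \<sigma> where "\<sigma> = sqrt (\<alpha>\<^sup>2 + \<beta>\<^sup>2)"
  have fst: "distr gauss borel (\<lambda>z::'a\<times>'a. \<sigma> *\<^sub>R fst z) = distr (gauss :: 'a measure) borel (\<lambda>z. \<sigma> *\<^sub>R z)"
  proof (rule measure_eqI)
    fix A :: "'a set" assume "A \<in> sets (distr gauss borel (\<lambda>z::'a\<times>'a. \<sigma> *\<^sub>R fst z))"
    then have [measurable]: "A \<in> sets borel" by simp
    have "emeasure (distr gauss borel (\<lambda>z::'a\<times>'a. \<sigma> *\<^sub>R fst z)) A = (\<integral>\<^sup>+x. indicator A x \<partial>distr (gauss::('a\<times>'a) measure) borel (\<lambda>z::'a\<times>'a. \<sigma> *\<^sub>R fst z))" by simp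
    also have "\<dots> = (\<integral>\<^sup>+z. indicator A (\<sigma> *\<^sub>R fst z) \<partial>(gauss::('a\<times>'a) measure))"
      by (subst nn_integral_distr) auto
    also have "\<dots> = (\<integral>\<^sup>+x. \<integral>\<^sup>+y. indicator A (\<sigma> *\<^sub>R x) \<partial>(gauss::'a measure) \<partial>(gauss::'a measure))"
      by (subst nn_integral_gauss_pair) auto
    also have "\<dots> = (\<integral>\<^sup>+x. indicator A (\<sigma> *\<^sub>R x) \<partial>(gauss::'a measure))"
      using gauss.emeasure_space_1[where 'a='a] by simp
    also have "\<dots> = emeasure (distr gauss borel (\<lambda>z. \<sigma> *\<^sub>R z)) A"
      by (subst nn_integral_indicator[symmetric], simp, subst nn_integral_distr) auto
    finally show "emeasure (distr gauss borel (\<lambda>z::'a\<times>'a. \<sigma> *\<^sub>R fst z)) A = emeasure (distr gauss borel (\<lambda>z. \<sigma> *\<^sub>R z)) A" .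
  qed simp
  show ?thesis
  proof (cases "\<beta> = 0")
    case True
    then show ?thesis using fst \<open>\<alpha> \<ge> 0\<close> by (simp add: \<sigma>_def)
  next
    case False
    then have "\<sigma> > 0" by (simp add: \<sigma>_def sum_power2_gt_zero_iff)
    have sq: "\<sigma>\<^sup>2 = \<alpha>\<^sup>2 + \<beta>\<^sup>2" by (simp add: \<sigma>_def)
    have cs: "(\<alpha>/\<sigma>)\<^sup>2 + (\<beta>/\<sigma>)\<^sup>2 = 1"
      using \<open>\<sigma> > 0\<close> unfolding power_divide add_divide_distrib[symmetric] sq[symmetric] by simp
    let ?R = "\<lambda>z::'a\<times>'a. ((\<alpha>/\<sigma>) *\<^sub>R fst z + (\<beta>/\<sigma>) *\<^sub>R snd z, (\<alpha>/\<sigma>) *\<^sub>R snd z - (\<beta>/\<sigma>) *\<^sub>R fst z)"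
    have [measurable]: "?R \<in> borel_measurable borel"
      by (intro borel_measurable_continuous_onI continuous_intros)
    have "distr gauss borel (\<lambda>z::'a\<times>'a. \<alpha> *\<^sub>R fst z + \<beta> *\<^sub>R snd z)
        = distr gauss borel ((\<lambda>z. \<sigma> *\<^sub>R fst z) \<circ> ?R)"
      using \<open>\<sigma> > 0\<close> by (intro arg_cong[of _ _ "distr gauss borel"]) (auto simp: fun_eq_iff scaleR_add_right)
    also have "\<dots> = distr (distr gauss borel ?R) borel (\<lambda>z. \<sigma> *\<^sub>R fst z)"
      by (subst distr_distr) auto
    also have "distr gauss borel ?R = gauss"
      using cs False \<open>\<sigma> > 0\<close> by (intro distr_gauss_rot) auto
    finally show ?thesis using fst by (simp add: \<sigma>_def)
  qed
qed

lemma integral_gauss_conv: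
  fixes f :: "'a::euclidean_space \<Rightarrow> real"
  assumes f [measurable]: "f \<in> borel_measurable borel" and b: "\<And>x. \<bar>f x\<bar> \<le> B" and "\<alpha> \<ge> 0"
  shows "(\<integral>x. \<integral>y. f (\<alpha> *\<^sub>R x + \<beta> *\<^sub>R y) \<partial>gauss \<partial>gauss) = (\<integral>z. f (sqrt (\<alpha>\<^sup>2 + \<beta>\<^sup>2) *\<^sub>R z) \<partial>gauss)"
proof -
  have [measurable]: "(\<lambda>z::'a\<times>'a. \<alpha> *\<^sub>R fst z + \<beta> *\<^sub>R snd z) \<in> borel_measurable borel"
    by (intro borel_measurable_continuous_onI continuous_intros)
  have "(\<integral>x. \<integral>y. f (\<alpha> *\<^sub>R x + \<beta> *\<^sub>R y) \<partial>gauss \<partial>gauss) = (\<integral>z. f (\<alpha> *\<^sub>R fst z + \<beta> *\<^sub>R snd z) \<partial>gauss)"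
    using b by (subst integral_gauss_pair) (auto intro!: integrable_gauss_bounded)
  also have "\<dots> = (\<integral>z. f z \<partial>distr gauss borel (\<lambda>z. \<alpha> *\<^sub>R fst z + \<beta> *\<^sub>R snd z))"
    by (subst integral_distr) auto
  also have "\<dots> = (\<integral>z. f (sqrt (\<alpha>\<^sup>2 + \<beta>\<^sup>2) *\<^sub>R z) \<partial>gauss)"
    unfolding distr_gauss_conv[OF \<open>\<alpha> \<ge> 0\<close>] by (subst integral_distr) auto
  finally show ?thesis .
qed

section \<open>Independent coordinates, one-dimensional projections and moments\<close>

lemma emeasure_gauss_UNIV [simp]: "emeasure (gauss :: 'a::euclidean_space measure) UNIV = 1"
  and measure_gauss_UNIV [simp]: "measure (gauss :: 'a::euclidean_space measure) UNIV = 1"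
  using gauss.emeasure_space_1[where 'a='a] gauss.prob_space[where 'a='a] by simp_all

lemma prob_gauss_box:
  assumes "\<And>b. A b \<in> sets borel"
  shows "measure gauss {x :: 'a :: euclidean_space. \<forall>b\<in>Basis. x \<bullet> b \<in> A b} = (\<Prod>b\<in>(Basis::'a set). measure gauss (A b))"
proof -
  have "ennreal (measure gauss {x :: 'a. \<forall>b\<in>Basis. x \<bullet> b \<in> A b}) = ennreal (\<Prod>b\<in>(Basis::'a set). measure gauss (A b))"
    using emeasure_gauss_box[OF assms, where 'a='a]
    by (simp only: gauss.emeasure_eq_measure prod_ennreal measure_nonneg)
  then show ?thesis by (subst (asm) ennreal_inj) (auto intro: prod_nonneg)
qed

text \<open>A cylinder is a box whose remaining sides are \<open>UNIV\<close>. The variable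
  \<open>gauss_copula\<close>, here and in \<open>indep_vars_gauss_coord\<close>, is a set of basis
  vectors and has nothing to do with the copula function defined later.\<close>

lemma prob_gauss_cylinder:
  assumes gauss_copula: "gauss_copula \<subseteq> (Basis :: 'a::euclidean_space set)" and A: "\<And>b. A b \<in> sets borel"
  shows "measure gauss {x :: 'a. \<forall>b\<in>gauss_copula. x \<bullet> b \<in> A b} = (\<Prod>b\<in>gauss_copula. measure gauss (A b))"
proof -
  define A' where "A' b = (if b \<in> gauss_copula then A b else UNIV)" for b
  have "measure gauss {x :: 'a. \<forall>b\<in>gauss_copula. x \<bullet> b \<in> A b} = measure gauss {x :: 'a. \<forall>b\<in>Basis. x \<bullet> b \<in> A' b}"
    using gauss_copula by (intro arg_cong[of _ _ "measure gauss"]) (auto simp: A'_def)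
  also have "\<dots> = (\<Prod>b\<in>Basis. measure gauss (A' b))"
    using A by (intro prob_gauss_box) (auto simp: A'_def)
  also have "\<dots> = (\<Prod>b\<in>gauss_copula. measure gauss (A b))"
    using gauss_copula by (intro prod.mono_neutral_cong_right) (auto simp: A'_def)
  finally show ?thesis .
qed

lemma distributed_gauss_coord:
  assumes b: "b \<in> (Basis :: 'a::euclidean_space set)"
  shows "distributed gauss lborel (\<lambda>x::'a. x \<bullet> b) std_normal_density"
  unfolding distributed_def
proof (intro conjI)
  show "distr gauss lborel (\<lambda>x::'a. x \<bullet> b) = density lborel (\<lambda>x. ennreal (std_normal_density x))"
  proof (rule measure_eqI)
    fix A assume "A \<in> sets (distr gauss lborel (\<lambda>x::'a. x \<bullet> b))"
    then have A [measurable]: "A \<in> sets borel" by simp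
    have "measure gauss {x :: 'a. \<forall>b\<in>{b}. x \<bullet> b \<in> A} = (\<Prod>b\<in>{b}. measure gauss A)"
      using b by (intro prob_gauss_cylinder) auto
    then have "emeasure gauss {x :: 'a. x \<bullet> b \<in> A} = emeasure gauss A"
      by (simp add: gauss.emeasure_eq_measure)
    moreover have "(\<lambda>x. x \<bullet> b) -` A = {x. x \<bullet> b \<in> A}" by auto
    moreover have "(gauss :: real measure) = density lborel (\<lambda>x. ennreal (std_normal_density x))"
      by (simp add: gauss_def gauss_density_real)
    ultimately show "emeasure (distr gauss lborel (\<lambda>x::'a. x \<bullet> b)) A = emeasure (density lborel (\<lambda>x. ennreal (std_normal_density x))) A"
      by (simp add: emeasure_distr)
  qed simp
qed auto

lemma indep_vars_gauss_coord: "gauss.indep_vars (\<lambda>_. borel) (\<lambda>b x. x \<bullet> b) (Basis :: 'a::euclidean_space set)"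
  unfolding gauss.indep_vars_def2 gauss.indep_sets_def
proof (intro conjI ballI allI impI)
  fix gauss_copula A assume gauss_copula: "gauss_copula \<subseteq> (Basis :: 'a set)" "gauss_copula \<noteq> {}"
    and "A \<in> Pi gauss_copula (\<lambda>b. {(\<lambda>x. x \<bullet> b) -` A \<inter> space gauss |A. A \<in> sets borel})"
  then have "\<forall>b\<in>gauss_copula. \<exists>C. A b = (\<lambda>x. x \<bullet> b) -` C \<and> C \<in> sets borel" by (auto simp: Pi_iff)
  then obtain C where C: "\<And>b. b \<in> gauss_copula \<Longrightarrow> A b = (\<lambda>x. x \<bullet> b) -` C b" "\<And>b. b \<in> gauss_copula \<Longrightarrow> C b \<in> sets borel"
    by metis
  define C' where "C' b = (if b \<in> gauss_copula then C b else UNIV)" for b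
  have C': "C' b \<in> sets borel" for b using C by (auto simp: C'_def)
  have "measure gauss (A b) = measure gauss (C' b)" if "b \<in> gauss_copula" for b
  proof -
    have "A b = {x. \<forall>b\<in>{b}. x \<bullet> b \<in> C' b}" using that C by (auto simp: C'_def)
    then show ?thesis using prob_gauss_cylinder[of "{b}" C'] that gauss_copula C' by auto
  qed
  moreover have "(\<Inter>j\<in>gauss_copula. A j) = {x. \<forall>b\<in>gauss_copula. x \<bullet> b \<in> C' b}" using C gauss_copula by (auto simp: C'_def)
  ultimately show "measure gauss (\<Inter>j\<in>gauss_copula. A j) = (\<Prod>j\<in>gauss_copula. measure gauss (A j))"
    using prob_gauss_cylinder[OF gauss_copula(1) C'] by simp
next
  fix b :: 'a
  have "(\<lambda>x::'a. x \<bullet> b) -` A \<in> sets borel" if "A \<in> sets borel" for A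
    using measurable_sets[of "\<lambda>x::'a. x \<bullet> b" borel borel A] that by simp
  then show "{(\<lambda>x::'a. x \<bullet> b) -` A \<inter> space gauss |A. A \<in> sets borel} \<subseteq> sets gauss"
    by auto
qed auto

text \<open>The inner product is a sum of independent normal variables with variances
  \<open>(a \<bullet> b)\<^sup>2\<close>, which add up to 1. Coordinates with coefficient 0 are left
  out through \<open>I\<close>, since the summation rule for normal variables wants positive
  standard deviations.\<close>

lemma distr_gauss_inner:
  fixes a :: "'a::euclidean_space"
  assumes a: "norm a = 1"
  shows "distr gauss borel (\<lambda>x. a \<bullet> x) = gauss"
proof -
  define I where "I = {b\<in>Basis. a \<bullet> b \<noteq> 0}"
  have I: "finite I" "I \<subseteq> Basis" by (auto simp: I_def)
  have "(\<Sum>b\<in>I. (a \<bullet> b)\<^sup>2) = (\<Sum>b\<in>Basis. (a \<bullet> b)\<^sup>2)"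
    by (rule sum.mono_neutral_left) (auto simp: I_def)
  also have "\<dots> = a \<bullet> a"
    by (subst euclidean_inner) (simp add: power2_eq_square)
  also have "\<dots> = 1" using a by (simp add: dot_square_norm)
  finally have sum1: "(\<Sum>b\<in>I. (a \<bullet> b)\<^sup>2) = 1" .
  have rep: "(\<Sum>b\<in>I. (a \<bullet> b) * (x \<bullet> b)) = a \<bullet> x" for x
  proof -
    have "(\<Sum>b\<in>I. (a \<bullet> b) * (x \<bullet> b)) = (\<Sum>b\<in>Basis. (a \<bullet> b) * (x \<bullet> b))"
      by (rule sum.mono_neutral_left) (auto simp: I_def)
    also have "\<dots> = a \<bullet> x" by (subst (3) euclidean_inner) simp
    finally show ?thesis .
  qed
  have "distributed gauss lborel (\<lambda>x. \<Sum>b\<in>I. (a \<bullet> b) * (x \<bullet> b)) (normal_density (\<Sum>b\<in>I. 0) (sqrt (\<Sum>b\<in>I. \<bar>a \<bullet> b\<bar>\<^sup>2)))"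
  proof (rule gauss.sum_indep_normal)
    show "I \<noteq> {}" using sum1 by auto
    have "gauss.indep_vars (\<lambda>_. borel) (\<lambda>b x. x \<bullet> b) I"
      using indep_vars_gauss_coord I(2) by (rule gauss.indep_vars_subset)
    then show "gauss.indep_vars (\<lambda>_. borel) (\<lambda>b x. (a \<bullet> b) * (x \<bullet> b)) I"
      by (rule gauss.indep_vars_compose2) auto
    fix b assume b: "b \<in> I"
    then show "0 < \<bar>a \<bullet> b\<bar>" by (auto simp: I_def)
    have "distributed gauss lborel (\<lambda>x. 0 + (a \<bullet> b) * (x \<bullet> b)) (normal_density (0 + (a \<bullet> b) * 0) (\<bar>a \<bullet> b\<bar> * 1))"
      using b by (intro gauss.normal_density_affine distributed_gauss_coord) (auto simp: I_def)
    then show "distributed gauss lborel (\<lambda>x. (a \<bullet> b) * (x \<bullet> b)) (normal_density 0 \<bar>a \<bullet> b\<bar>)" by simp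
  qed (use I in auto)
  then have "distributed gauss lborel (\<lambda>x. a \<bullet> x) std_normal_density"
    by (simp add: rep sum1)
  then have "distr gauss lborel (\<lambda>x. a \<bullet> x) = gauss"
    by (simp add: distributed_def gauss_def gauss_density_real)
  then show ?thesis by (simp cong: distr_cong)
qed

lemma integrable_gauss_inner_pow: "integrable gauss (\<lambda>x. (v \<bullet> x) ^ k)" (is ?I)
  and integral_gauss_inner: "(\<integral>x. v \<bullet> x \<partial>gauss) = 0"
  and integral_gauss_inner_sq: "(\<integral>x. (v \<bullet> x)\<^sup>2 \<partial>gauss) = (norm (v :: 'a::euclidean_space))\<^sup>2"
proof -
  \<comment> \<open>The zero vector has no direction; any basis vector serves, as it is multiplied
    by \<open>norm v = 0\<close>.\<close>
  define a where "a = (if v = 0 then SOME i. i \<in> Basis else v /\<^sub>R norm v)"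
  have a: "norm a = 1" by (auto simp: a_def some_in_eq)
  have v: "v = norm v *\<^sub>R a" by (auto simp: a_def)
  have vx: "v \<bullet> x = norm v * (a \<bullet> x)" for x by (subst v) simp
  have g: "(gauss::real measure) = density lborel (\<lambda>x. ennreal (std_normal_density x))"
    by (simp add: gauss_def gauss_density_real)
  have i: "integrable (gauss::real measure) (\<lambda>x. x ^ k)" for k
    unfolding g by (subst integrable_density) (auto intro: integrable_std_normal_moment)
  then have j: "integrable gauss (\<lambda>x. (a \<bullet> x) ^ k)" for k
    unfolding distr_gauss_inner[OF a, symmetric] by (subst (asm) integrable_distr_eq) auto
  then show ?I unfolding vx power_mult_distrib by simp
  have eq: "(\<integral>x. (a \<bullet> x) ^ k \<partial>gauss) = (\<integral>x. std_normal_density x * x ^ k \<partial>lborel)" for k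
  proof -
    have "(\<integral>x. (a \<bullet> x) ^ k \<partial>gauss) = (\<integral>x. x ^ k \<partial>distr gauss borel (\<lambda>x. a \<bullet> x))"
      by (subst integral_distr) auto
    also have "\<dots> = (\<integral>x. std_normal_density x * x ^ k \<partial>lborel)"
      unfolding distr_gauss_inner[OF a] g by (subst integral_density) auto
    finally show ?thesis .
  qed
  have "(\<integral>x. (a \<bullet> x) \<partial>gauss) = 0"
    using eq[of 1] has_bochner_integral_integral_eq[OF std_normal_moment_odd[of 0]] by simp
  then show "(\<integral>x. v \<bullet> x \<partial>gauss) = 0" unfolding vx by simp
  have "(\<integral>x. (a \<bullet> x)\<^sup>2 \<partial>gauss) = 1"
    using eq[of 2] has_bochner_integral_integral_eq[OF std_normal_moment_even[of 1]] by simp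
  then show "(\<integral>x. (v \<bullet> x)\<^sup>2 \<partial>gauss) = (norm v)\<^sup>2" unfolding vx power_mult_distrib by simp
qed

lemma integrable_gauss_inner: "integrable gauss (\<lambda>x. v \<bullet> x)"
  using integrable_gauss_inner_pow[of v 1] by simp

text \<open>Polarisation of the second moment of a single projection.\<close>

lemma integrable_gauss_inner_mult: "integrable gauss (\<lambda>x. (v \<bullet> x) * (w \<bullet> x))" (is ?I)
  and integral_gauss_inner_mult: "(\<integral>x. (v \<bullet> x) * (w \<bullet> x) \<partial>gauss) = v \<bullet> (w :: 'a::euclidean_space)"
proof -
  have eq: "(v \<bullet> x) * (w \<bullet> x) = (((v + w) \<bullet> x)\<^sup>2 - ((v - w) \<bullet> x)\<^sup>2) / 4" for x
    by (simp add: inner_simps power2_eq_square algebra_simps)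
  show ?I unfolding eq by (intro integrable_divide Bochner_Integration.integrable_diff integrable_gauss_inner_pow)
  show "(\<integral>x. (v \<bullet> x) * (w \<bullet> x) \<partial>gauss) = v \<bullet> w"
    unfolding eq
    by (simp add: integrable_gauss_inner_pow integral_gauss_inner_sq)
       (simp add: power2_norm_eq_inner inner_simps inner_commute)
qed

text \<open>The dilation by sqrt 2 turns the density times the exponential back into the Gaussian
  density, up to the constant factor of the substitution. The exponent 1/4 is what makes this
  exact.\<close>

lemma integrable_gauss_exp_norm: "integrable gauss (\<lambda>x::'a::euclidean_space. exp ((norm x)\<^sup>2 / 4))"
proof (rule integrableI_nonneg)
  let ?c = "ennreal (\<bar>sqrt 2\<bar> ^ DIM('a))"
  have "(\<integral>\<^sup>+x. ennreal (exp ((norm x)\<^sup>2 / 4)) \<partial>(gauss::'a measure))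
     = (\<integral>\<^sup>+x. ennreal (gauss_density x) * ennreal (exp ((norm x)\<^sup>2 / 4)) \<partial>(lborel::'a measure))"
    by (subst nn_integral_gauss) auto
  also have "\<dots> = ?c * (\<integral>\<^sup>+x. ennreal (gauss_density (0 + sqrt 2 *\<^sub>R x)) * ennreal (exp ((norm (0 + sqrt 2 *\<^sub>R x))\<^sup>2 / 4)) \<partial>(lborel::'a measure))"
    by (subst nn_integral_lborel_affine[of _ "sqrt 2" 0]) auto
  also have "(\<lambda>x::'a. ennreal (gauss_density (0 + sqrt 2 *\<^sub>R x)) * ennreal (exp ((norm (0 + sqrt 2 *\<^sub>R x))\<^sup>2 / 4))) = (\<lambda>x. ennreal (gauss_density x) * 1)"
  proof
    fix x :: 'a
    have "exp (- (norm x)\<^sup>2) * exp ((norm x)\<^sup>2 / 2) = exp (- (norm x)\<^sup>2 / 2)"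
      unfolding exp_add[symmetric] by simp
    then have "gauss_density (0 + sqrt 2 *\<^sub>R x) * exp ((norm (0 + sqrt 2 *\<^sub>R x))\<^sup>2 / 4) = gauss_density x"
      by (simp add: gauss_density_def power_mult_distrib)
    then show "ennreal (gauss_density (0 + sqrt 2 *\<^sub>R x)) * ennreal (exp ((norm (0 + sqrt 2 *\<^sub>R x))\<^sup>2 / 4)) = ennreal (gauss_density x) * 1"
      by (simp flip: ennreal_mult'')
  qed
  also have "(\<integral>\<^sup>+x. ennreal (gauss_density x) * 1 \<partial>(lborel::'a measure)) = 1"
    by (subst nn_integral_gauss[symmetric]) auto
  finally show "(\<integral>\<^sup>+x. ennreal (exp ((norm x)\<^sup>2 / 4)) \<partial>(gauss::'a measure)) < \<infinity>"
    by (simp add: ennreal_mult_less_top flip: top.not_eq_extremum)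
qed auto

lemma exp_ge_pow_div_fact:
  fixes x :: real
  assumes "x \<ge> 0"
  shows "x ^ k / fact k \<le> exp x"
proof -
  have "x ^ k / fact k = (\<Sum>n\<in>{k}. inverse (fact n) *\<^sub>R x ^ n)" by (simp add: divide_inverse_commute)
  also have "\<dots> \<le> (\<Sum>n. inverse (fact n) *\<^sub>R x ^ n)"
    using assms by (intro sum_le_suminf summable_exp_generic) auto
  finally show ?thesis by (simp add: exp_def)
qed

text \<open>With t = |x|, the power is at most k! exp(1 + t), and 1 + t is at most 2 + t^2 / 4.
  These moments are needed to integrate the Taylor remainders of an interpolation step.\<close>

lemma integrable_gauss_norm_pow: "integrable gauss (\<lambda>x::'a::euclidean_space. (1 + norm x) ^ k)"
proof (rule Bochner_Integration.integrable_bound)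
  show "integrable gauss (\<lambda>x::'a. fact k * exp 2 * exp ((norm x)\<^sup>2 / 4))"
    by (intro integrable_mult_right integrable_gauss_exp_norm)
  have "(1 + norm x) ^ k \<le> fact k * exp 2 * exp ((norm x)\<^sup>2 / 4)" for x :: 'a
  proof -
    let ?t = "norm x"
    have "(1 + ?t) ^ k / fact k \<le> exp (1 + ?t)"
      using exp_ge_pow_div_fact[of "1 + ?t" k] by simp
    also have "1 + ?t \<le> 2 + ?t\<^sup>2 / 4"
      using zero_le_power2[of "?t / 2 - 1"] by (simp add: power2_eq_square algebra_simps)
    finally have "(1 + ?t) ^ k / fact k \<le> exp 2 * exp (?t\<^sup>2 / 4)"
      unfolding exp_add by simp
    then show ?thesis by (simp add: pos_divide_le_eq mult_ac)
  qed
  then show "AE x in gauss. norm ((1 + norm (x::'a)) ^ k) \<le> norm (fact k * exp 2 * exp ((norm x)\<^sup>2 / 4))"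
    by (intro AE_I2) (simp add: abs_mult)
qed auto

text \<open>Completing the square in the exponent. A shift of the argument becomes a weight that is
  smooth in the shift, so averages of merely measurable functions can be expanded in it.\<close>

lemma cameron_martin_gauss:
  "distr gauss borel (\<lambda>x. x + v) = density gauss (\<lambda>x. ennreal (exp (x \<bullet> v - (norm (v::'a::euclidean_space))\<^sup>2 / 2)))"
proof (rule measure_eqI)
  fix A :: "'a set" assume "A \<in> sets (distr gauss borel (\<lambda>x. x + v))"
  then have [measurable]: "A \<in> sets borel" by simp
  have "emeasure (distr gauss borel (\<lambda>x. x + v)) A = (\<integral>\<^sup>+x. ennreal (gauss_density x) * indicator A (x + v) \<partial>lborel)"
    by (subst nn_integral_indicator[symmetric], simp, subst nn_integral_distr, measurable, subst nn_integral_gauss, measurable)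
  also have "\<dots> = (\<integral>\<^sup>+x. ennreal (gauss_density (x - v)) * indicator A x \<partial>lborel)"
    by (subst nn_integral_lborel_affine[of _ 1 "-v"]) (auto simp: algebra_simps)
  also have "\<dots> = (\<integral>\<^sup>+x. ennreal (gauss_density x) * (ennreal (exp (x \<bullet> v - (norm v)\<^sup>2 / 2)) * indicator A x) \<partial>lborel)"
  proof (rule nn_integral_cong)
    fix x :: 'a
    have "- (norm x)\<^sup>2 / 2 + (x \<bullet> v - (norm v)\<^sup>2 / 2) = - (norm (x - v))\<^sup>2 / 2"
      unfolding power2_norm_eq_inner by (simp add: inner_simps inner_commute field_simps)
    then have "gauss_density x * exp (x \<bullet> v - (norm v)\<^sup>2 / 2) = gauss_density (x - v)"
      unfolding gauss_density_def mult.assoc exp_add[symmetric] by simp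
    then show "ennreal (gauss_density (x - v)) * indicator A x = ennreal (gauss_density x) * (ennreal (exp (x \<bullet> v - (norm v)\<^sup>2 / 2)) * indicator A x)"
      by (simp add: mult.assoc[symmetric] flip: ennreal_mult'')
  qed
  also have "\<dots> = emeasure (density gauss (\<lambda>x. ennreal (exp (x \<bullet> v - (norm v)\<^sup>2 / 2)))) A"
    by (subst nn_integral_gauss[symmetric]) (auto simp: emeasure_density)
  finally show "emeasure (distr gauss borel (\<lambda>x. x + v)) A = emeasure (density gauss (\<lambda>x. ennreal (exp (x \<bullet> v - (norm v)\<^sup>2 / 2)))) A" .
qed simp

lemma integral_gauss_translate:
  fixes f :: "'a::euclidean_space \<Rightarrow> real"
  assumes [measurable]: "f \<in> borel_measurable borel"
  shows "(\<integral>x. f (x + v) \<partial>gauss) = (\<integral>x. exp (x \<bullet> v - (norm v)\<^sup>2 / 2) * f x \<partial>gauss)"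
    and "integrable gauss (\<lambda>x. f (x + v)) \<longleftrightarrow> integrable gauss (\<lambda>x. exp (x \<bullet> v - (norm v)\<^sup>2 / 2) * f x)"
proof -
  have "(\<integral>x. f (x + v) \<partial>gauss) = (\<integral>x. f x \<partial>distr gauss borel (\<lambda>x. x + v))"
    by (subst integral_distr) auto
  also have "\<dots> = (\<integral>x. exp (x \<bullet> v - (norm v)\<^sup>2 / 2) * f x \<partial>gauss)"
    unfolding cameron_martin_gauss by (subst integral_density) auto
  finally show "(\<integral>x. f (x + v) \<partial>gauss) = (\<integral>x. exp (x \<bullet> v - (norm v)\<^sup>2 / 2) * f x \<partial>gauss)" .
  have "integrable gauss (\<lambda>x. f (x + v)) \<longleftrightarrow> integrable (distr gauss borel (\<lambda>x. x + v)) f"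
    by (subst integrable_distr_eq) auto
  also have "\<dots> \<longleftrightarrow> integrable gauss (\<lambda>x. exp (x \<bullet> v - (norm v)\<^sup>2 / 2) * f x)"
    unfolding cameron_martin_gauss by (subst integrable_density) auto
  finally show "integrable gauss (\<lambda>x. f (x + v)) \<longleftrightarrow> integrable gauss (\<lambda>x. exp (x \<bullet> v - (norm v)\<^sup>2 / 2) * f x)" .
qed

section \<open>The heat semigroup\<close>

text \<open>With q = |v|^2, the error Z - 1 - v . x has second moment exp q - 1 - q, since the mixed
  moments of Z come from translating the Gaussian. For q <= 1 this is at most q^2, which bounds the
  first absolute moment by q. For q > 1 the triangle inequality gives 2 + (1 + q) / 2, which is
  below 3 q.\<close>

lemma gauss_exp_linear_error:
  fixes v :: "'a::euclidean_space"
  shows "integrable gauss (\<lambda>x. exp (x \<bullet> v - (norm v)\<^sup>2 / 2))"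
    and "(\<integral>x. \<bar>exp (x \<bullet> v - (norm v)\<^sup>2 / 2) - 1 - v \<bullet> x\<bar> \<partial>gauss) \<le> 3 * (norm v)\<^sup>2"
proof -
  define q where "q = (norm v)\<^sup>2"
  have q0: "q \<ge> 0" by (simp add: q_def)
  define Z where "Z x = exp (x \<bullet> v - (norm v)\<^sup>2 / 2)" for x :: 'a
  have [measurable]: "Z \<in> borel_measurable borel" unfolding Z_def[abs_def] by measurable
  have iZ: "integrable gauss Z" using integral_gauss_translate(2)[of "\<lambda>_. 1" v] by (simp add: Z_def[abs_def])
  then show "integrable gauss (\<lambda>x. exp (x \<bullet> v - (norm v)\<^sup>2 / 2))" by (simp add: Z_def[abs_def])
  have Z1: "(\<integral>x. Z x \<partial>gauss) = 1" using integral_gauss_translate(1)[of "\<lambda>_. 1" v] by (simp add: Z_def)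
  have Zsq: "(Z x)\<^sup>2 = exp q * exp (x \<bullet> (2 *\<^sub>R v) - (norm (2 *\<^sub>R v))\<^sup>2 / 2)" for x
    unfolding Z_def exp_double[symmetric] exp_add[symmetric] q_def by (simp add: power_mult_distrib algebra_simps)
  have iZ2: "integrable gauss (\<lambda>x. (Z x)\<^sup>2)" unfolding Zsq
    using integral_gauss_translate(2)[of "\<lambda>_. 1" "2 *\<^sub>R v"] by simp
  have Z2: "(\<integral>x. (Z x)\<^sup>2 \<partial>gauss) = exp q" unfolding Zsq
    using integral_gauss_translate(1)[of "\<lambda>_. 1" "2 *\<^sub>R v"] by simp
  have iL: "integrable gauss (\<lambda>x. v \<bullet> x)" by (rule integrable_gauss_inner)
  have iL2: "integrable gauss (\<lambda>x. (v \<bullet> x)\<^sup>2)" by (rule integrable_gauss_inner_pow)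
  have iT: "integrable gauss (\<lambda>x. v \<bullet> (x + v))"
    unfolding inner_add_right using iL by simp
  have iZL: "integrable gauss (\<lambda>x. Z x * (v \<bullet> x))"
    using integral_gauss_translate(2)[of "\<lambda>x. v \<bullet> x" v] iT by (simp add: Z_def)
  have ZL: "(\<integral>x. Z x * (v \<bullet> x) \<partial>gauss) = q"
  proof -
    have "(\<integral>x. Z x * (v \<bullet> x) \<partial>gauss) = (\<integral>x. v \<bullet> (x + v) \<partial>gauss)"
      using integral_gauss_translate(1)[of "\<lambda>x. v \<bullet> x" v] by (simp add: Z_def)
    also have "\<dots> = q" unfolding inner_add_right
      using iL by (simp add: integral_gauss_inner q_def power2_norm_eq_inner)
    finally show ?thesis .
  qed
  have sq: "(Z x - 1 - v \<bullet> x)\<^sup>2 = (Z x)\<^sup>2 + 1 + (v \<bullet> x)\<^sup>2 - 2 * Z x - 2 * (Z x * (v \<bullet> x)) + 2 * (v \<bullet> x)" for x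
    by (simp add: power2_eq_square algebra_simps)
  have iS: "integrable gauss (\<lambda>x. (Z x - 1 - v \<bullet> x)\<^sup>2)"
    unfolding sq using iZ iZ2 iL iL2 iZL by simp
  have S: "(\<integral>x. (Z x - 1 - v \<bullet> x)\<^sup>2 \<partial>gauss) = exp q - 1 - q"
    unfolding sq using iZ iZ2 iL iL2 iZL
    by (simp add: Z1 Z2 ZL integral_gauss_inner integral_gauss_inner_sq q_def[symmetric])
  have iA: "integrable gauss (\<lambda>x. \<bar>Z x - 1 - v \<bullet> x\<bar>)" using iZ iL by simp
  have "(\<integral>x. \<bar>Z x - 1 - v \<bullet> x\<bar> \<partial>gauss) \<le> 3 * q"
  proof (cases "q \<le> 1")
    case False
    have "(\<integral>x. \<bar>Z x - 1 - v \<bullet> x\<bar> \<partial>gauss) \<le> (\<integral>x. Z x + 1 + (1 + (v \<bullet> x)\<^sup>2) / 2 \<partial>gauss)"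
    proof (rule integral_mono[OF iA])
      fix x
      have "\<bar>v \<bullet> x\<bar> \<le> (1 + (v \<bullet> x)\<^sup>2) / 2"
        using zero_le_power2[of "\<bar>v \<bullet> x\<bar> - 1"] by (simp add: power2_eq_square algebra_simps)
      moreover have "Z x > 0" by (simp add: Z_def)
      ultimately show "\<bar>Z x - 1 - v \<bullet> x\<bar> \<le> Z x + 1 + (1 + (v \<bullet> x)\<^sup>2) / 2" by linarith
    qed (use iZ iL2 in simp)
    also have "\<dots> = 1 + 1 + (1 + q) / 2"
      using iZ iL2 by (simp add: Z1 integral_gauss_inner_sq q_def[symmetric] add_divide_distrib)
    finally show ?thesis using False by (simp add: field_simps)
  next
    case True
    show ?thesis
    proof (cases "q = 0")
      case True
      then show ?thesis by (simp add: Z_def q_def)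
    next
      case False
      then have "q > 0" using q0 by simp
      \<comment> \<open>The arithmetic-geometric mean inequality with weight q, which is balanced
        because the second moment of the error is of size q^2.\<close>
      have "(\<integral>x. \<bar>Z x - 1 - v \<bullet> x\<bar> \<partial>gauss) \<le> (\<integral>x. ((Z x - 1 - v \<bullet> x)\<^sup>2 / q + q) / 2 \<partial>gauss)"
      proof (rule integral_mono[OF iA])
        fix x
        let ?A = "\<bar>Z x - 1 - v \<bullet> x\<bar>"
        have "0 \<le> (?A - q)\<^sup>2" by simp
        then have "2 * ?A * q \<le> ?A\<^sup>2 + q\<^sup>2" by (simp add: power2_eq_square algebra_simps)
        then have "?A \<le> (?A\<^sup>2 / q + q) / 2" using \<open>q > 0\<close> by (simp add: field_simps power2_eq_square)
        then show "?A \<le> ((Z x - 1 - v \<bullet> x)\<^sup>2 / q + q) / 2" by simp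
      qed (use iS in simp)
      also have "\<dots> = ((exp q - 1 - q) / q + q) / 2"
        using iS S by (simp add: add_divide_distrib)
      also have "exp q - 1 - q \<le> q\<^sup>2" using exp_bound[of q] q0 True by simp
      also have "(q\<^sup>2 / q + q) / 2 = q" using \<open>q > 0\<close> by (simp add: power2_eq_square)
      finally show ?thesis using \<open>q > 0\<close> by (simp add: divide_right_mono)
    qed
  qed
  then show "(\<integral>x. \<bar>exp (x \<bullet> v - (norm v)\<^sup>2 / 2) - 1 - v \<bullet> x\<bar> \<partial>gauss) \<le> 3 * (norm v)\<^sup>2"
    by (simp add: Z_def q_def)
qed

text \<open>Here \<tau> is the variance of the added noise, so parameters add under composition. The
  Ornstein-Uhlenbeck operator is recovered as \<open>heat (1 - \<rho>\<^sup>2) f\<close> evaluated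
  at \<rho> x.\<close>

definition heat :: "real \<Rightarrow> ('a::euclidean_space \<Rightarrow> real) \<Rightarrow> 'a \<Rightarrow> real" where
  "heat \<tau> f x = (\<integral>z. f (x + sqrt \<tau> *\<^sub>R z) \<partial>gauss)"

lemma borel_measurable_heat [measurable]:
  assumes [measurable]: "f \<in> borel_measurable borel"
  shows "heat \<tau> f \<in> borel_measurable borel"
proof -
  have "(\<lambda>(x, z). f (x + sqrt \<tau> *\<^sub>R z)) \<in> borel_measurable (borel \<Otimes>\<^sub>M gauss)"
    by measurable
  from gauss.borel_measurable_lebesgue_integral[OF this] show ?thesis
    by (simp add: heat_def[abs_def])
qed

lemma integrable_heat:
  fixes f :: "'a::euclidean_space \<Rightarrow> real"
  assumes [measurable]: "f \<in> borel_measurable borel" and "\<And>x. \<bar>f x\<bar> \<le> B"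
  shows "integrable gauss (\<lambda>z. f (x + sqrt \<tau> *\<^sub>R z))"
  using assms(2) by (intro integrable_gauss_bounded[of _ B]) auto

lemma heat_bounds:
  assumes [measurable]: "f \<in> borel_measurable borel" and lu: "\<And>x. f x \<in> {l..u}"
  shows "heat \<tau> f x \<in> {l..u}"
proof -
  have i: "integrable gauss (\<lambda>z. f (x + sqrt \<tau> *\<^sub>R z))"
  proof (rule integrable_heat[of _ "\<bar>l\<bar> + \<bar>u\<bar>"])
    show "\<bar>f x\<bar> \<le> \<bar>l\<bar> + \<bar>u\<bar>" for x using lu[of x] by auto
  qed measurable
  show ?thesis
    unfolding heat_def using lu i by (auto intro!: gauss.integral_ge_const gauss.integral_le_const)
qed

lemma heat_heat:
  assumes [measurable]: "f \<in> borel_measurable borel" and b: "\<And>x. \<bar>f x\<bar> \<le> B" and "0 \<le> s" "0 \<le> t"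
  shows "heat s (heat t f) x = heat (s + t) f x"
proof -
  have "(\<integral>z. \<integral>y. f (x + (sqrt s *\<^sub>R z + sqrt t *\<^sub>R y)) \<partial>gauss \<partial>gauss)
      = (\<integral>z. f (x + sqrt ((sqrt s)\<^sup>2 + (sqrt t)\<^sup>2) *\<^sub>R z) \<partial>gauss)"
    using b \<open>0 \<le> s\<close> by (intro integral_gauss_conv[where f="\<lambda>y. f (x + y)"]) auto
  then show ?thesis using assms by (simp add: heat_def add.assoc)
qed

text \<open>The shift v is moved onto the Gaussian weight, where it is v / sqrt \<tau>; the weight
  is 1 plus a linear term up to an error of order |v|^2 / \<tau> in mean. Only a vector D with a
  quadratic error bound is produced, which is all that later steps use of differentiability.\<close>

lemma heat_taylor:
  fixes f :: "'a::euclidean_space \<Rightarrow> real"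
  assumes [measurable]: "f \<in> borel_measurable borel" and b: "\<And>x. \<bar>f x\<bar> \<le> 1" and "\<tau> > 0"
  obtains D where "\<And>v. \<bar>heat \<tau> f (x + v) - heat \<tau> f x - D \<bullet> v\<bar> \<le> 3 / \<tau> * (norm v)\<^sup>2"
proof
  let ?F = "\<lambda>z. f (x + sqrt \<tau> *\<^sub>R z)"
  \<comment> \<open>This is the gradient by Gaussian integration by parts: the mean of f(x + sqrt
    \<tau> z) z / sqrt \<tau>, written out by coordinates.\<close>
  define D where "D = (\<Sum>b\<in>Basis. (\<integral>z. ?F z * (b \<bullet> z) / sqrt \<tau> \<partial>gauss) *\<^sub>R b)"
  have iF: "integrable gauss (\<lambda>z. ?F z * g z)" if "integrable gauss g" for g
  proof (rule Bochner_Integration.integrable_bound[OF that])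
    show "(\<lambda>z. ?F z * g z) \<in> borel_measurable gauss"
      using borel_measurable_integrable[OF that] by measurable
    show "AE z in gauss. norm (?F z * g z) \<le> norm (g z)"
      using b by (intro AE_I2) (simp add: abs_mult mult_left_le_one_le)
  qed
  fix v :: 'a
  define w where "w = v /\<^sub>R sqrt \<tau>"
  have v: "v = sqrt \<tau> *\<^sub>R w" using \<open>\<tau> > 0\<close> by (simp add: w_def)
  have nw: "(norm w)\<^sup>2 = (norm v)\<^sup>2 / \<tau>"
    using \<open>\<tau> > 0\<close> by (simp add: w_def power_divide divide_inverse_commute power_mult_distrib power_inverse)
  let ?Z = "\<lambda>z. exp (z \<bullet> w - (norm w)\<^sup>2 / 2)"
  have e1: "heat \<tau> f (x + v) = (\<integral>z. ?F z * ?Z z \<partial>gauss)"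
  proof -
    have "heat \<tau> f (x + v) = (\<integral>z. ?F (z + w) \<partial>gauss)"
      by (simp add: heat_def v algebra_simps)
    also have "\<dots> = (\<integral>z. ?Z z * ?F z \<partial>gauss)"
      by (intro integral_gauss_translate) measurable
    finally show ?thesis by (simp add: mult.commute)
  qed
  have e2: "D \<bullet> v = (\<integral>z. ?F z * (w \<bullet> z) \<partial>gauss)"
  proof -
    have "D \<bullet> v = (\<Sum>b\<in>Basis. (\<integral>z. ?F z * (b \<bullet> z) / sqrt \<tau> \<partial>gauss) * (b \<bullet> v))"
      by (simp only: D_def inner_sum_left inner_scaleR_left)
    also have "\<dots> = (\<Sum>b\<in>Basis. (\<integral>z. ?F z * ((w \<bullet> b) * (b \<bullet> z)) \<partial>gauss))"
    proof (rule sum.cong[OF refl])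
      fix b :: 'a
      have "(\<integral>z. ?F z * (b \<bullet> z) / sqrt \<tau> \<partial>gauss) * (b \<bullet> v) = (\<integral>z. ?F z * (b \<bullet> z) / sqrt \<tau> * (b \<bullet> v) \<partial>gauss)"
        by (rule integral_mult_left_zero[symmetric])
      also have "(\<lambda>z. ?F z * (b \<bullet> z) / sqrt \<tau> * (b \<bullet> v)) = (\<lambda>z. ?F z * ((w \<bullet> b) * (b \<bullet> z)))"
        using \<open>\<tau> > 0\<close> by (auto simp: v fun_eq_iff inner_commute)
      finally show "(\<integral>z. ?F z * (b \<bullet> z) / sqrt \<tau> \<partial>gauss) * (b \<bullet> v) = (\<integral>z. ?F z * ((w \<bullet> b) * (b \<bullet> z)) \<partial>gauss)" .
    qed
    also have "\<dots> = (\<integral>z. (\<Sum>b\<in>Basis. ?F z * ((w \<bullet> b) * (b \<bullet> z))) \<partial>gauss)"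
      by (intro Bochner_Integration.integral_sum[symmetric] iF integrable_mult_right integrable_gauss_inner)
    also have "(\<lambda>z. (\<Sum>b\<in>Basis. ?F z * ((w \<bullet> b) * (b \<bullet> z)))) = (\<lambda>z. ?F z * (w \<bullet> z))"
      by (rule ext, subst (2) euclidean_inner) (simp add: sum_distrib_left inner_commute)
    finally show ?thesis .
  qed
  have i: "integrable gauss ?Z" "integrable gauss (\<lambda>z. w \<bullet> z)" "integrable gauss (\<lambda>_::'a. 1::real)"
    by (simp_all add: gauss_exp_linear_error(1) integrable_gauss_inner)
  have eq: "heat \<tau> f (x + v) - heat \<tau> f x - D \<bullet> v = (\<integral>z. ?F z * ?Z z - ?F z * 1 - ?F z * (w \<bullet> z) \<partial>gauss)"
    unfolding Bochner_Integration.integral_diff[OF Bochner_Integration.integrable_diff[OF iF[OF i(1)] iF[OF i(3)]] iF[OF i(2)]]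
      Bochner_Integration.integral_diff[OF iF[OF i(1)] iF[OF i(3)]]
    by (simp only: e1 e2 mult_1_right) (simp only: heat_def)
  have "\<bar>heat \<tau> f (x + v) - heat \<tau> f x - D \<bullet> v\<bar> \<le> (\<integral>z. \<bar>?F z * ?Z z - ?F z * 1 - ?F z * (w \<bullet> z)\<bar> \<partial>gauss)"
    unfolding eq by (rule integral_abs_bound)
  also have "\<dots> \<le> (\<integral>z. \<bar>?Z z - 1 - w \<bullet> z\<bar> \<partial>gauss)"
  proof (rule integral_mono)
    show "integrable gauss (\<lambda>z. \<bar>?F z * ?Z z - ?F z * 1 - ?F z * (w \<bullet> z)\<bar>)"
      by (rule integrable_abs[OF Bochner_Integration.integrable_diff[OF Bochner_Integration.integrable_diff[OF iF[OF i(1)] iF[OF i(3)]] iF[OF i(2)]]])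
    show "integrable gauss (\<lambda>z. \<bar>?Z z - 1 - w \<bullet> z\<bar>)"
      by (rule integrable_abs[OF Bochner_Integration.integrable_diff[OF Bochner_Integration.integrable_diff[OF i(1) i(3)] i(2)]])
    fix z
    have "\<bar>?F z * ?Z z - ?F z * 1 - ?F z * (w \<bullet> z)\<bar> = \<bar>?F z\<bar> * \<bar>?Z z - 1 - w \<bullet> z\<bar>"
      unfolding abs_mult[symmetric] by (simp add: algebra_simps)
    also have "\<dots> \<le> \<bar>?Z z - 1 - w \<bullet> z\<bar>" using b by (simp add: mult_left_le_one_le)
    finally show "\<bar>?F z * ?Z z - ?F z * 1 - ?F z * (w \<bullet> z)\<bar> \<le> \<bar>?Z z - 1 - w \<bullet> z\<bar>" .
  qed
  also have "\<dots> \<le> 3 * (norm w)\<^sup>2" by (rule gauss_exp_linear_error)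
  finally show "\<bar>heat \<tau> f (x + v) - heat \<tau> f x - D \<bullet> v\<bar> \<le> 3 / \<tau> * (norm v)\<^sup>2"
    by (simp add: nw)
qed

section \<open>The normal distribution function\<close>

abbreviation gauss1 :: "real measure" where "gauss1 \<equiv> gauss"

lemma std_normal_density_pos [simp]: "0 < std_normal_density x"
  by (rule normal_density_pos) simp

definition Phi :: "real \<Rightarrow> real" where "Phi s = measure gauss1 {..s}"

lemma integral_gauss1: "f \<in> borel_measurable borel \<Longrightarrow> (\<integral>x. f x \<partial>gauss1) = (\<integral>x. std_normal_density x * f x \<partial>lborel)"
  for f :: "real \<Rightarrow> real"
  unfolding gauss_def gauss_density_real by (subst integral_density) auto

text \<open>The weight \<open>k\<close> lets one lemma differentiate both \<open>Phi\<close> (with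
  \<open>k\<close> constantly 1) and the bivariate distribution function in its first
  argument.\<close>

lemma DERIV_gauss_atMost_integral:
  fixes k :: "real \<Rightarrow> real"
  assumes k: "continuous_on UNIV k" and b: "\<And>x. \<bar>k x\<bar> \<le> B"
  shows "((\<lambda>s. \<integral>x. indicator {..s} x * k x \<partial>gauss1) has_real_derivative std_normal_density s * k s) (at s)"
proof -
  have [measurable]: "k \<in> borel_measurable borel" using k by (rule borel_measurable_continuous_onI)
  let ?g = "\<lambda>x. std_normal_density x * k x"
  let ?F = "\<lambda>s. \<integral>x. indicator {..s} x * k x \<partial>gauss1"
  \<comment> \<open>The fundamental theorem of calculus is applied on the compact interval from c to
    s + 1, which has s in its interior; the integral up to c is a constant.\<close>
  define c where "c = s - 1"
  have B0: "B \<ge> 0" using b[of 0] by linarith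
  have i: "integrable gauss1 (\<lambda>x. indicator A x * k x)" if "A \<in> sets borel" for A
  proof (rule integrable_gauss_bounded[of _ B])
    show "(\<lambda>x. indicator A x * k x) \<in> borel_measurable borel" using that by measurable
    show "\<bar>indicator A x * k x\<bar> \<le> B" for x using b[of x] B0 by (auto simp: indicator_def)
  qed
  have cg: "continuous_on {c..s + 1} ?g"
    unfolding normal_density_def by (intro continuous_intros continuous_on_subset[OF k]) auto
  have "((\<lambda>u. LBINT y=c..u. ?g y) has_vector_derivative ?g s) (at s within {c..s+1})"
    using cg by (intro interval_integral_FTC2) (auto simp: c_def)
  then have D: "((\<lambda>u. ?F c + (LBINT y=c..u. ?g y)) has_real_derivative ?g s) (at s within {c..s+1})"
    unfolding has_real_derivative_iff_has_vector_derivative[symmetric]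
    by (auto intro!: derivative_eq_intros)
  have eq: "?F c + (LBINT y=c..u. ?g y) = ?F u" if "u \<in> {c..s+1}" for u
  proof -
    have "(LBINT y=c..u. ?g y) = (\<integral>x. std_normal_density x * (indicator {c<..u} x * k x) \<partial>lborel)"
      using that by (simp add: interval_integral_Ioc set_lebesgue_integral_def mult_ac)
    also have "\<dots> = (\<integral>x. indicator {c<..u} x * k x \<partial>gauss1)"
      by (subst integral_gauss1) auto
    finally have "?F c + (LBINT y=c..u. ?g y) = (\<integral>x. indicator {..c} x * k x + indicator {c<..u} x * k x \<partial>gauss1)"
      by (simp add: i)
    also have "\<dots> = ?F u" using that by (intro Bochner_Integration.integral_cong) (auto simp: indicator_def)
    finally show ?thesis .
  qed
  have "(?F has_real_derivative ?g s) (at s within {c..s+1})"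
    by (rule has_field_derivative_transform_within[OF D, where d=1]) (use eq in \<open>auto simp: c_def\<close>)
  then show ?thesis
    by (subst (asm) at_within_interior) (auto simp: c_def)
qed

lemma Phi_eq_integral: "Phi s = (\<integral>x. indicator {..s} x \<partial>gauss1)"
  by (simp add: Phi_def)

lemma DERIV_Phi [derivative_intros]:
  assumes "(f has_real_derivative f') (at x within S)"
  shows "((\<lambda>x. Phi (f x)) has_real_derivative std_normal_density (f x) * f') (at x within S)"
proof -
  have "(Phi has_real_derivative std_normal_density y) (at y)" for y
    using DERIV_gauss_atMost_integral[of "\<lambda>_. 1" 1 y] by (simp add: Phi_eq_integral[abs_def])
  from DERIV_chain2[OF this assms] show ?thesis .
qed

lemma isCont_Phi: "isCont Phi x"
  using DERIV_Phi[OF DERIV_ident, of x UNIV] DERIV_isCont by simp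

lemma continuous_on_Phi [continuous_intros]: "continuous_on S f \<Longrightarrow> continuous_on S (\<lambda>x. Phi (f x))"
  by (intro continuous_on_compose2[of UNIV Phi S f] continuous_at_imp_continuous_on) (auto intro: isCont_Phi)

lemma borel_measurable_Phi [measurable]: "Phi \<in> borel_measurable borel"
  by (intro borel_measurable_continuous_onI continuous_intros)

lemma DERIV_Phi_at: "(Phi has_real_derivative std_normal_density x) (at x)"
  using DERIV_Phi[OF DERIV_ident, of x UNIV] by simp

lemma Phi_strict_mono: "x < y \<Longrightarrow> Phi x < Phi y"
  using DERIV_Phi_at std_normal_density_pos by (intro DERIV_pos_imp_increasing[of x y Phi]) blast+

lemma Phi_less_iff [simp]: "Phi x < Phi y \<longleftrightarrow> x < y"
  by (metis Phi_strict_mono linorder_neqE_linordered_idom order_less_imp_not_less)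

lemma Phi_le_iff [simp]: "Phi x \<le> Phi y \<longleftrightarrow> x \<le> y"
  by (simp flip: not_less)

lemma Phi_eq_iff [simp]: "Phi x = Phi y \<longleftrightarrow> x = y"
  by (metis Phi_less_iff less_irrefl linorder_neqE_linordered_idom)

lemma Phi_pos: "0 < Phi x" and Phi_less_1: "Phi x < 1"
proof -
  have "0 \<le> Phi (x - 1)" "Phi (x + 1) \<le> 1" by (simp_all add: Phi_def)
  moreover have "Phi (x - 1) < Phi x" "Phi x < Phi (x + 1)" by simp_all
  ultimately show "0 < Phi x" "Phi x < 1" by linarith+
qed

lemma integral_gauss_uminus:
  fixes f :: "'a::euclidean_space \<Rightarrow> real"
  assumes [measurable]: "f \<in> borel_measurable borel"
  shows "(\<integral>x. f (- x) \<partial>gauss) = (\<integral>x. f x \<partial>gauss)"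
proof -
  have "(\<integral>x. f x \<partial>distr gauss borel uminus) = (\<integral>x. f (- x) \<partial>gauss)"
    by (subst integral_distr) auto
  then show ?thesis by (simp add: distr_gauss_uminus)
qed

lemma integral_gauss1_affine:
  assumes "r > 0"
  shows "(\<integral>z. indicator {..t} (c + r * z) \<partial>gauss1) = Phi ((t - c) / r)"
    and "(\<integral>z. indicator {..t} (c - r * z) \<partial>gauss1) = Phi ((t - c) / r)"
proof -
  have eq: "indicator {..t} (c + r * z) = (indicator {..(t - c) / r} z :: real)" for z
    using assms by (auto simp: indicator_def field_simps)
  show *: "(\<integral>z. indicator {..t} (c + r * z) \<partial>gauss1) = Phi ((t - c) / r)"
    unfolding eq Phi_eq_integral ..
  show "(\<integral>z. indicator {..t} (c - r * z) \<partial>gauss1) = Phi ((t - c) / r)"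
    unfolding *[symmetric] by (subst integral_gauss_uminus[symmetric]) auto
qed

lemma Phi_minus: "Phi (- s) = 1 - Phi s"
proof -
  have "Phi (- s) = (\<integral>z. indicator {..- s} (- z) \<partial>gauss1)"
    using integral_gauss1_affine(2)[of 1 "-s" 0] by simp
  also have "\<dots> = measure gauss1 {s..}"
    by (subst Bochner_Integration.integral_cong[where g="indicator {s..}"]) (auto simp: indicator_def)
  also have "\<dots> = measure gauss1 {s<..}"
  proof -
    have "AE x in lborel. x \<in> {s} \<longrightarrow> ennreal (gauss_density x) = 0"
      using AE_lborel_singleton[of s] by eventually_elim simp
    then have "{s} \<in> null_sets gauss1"
      unfolding gauss_def by (subst null_sets_density_iff) auto
    then have "measure gauss1 {s} = 0" by (simp add: measure_def null_setsD1)
    moreover have "{s..} = {s} \<union> {s<..}" by auto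
    ultimately show ?thesis
      using gauss_real.finite_measure_Union[of "{s}" "{s<..}"] by simp
  qed
  also have "{s<..} = space gauss1 - {..s}" by auto
  also have "measure gauss1 (space gauss1 - {..s}) = 1 - Phi s"
    unfolding Phi_def by (rule gauss_real.prob_compl) simp
  finally show ?thesis .
qed

lemma Phi_at_top: "(Phi \<longlongrightarrow> 1) at_top"
  and Phi_at_bot: "(Phi \<longlongrightarrow> 0) at_bot"
proof -
  interpret real_distribution gauss1 by standard auto
  have "Phi = cdf gauss1" by (auto simp: Phi_def cdf_def)
  then show "(Phi \<longlongrightarrow> 1) at_top" "(Phi \<longlongrightarrow> 0) at_bot"
    using cdf_lim_at_top_prob cdf_lim_at_bot by simp_all
qed

section \<open>The quantile function\<close>

definition Phi_inv :: "real \<Rightarrow> real" where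
  "Phi_inv x = (if 0 < x \<and> x < 1 then (THE s. Phi s = x) else 0)"

lemma Phi_inv_Phi [simp]: "Phi_inv (Phi s) = s"
  by (simp add: Phi_inv_def Phi_pos Phi_less_1)

lemma Phi_surj: assumes "0 < x" "x < 1" obtains s where "x = Phi s"
proof -
  have "eventually (\<lambda>s. Phi s < x) at_bot" "eventually (\<lambda>s. Phi s > x) at_top"
    using Phi_at_bot Phi_at_top assms by (auto intro: order_tendstoD)
  then obtain a b where "Phi a < x" "Phi b > x"
    by (auto simp: eventually_at_bot_linorder eventually_at_top_linorder)
  moreover then have "a \<le> b" by (meson Phi_less_iff less_trans less_imp_le)
  ultimately show ?thesis
    using IVT'[of Phi a x b] that by (force intro: continuous_intros continuous_on_Phi[OF continuous_on_id])
qed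

lemma Phi_Phi_inv [simp]: "0 < x \<Longrightarrow> x < 1 \<Longrightarrow> Phi (Phi_inv x) = x"
  by (erule (1) Phi_surj) simp

lemma DERIV_Phi_inv: 
  assumes "0 < x" "x < 1"
  shows "(Phi_inv has_real_derivative 1 / std_normal_density (Phi_inv x)) (at x)"
proof -
  obtain s where x: "x = Phi s" using Phi_surj assms by blast
  have "isCont Phi_inv (Phi s)"
    by (rule isCont_inverse_function[of 1 s]) (auto intro: isCont_Phi)
  then have "(Phi_inv has_real_derivative inverse (std_normal_density s)) (at x)"
    using assms DERIV_Phi[OF DERIV_ident, of _ UNIV]
    by (intro DERIV_inverse_function[where a=0 and b=1 and f=Phi])
       (auto simp: x less_imp_neq[OF std_normal_density_pos, symmetric])
  then show ?thesis by (simp add: x inverse_eq_divide)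
qed

text \<open>Continuity holds on the open unit interval only; because the default value outside is 0,
  multiplying by the indicator of that interval changes nothing.\<close>

lemma borel_measurable_Phi_inv [measurable]: "Phi_inv \<in> borel_measurable borel"
proof -
  have "continuous_on {0<..<1} Phi_inv"
    by (intro continuous_at_imp_continuous_on ballI DERIV_isCont[OF DERIV_Phi_inv]) auto
  then have "(\<lambda>x. indicator {0<..<1} x *\<^sub>R Phi_inv x) \<in> borel_measurable borel"
    by (intro borel_measurable_continuous_on_indicator) auto
  also have "(\<lambda>x. indicator {0<..<1} x *\<^sub>R Phi_inv x) = Phi_inv"
    by (auto simp: fun_eq_iff indicator_def Phi_inv_def)
  finally show ?thesis .
qed

lemma std_normal_density_mono: "\<bar>s\<bar> \<le> M \<Longrightarrow> std_normal_density M \<le> std_normal_density s"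
  using abs_le_square_iff[of s M] by (auto simp: std_normal_density_def divide_right_mono)

text \<open>The derivative of the quantile function is the reciprocal of the density at the
  quantile, and for quantiles between -M and M the density is smallest at M. The constant is
  unbounded in M, which is one reason for the truncation to
  \<open>{Phi (-M)..Phi M}\<close>.\<close>

lemma Phi_inv_lipschitz:
  assumes "x \<in> {Phi (-M)..Phi M}" "y \<in> {Phi (-M)..Phi M}"
  shows "\<bar>Phi_inv x - Phi_inv y\<bar> \<le> \<bar>x - y\<bar> / std_normal_density M"
  using assms
proof (induction x y rule: linorder_wlog)
  case (le x y)
  then obtain s t where st: "x = Phi s" "y = Phi t"
    by (metis Phi_surj Phi_pos Phi_less_1 atLeastAtMost_iff less_le_trans le_less_trans)
  have "s \<le> t" using le st by simp
  show ?case
  proof (cases "s = t")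
    case False
    with \<open>s \<le> t\<close> have "s < t" by simp
    then obtain z where z: "s < z" "z < t" "Phi t - Phi s = (t - s) * std_normal_density z"
      using MVT2[of s t Phi std_normal_density] DERIV_Phi[OF DERIV_ident, of _ UNIV] by auto
    have "\<bar>z\<bar> \<le> M" using z le by (auto simp: st)
    then have "(t - s) * std_normal_density M \<le> Phi t - Phi s"
      unfolding z(3) using \<open>s < t\<close> by (intro mult_left_mono std_normal_density_mono) auto
    then show ?thesis using \<open>s < t\<close> by (simp add: st pos_le_divide_eq)
  qed (simp add: st)
qed (simp add: abs_minus_commute)

section \<open>The bivariate normal distribution function and the Gaussian copula\<close>

text \<open>The conditional standard deviation of y given x for a \<rho>-correlated standard normal
  pair.\<close>

definition resid :: "real \<Rightarrow> real" where "resid \<rho> = sqrt (1 - \<rho>\<^sup>2)"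

text \<open>The probability that X <= s and Y <= t for a \<rho>-correlated standard normal pair,
  with Y already integrated out given X = a. In this form the derivative in s is immediate, while
  the symmetry in s and t has to be proved.\<close>

definition bvn_cdf :: "real \<Rightarrow> real \<Rightarrow> real \<Rightarrow> real" where
  "bvn_cdf \<rho> s t = (\<integral>a. indicator {..s} a * Phi ((t - \<rho> * a) / resid \<rho>) \<partial>gauss1)"

lemma abs_Phi_le_1 [simp]: "\<bar>Phi x\<bar> \<le> 1"
  using Phi_pos[of x] Phi_less_1[of x] by simp

lemma Phi_nonneg [simp]: "0 \<le> Phi x" and Phi_le_1 [simp]: "Phi x \<le> 1"
  using Phi_pos[of x] Phi_less_1[of x] by simp_all

text \<open>The value of \<open>E[f(x) g(y)]\<close> when \<open>f\<close>, \<open>g\<close> are the indicators of parallel halfspaces of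
  measures \<open>x\<close> and \<open>y\<close>.\<close>
definition gauss_copula :: "real \<Rightarrow> real \<Rightarrow> real \<Rightarrow> real" where "gauss_copula \<rho> x y = bvn_cdf \<rho> (Phi_inv x) (Phi_inv y)"

context
  fixes \<rho> :: real
  assumes rho: "0 \<le> \<rho>" "\<rho> < 1"
begin

lemma resid_pos: "resid \<rho> > 0" and resid_sq: "(resid \<rho>)\<^sup>2 = 1 - \<rho>\<^sup>2"
  using rho by (simp_all add: resid_def abs_square_less_1 power_le_one)

lemma integrable_bvn_cdf: "A \<in> sets borel \<Longrightarrow> integrable gauss1 (\<lambda>a. indicator A a * Phi ((t - \<rho> * a) / resid \<rho>))"
  by (rule integrable_gauss_bounded[of _ 1]) (auto simp: indicator_def)

lemma DERIV_bvn_cdf: "((\<lambda>s. bvn_cdf \<rho> s t) has_real_derivative std_normal_density s * Phi ((t - \<rho> * s) / resid \<rho>)) (at s)"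
  unfolding bvn_cdf_def using resid_pos
  by (intro DERIV_gauss_atMost_integral[of _ 1] continuous_intros) auto

text \<open>With y = \<rho> x + \<open>resid \<rho>\<close> z, the rotation with cosine \<rho> and
  sine \<open>resid \<rho>\<close> maps (x, z) to (y, w), and x = \<rho> y -
  \<open>resid \<rho>\<close> w has the same shape up to a sign, which does not matter for Gaussian
  w.\<close>

lemma bvn_cdf_symmetric: "bvn_cdf \<rho> s t = bvn_cdf \<rho> t s"
proof -
  have R [measurable]: "(\<lambda>z::real\<times>real. (\<rho> *\<^sub>R fst z + resid \<rho> *\<^sub>R snd z, \<rho> *\<^sub>R snd z - resid \<rho> *\<^sub>R fst z)) \<in> borel_measurable borel"
    by (intro borel_measurable_continuous_onI continuous_intros)
  \<comment> \<open>The joint event in rotated coordinates: u is y, and the argument of the second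
    indicator is x.\<close>
  let ?F = "\<lambda>(u, v). indicator {..t} u * indicator {..s} (\<rho> * u - resid \<rho> * v) :: real"
  have [measurable]: "?F \<in> borel_measurable borel"
    by (simp add: case_prod_beta')
  have b: "\<bar>?F z\<bar> \<le> 1" for z by (auto simp: case_prod_beta' indicator_def)
  have "bvn_cdf \<rho> s t = (\<integral>x. \<integral>z. indicator {..s} x * indicator {..t} (\<rho> * x + resid \<rho> * z) \<partial>gauss1 \<partial>gauss1)"
    using resid_pos by (simp add: bvn_cdf_def integral_gauss1_affine)
  also have "\<dots> = (\<integral>z. indicator {..s} (fst z) * indicator {..t} (\<rho> * fst z + resid \<rho> * snd z) \<partial>(gauss::(real\<times>real) measure))"
    by (subst integral_gauss_pair) (auto intro!: integrable_gauss_bounded[of _ 1] simp: indicator_def)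
  also have "\<dots> = (\<integral>z. ?F (\<rho> *\<^sub>R fst z + resid \<rho> *\<^sub>R snd z, \<rho> *\<^sub>R snd z - resid \<rho> *\<^sub>R fst z) \<partial>(gauss::(real\<times>real) measure))"
  proof (intro Bochner_Integration.integral_cong refl)
    fix z :: "real \<times> real"
    have "\<rho> * (\<rho> * fst z + resid \<rho> * snd z) - resid \<rho> * (\<rho> * snd z - resid \<rho> * fst z) = (\<rho>\<^sup>2 + (resid \<rho>)\<^sup>2) * fst z"
      by (simp add: power2_eq_square algebra_simps)
    also have "\<dots> = fst z" by (simp add: resid_sq)
    finally show "indicator {..s} (fst z) * indicator {..t} (\<rho> * fst z + resid \<rho> * snd z)
        = ?F (\<rho> *\<^sub>R fst z + resid \<rho> *\<^sub>R snd z, \<rho> *\<^sub>R snd z - resid \<rho> *\<^sub>R fst z)"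
      by (simp add: mult.commute)
  qed
  also have "\<dots> = (\<integral>z. ?F z \<partial>distr gauss borel (\<lambda>z::real\<times>real. (\<rho> *\<^sub>R fst z + resid \<rho> *\<^sub>R snd z, \<rho> *\<^sub>R snd z - resid \<rho> *\<^sub>R fst z)))"
    by (subst integral_distr) auto
  also have "\<dots> = (\<integral>z. ?F z \<partial>gauss)"
    using resid_pos by (subst distr_gauss_rot) (auto simp: resid_sq)
  also have "\<dots> = (\<integral>u. \<integral>v. ?F (u, v) \<partial>gauss1 \<partial>gauss1)"
    using b by (subst integral_gauss_pair) (auto intro!: integrable_gauss_bounded[of _ 1])
  also have "\<dots> = bvn_cdf \<rho> t s"
    using resid_pos by (simp add: bvn_cdf_def integral_gauss1_affine)
  finally show ?thesis .
qed

lemma integral_Phi_affine: "(\<integral>a. Phi ((t - \<rho> * a) / resid \<rho>) \<partial>gauss1) = Phi t"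
proof -
  have "(\<integral>a. Phi ((t - \<rho> * a) / resid \<rho>) \<partial>gauss1) = (\<integral>x. \<integral>z. indicator {..t} (\<rho> *\<^sub>R x + resid \<rho> *\<^sub>R z) \<partial>gauss1 \<partial>gauss1)"
    using resid_pos by (simp add: integral_gauss1_affine)
  also have "\<dots> = (\<integral>z. indicator {..t} (sqrt (\<rho>\<^sup>2 + (resid \<rho>)\<^sup>2) *\<^sub>R z) \<partial>gauss1)"
    using rho by (intro integral_gauss_conv[of _ 1]) (auto simp: indicator_def)
  finally show ?thesis by (simp add: resid_sq Phi_def)
qed

text \<open>The difference integrates a conditional probability, a number between 0 and 1, over the
  interval from s to s'. In terms of x = Phi s this makes the copula 1-Lipschitz in each
  argument.\<close>

lemma bvn_cdf_diff:
  assumes "s \<le> s'"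
  shows "0 \<le> bvn_cdf \<rho> s' t - bvn_cdf \<rho> s t" "bvn_cdf \<rho> s' t - bvn_cdf \<rho> s t \<le> Phi s' - Phi s"
proof -
  have eq: "bvn_cdf \<rho> s' t - bvn_cdf \<rho> s t = (\<integral>a. indicator {s<..s'} a * Phi ((t - \<rho> * a) / resid \<rho>) \<partial>gauss1)"
    unfolding bvn_cdf_def Bochner_Integration.integral_diff[OF integrable_bvn_cdf integrable_bvn_cdf, of "{..s'}" "{..s}", simplified, symmetric]
    using assms by (intro Bochner_Integration.integral_cong) (auto simp: indicator_def)
  show "0 \<le> bvn_cdf \<rho> s' t - bvn_cdf \<rho> s t"
    unfolding eq by (intro integral_nonneg_AE AE_I2) simp
  have "bvn_cdf \<rho> s' t - bvn_cdf \<rho> s t \<le> (\<integral>a. indicator {s<..s'} a \<partial>gauss1)"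
    unfolding eq
    by (intro integral_mono integrable_bvn_cdf integrable_gauss_bounded[of _ 1]) (auto simp: indicator_def)
  also have "\<dots> = Phi s' - Phi s"
  proof -
    have "{s<..s'} = {..s'} - {..s}" using assms by auto
    then show ?thesis
      using assms gauss_real.finite_measure_Diff[of "{..s'}" "{..s}"] by (simp add: Phi_def)
  qed
  finally show "bvn_cdf \<rho> s' t - bvn_cdf \<rho> s t \<le> Phi s' - Phi s" .
qed

text \<open>Positive dependence: since \<rho> >= 0, the conditional probability of Y <= t given X =
  a decreases in a. So it is at least its value c at s when a <= s, and at most c beyond s.\<close>

lemma bvn_cdf_ge_mult: "Phi s * Phi t \<le> bvn_cdf \<rho> s t"
proof -
  define c where "c = Phi ((t - \<rho> * s) / resid \<rho>)"
  let ?A = "\<lambda>a. Phi ((t - \<rho> * a) / resid \<rho>)"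
  have i: "integrable gauss1 (\<lambda>a. indicator A a * ?A a)" "integrable gauss1 (\<lambda>a. indicator A a * c)" if "A \<in> sets borel" for A
    using that by (auto intro!: integrable_gauss_bounded[of _ 1] simp: indicator_def c_def)
  have 1: "Phi s * c \<le> bvn_cdf \<rho> s t"
  proof -
    have "Phi s * c = (\<integral>a. indicator {..s} a * c \<partial>gauss1)" by (simp add: Phi_def)
    also have "\<dots> \<le> (\<integral>a. indicator {..s} a * ?A a \<partial>gauss1)"
      using resid_pos rho by (intro integral_mono i)
        (auto simp: indicator_def c_def intro!: divide_right_mono mult_left_mono)
    finally show ?thesis by (simp add: bvn_cdf_def)
  qed
  have 2: "Phi t - bvn_cdf \<rho> s t \<le> (1 - Phi s) * c"
  proof -
    have "Phi t - bvn_cdf \<rho> s t = (\<integral>a. ?A a - indicator {..s} a * ?A a \<partial>gauss1)"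
      using Bochner_Integration.integral_diff[OF i(1)[of UNIV] i(1)[of "{..s}"]]
      by (simp add: bvn_cdf_def integral_Phi_affine)
    also have "\<dots> \<le> (\<integral>a. c - indicator {..s} a * c \<partial>gauss1)"
      using resid_pos rho i(1)[of UNIV] i(1)[of "{..s}"] i(2)[of UNIV] i(2)[of "{..s}"]
      by (intro integral_mono Bochner_Integration.integrable_diff) (auto simp: indicator_def c_def intro!: divide_right_mono mult_left_mono)
    also have "\<dots> = (1 - Phi s) * c"
      using Bochner_Integration.integral_diff[OF i(2)[of UNIV] i(2)[of "{..s}"]]
      by (simp add: Phi_def algebra_simps)
    finally show ?thesis .
  qed
  \<comment> \<open>Weighting the two estimates by \<open>Phi s\<close> and \<open>1 - Phi s\<close>
    eliminates c, and what remains rearranges to the claim.\<close>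
  have "Phi s * (Phi t - bvn_cdf \<rho> s t) \<le> Phi s * ((1 - Phi s) * c)"
    using 2 by (intro mult_left_mono) auto
  also have "\<dots> = (1 - Phi s) * (Phi s * c)" by simp
  also have "\<dots> \<le> (1 - Phi s) * bvn_cdf \<rho> s t"
    using 1 by (intro mult_left_mono) auto
  finally show ?thesis by (simp add: algebra_simps)
qed

lemma bvn_cdf_nonneg: "0 \<le> bvn_cdf \<rho> s t"
  using bvn_cdf_ge_mult[of s t] by (rule order_trans[rotated]) simp

lemma bvn_cdf_le_1: "bvn_cdf \<rho> s t \<le> 1"
proof -
  have "bvn_cdf \<rho> s t \<le> \<bar>bvn_cdf \<rho> s t\<bar>" by simp
  also have "\<dots> \<le> 1" unfolding bvn_cdf_def by (rule abs_integral_gauss_le) (auto simp: indicator_def)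
  finally show ?thesis .
qed

lemma gauss_copula_commute: "gauss_copula \<rho> x y = gauss_copula \<rho> y x"
  by (simp add: gauss_copula_def bvn_cdf_symmetric)

lemma gauss_copula_bounds: "0 \<le> gauss_copula \<rho> x y" "gauss_copula \<rho> x y \<le> 1"
  by (simp_all add: gauss_copula_def bvn_cdf_nonneg bvn_cdf_le_1)

lemma gauss_copula_ge_mult:
  assumes "x \<in> {0<..<1}" "y \<in> {0<..<1}"
  shows "x * y \<le> gauss_copula \<rho> x y"
  using assms bvn_cdf_ge_mult[of "Phi_inv x" "Phi_inv y"] by (simp add: gauss_copula_def)

lemma gauss_copula_lipschitz1:
  assumes "x \<in> {0<..<1}" "x' \<in> {0<..<1}"
  shows "\<bar>gauss_copula \<rho> x y - gauss_copula \<rho> x' y\<bar> \<le> \<bar>x - x'\<bar>"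
  using assms
proof (induction x x' rule: linorder_wlog)
  case (le x x')
  then have "Phi_inv x \<le> Phi_inv x'" by (subst Phi_le_iff[symmetric]) simp
  from bvn_cdf_diff[OF this, of "Phi_inv y"] show ?case using le by (simp add: gauss_copula_def)
qed (simp add: abs_minus_commute)

lemma gauss_copula_lipschitz:
  assumes "x \<in> {0<..<1}" "x' \<in> {0<..<1}" "y \<in> {0<..<1}" "y' \<in> {0<..<1}"
  shows "\<bar>gauss_copula \<rho> x y - gauss_copula \<rho> x' y'\<bar> \<le> \<bar>x - x'\<bar> + \<bar>y - y'\<bar>"
  using gauss_copula_lipschitz1[OF assms(1,2), of y] gauss_copula_lipschitz1[OF assms(3,4), of x'] gauss_copula_commute[of x'] by auto

lemma borel_measurable_bvn_cdf [measurable]: "(\<lambda>p. bvn_cdf \<rho> (fst p) (snd p)) \<in> borel_measurable (borel \<Otimes>\<^sub>M borel)"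
proof -
  have "(\<lambda>(p, a). indicator {z. snd z \<le> fst z} (fst p, a) * Phi ((snd p - \<rho> * a) / resid \<rho>)) \<in> borel_measurable ((borel \<Otimes>\<^sub>M borel) \<Otimes>\<^sub>M gauss1)"
    by measurable
  from gauss.borel_measurable_lebesgue_integral[OF this] show ?thesis
    by (simp add: bvn_cdf_def[abs_def] indicator_def)
qed

lemma borel_measurable_gauss_copula [measurable (raw)]:
  assumes [measurable]: "f \<in> borel_measurable M" "g \<in> borel_measurable M"
  shows "(\<lambda>x. gauss_copula \<rho> (f x) (g x)) \<in> borel_measurable M"
proof -
  have "(\<lambda>x. (Phi_inv (f x), Phi_inv (g x))) \<in> M \<rightarrow>\<^sub>M borel \<Otimes>\<^sub>M borel" by measurable
  from measurable_compose[OF this borel_measurable_bvn_cdf] show ?thesis by (simp add: gauss_copula_def)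
qed

end

section \<open>Taylor bounds and the second derivatives of the copula\<close>

lemma taylor_first_order_lipschitz:
  fixes g h :: "real \<Rightarrow> real"
  assumes g: "\<And>t. t \<in> {l..u} \<Longrightarrow> (g has_real_derivative h t) (at t)"
    and h: "\<And>s t. s \<in> {l..u} \<Longrightarrow> t \<in> {l..u} \<Longrightarrow> \<bar>h s - h t\<bar> \<le> L * \<bar>s - t\<bar>"
    and L: "L \<ge> 0" and x: "x \<in> {l..u}" and y: "y \<in> {l..u}"
  shows "\<bar>g y - g x - h x * (y - x)\<bar> \<le> L * \<bar>y - x\<bar>\<^sup>2"
proof -
  have "\<exists>t. t \<in> {l..u} \<and> \<bar>t - x\<bar> \<le> \<bar>y - x\<bar> \<and> g y = g x + h t * (y - x)"
  proof (cases x y rule: linorder_cases)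
    case less
    then obtain z where "z > x" "z < y" "g y - g x = (y - x) * h z"
      using MVT2[of x y g h] g x y by auto
    then show ?thesis using x y by (intro exI[of _ z]) (auto simp: algebra_simps)
  next
    case greater
    then obtain z where "z > y" "z < x" "g x - g y = (x - y) * h z"
      using MVT2[of y x g h] g x y by auto
    then show ?thesis using x y by (intro exI[of _ z]) (auto simp: algebra_simps)
  qed (use x in auto)
  then obtain t where t: "t \<in> {l..u}" "\<bar>t - x\<bar> \<le> \<bar>y - x\<bar>" "g y = g x + h t * (y - x)" by blast
  have "\<bar>g y - g x - h x * (y - x)\<bar> = \<bar>h t - h x\<bar> * \<bar>y - x\<bar>"
    unfolding t(3) by (simp add: abs_mult[symmetric] algebra_simps)
  also have "\<dots> \<le> L * \<bar>y - x\<bar> * \<bar>y - x\<bar>"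
    using order_trans[OF h[OF t(1) x] mult_left_mono[OF t(2) L]] by (intro mult_right_mono) auto
  finally show ?thesis
    by (simp add: power2_eq_square mult_ac)
qed

lemma taylor_second_order_lipschitz:
  fixes f g h :: "real \<Rightarrow> real"
  assumes f: "\<And>t. t \<in> {l..u} \<Longrightarrow> (f has_real_derivative g t) (at t)"
    and g: "\<And>t. t \<in> {l..u} \<Longrightarrow> (g has_real_derivative h t) (at t)"
    and h: "\<And>s t. s \<in> {l..u} \<Longrightarrow> t \<in> {l..u} \<Longrightarrow> \<bar>h s - h t\<bar> \<le> L * \<bar>s - t\<bar>"
    and L: "L \<ge> 0" and x: "x \<in> {l..u}" and y: "y \<in> {l..u}"
  shows "\<bar>f y - f x - g x * (y - x) - h x * (y - x)\<^sup>2 / 2\<bar> \<le> L * \<bar>y - x\<bar> ^ 3"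
proof -
  have "\<exists>t. t \<in> {l..u} \<and> \<bar>t - x\<bar> \<le> \<bar>y - x\<bar> \<and> f y = f x + g x * (y - x) + h t * (y - x)\<^sup>2 / 2"
  proof (cases "x = y")
    case False
    have "\<exists>t. (if y < x then y < t \<and> t < x else x < t \<and> t < y) \<and>
      f y = (\<Sum>m<2. (if m = 0 then f else if m = 1 then g else h) x / fact m * (y - x) ^ m)
        + (if (2::nat) = 0 then f else if (2::nat) = 1 then g else h) t / fact 2 * (y - x)\<^sup>2"
      using f g x y False by (intro Taylor[where a=l and b=u]) (auto simp: less_Suc_eq numeral_2_eq_2)
    then obtain t where t: "if y < x then y < t \<and> t < x else x < t \<and> t < y"
      and eq: "f y = f x + g x * (y - x) + h t * (y - x)\<^sup>2 / 2"
      by (auto simp: numeral_2_eq_2)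
    then show ?thesis using x y by (intro exI[of _ t]) (auto split: if_splits)
  qed (use x in auto)
  then obtain t where t: "t \<in> {l..u}" "\<bar>t - x\<bar> \<le> \<bar>y - x\<bar>"
    "f y = f x + g x * (y - x) + h t * (y - x)\<^sup>2 / 2" by blast
  have eq: "f y - f x - g x * (y - x) - h x * (y - x)\<^sup>2 / 2 = (h t - h x) * (y - x)\<^sup>2 / 2"
    unfolding t(3) by (simp add: left_diff_distrib diff_divide_distrib)
  have "\<bar>f y - f x - g x * (y - x) - h x * (y - x)\<^sup>2 / 2\<bar> = \<bar>h t - h x\<bar> * \<bar>y - x\<bar>\<^sup>2 / 2"
    unfolding eq by (simp add: abs_mult)
  also have "\<dots> \<le> L * \<bar>y - x\<bar> * \<bar>y - x\<bar>\<^sup>2 / 2"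
    using order_trans[OF h[OF t(1) x] mult_left_mono[OF t(2) L]]
    by (intro divide_right_mono mult_right_mono) auto
  also have "\<dots> \<le> L * \<bar>y - x\<bar> * \<bar>y - x\<bar>\<^sup>2"
    using L by simp
  finally show ?thesis
    by (simp add: power2_eq_square power3_eq_cube mult_ac)
qed

lemma exp_lipschitz:
  fixes p q :: real
  assumes "p \<le> m" "q \<le> m"
  shows "\<bar>exp p - exp q\<bar> \<le> exp m * \<bar>p - q\<bar>"
  using assms
proof (induction p q rule: linorder_wlog)
  case (le p q)
  have "exp q - exp p = exp q * (1 - exp (p - q))"
    by (simp add: algebra_simps exp_diff)
  also have "\<dots> \<le> exp m * (q - p)"
    using le exp_ge_add_one_self[of "p - q"] by (intro mult_mono) (auto simp del: exp_ge_add_one_self)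
  finally show ?case using le by simp
qed (simp add: abs_minus_commute)

text \<open>The density at (t - \<rho> s) / \<open>resid \<rho>\<close> divided by the density at s,
  respectively at t; the normalising constants cancel. Up to the factors -\<rho> /
  \<open>resid \<rho>\<close> and 1 / \<open>resid \<rho>\<close> these are the pure and the mixed
  second derivative of the copula at the point with quantiles s and t.\<close>

definition cond_ratio1 where "cond_ratio1 \<rho> s t = exp (- (t - \<rho> * s)\<^sup>2 / (2 * (resid \<rho>)\<^sup>2) + s\<^sup>2 / 2)"
definition cond_ratio2 where "cond_ratio2 \<rho> s t = exp (- (t - \<rho> * s)\<^sup>2 / (2 * (resid \<rho>)\<^sup>2) + t\<^sup>2 / 2)"

context
  fixes \<rho> :: real
  assumes rho: "0 \<le> \<rho>" "\<rho> < 1"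
begin

text \<open>The variable u stands for s or for t, so both ratios are covered at once. Dropping the
  negative square bounds the exponent by M^2 / 2, below which exp is Lipschitz; the exponent itself
  is Lipschitz because it is made of squares of numbers bounded by 2 M and M.\<close>

lemma exp_quad_lipschitz:
  assumes "\<bar>s\<bar> \<le> M" "\<bar>t\<bar> \<le> M" "\<bar>s'\<bar> \<le> M" "\<bar>t'\<bar> \<le> M"
    and u: "u \<in> {s, t}" and u': "(u' = s' \<and> u = s) \<or> (u' = t' \<and> u = t)"
  shows "\<bar>exp (- (t - \<rho> * s)\<^sup>2 / (2 * (resid \<rho>)\<^sup>2) + u\<^sup>2 / 2) - exp (- (t' - \<rho> * s')\<^sup>2 / (2 * (resid \<rho>)\<^sup>2) + u'\<^sup>2 / 2)\<bar>
    \<le> exp (M\<^sup>2 / 2) * (2 * M / (resid \<rho>)\<^sup>2 + M) * (\<bar>s - s'\<bar> + \<bar>t - t'\<bar>)"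
proof -
  let ?p = "\<lambda>s t u. - (t - \<rho> * s)\<^sup>2 / (2 * (resid \<rho>)\<^sup>2) + u\<^sup>2 / 2"
  have M: "M \<ge> 0" using assms(1) by linarith
  have uM: "\<bar>u\<bar> \<le> M" "\<bar>u'\<bar> \<le> M" using assms by auto
  have pM: "?p s t u \<le> M\<^sup>2 / 2" if "\<bar>u\<bar> \<le> M" for s t u
  proof -
    have "u\<^sup>2 \<le> M\<^sup>2" using that M by (simp add: abs_le_square_iff[symmetric])
    moreover have "- (t - \<rho> * s)\<^sup>2 / (2 * (resid \<rho>)\<^sup>2) \<le> 0" by simp
    ultimately show ?thesis by linarith
  qed
  have sqd: "\<bar>a\<^sup>2 - b\<^sup>2\<bar> \<le> 2 * N * \<bar>a - b\<bar>" if "\<bar>a\<bar> \<le> N" "\<bar>b\<bar> \<le> N" for a b N :: real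
  proof -
    have "\<bar>a\<^sup>2 - b\<^sup>2\<bar> = \<bar>a + b\<bar> * \<bar>a - b\<bar>" by (simp add: power2_eq_square algebra_simps flip: abs_mult)
    also have "\<dots> \<le> 2 * N * \<bar>a - b\<bar>" using that by (intro mult_right_mono) auto
    finally show ?thesis .
  qed
  have rs: "\<rho> * \<bar>x\<bar> \<le> \<bar>x\<bar>" for x using rho by (simp add: mult_left_le_one_le)
  have n: "\<bar>t - \<rho> * s\<bar> \<le> 2 * M" if "\<bar>s\<bar> \<le> M" "\<bar>t\<bar> \<le> M" for s t
    using rs[of s] that abs_mult[of \<rho> s] rho by simp
  have "\<bar>(t - \<rho> * s)\<^sup>2 - (t' - \<rho> * s')\<^sup>2\<bar> \<le> 2 * (2 * M) * \<bar>(t - \<rho> * s) - (t' - \<rho> * s')\<bar>"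
    using assms by (intro sqd n)
  also have "\<bar>(t - \<rho> * s) - (t' - \<rho> * s')\<bar> \<le> \<bar>s - s'\<bar> + \<bar>t - t'\<bar>"
  proof -
    have "(t - \<rho> * s) - (t' - \<rho> * s') = (t - t') - \<rho> * (s - s')" by (simp add: algebra_simps)
    then show ?thesis using rs[of "s - s'"] abs_mult[of \<rho> "s - s'"] rho by simp
  qed
  finally have q: "\<bar>(t - \<rho> * s)\<^sup>2 - (t' - \<rho> * s')\<^sup>2\<bar> \<le> 4 * M * (\<bar>s - s'\<bar> + \<bar>t - t'\<bar>)"
    using M by (simp add: mult_left_mono)
  have "\<bar>u\<^sup>2 - u'\<^sup>2\<bar> \<le> 2 * M * \<bar>u - u'\<bar>" by (intro sqd uM)
  also have "\<dots> \<le> 2 * M * (\<bar>s - s'\<bar> + \<bar>t - t'\<bar>)" using u' M by (intro mult_left_mono) auto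
  finally have u2: "\<bar>u\<^sup>2 - u'\<^sup>2\<bar> \<le> 2 * M * (\<bar>s - s'\<bar> + \<bar>t - t'\<bar>)" .
  have "?p s t u - ?p s' t' u' = ((t' - \<rho> * s')\<^sup>2 - (t - \<rho> * s)\<^sup>2) / (2 * (resid \<rho>)\<^sup>2) + (u\<^sup>2 - u'\<^sup>2) / 2"
    by (simp add: diff_divide_distrib)
  then have "\<bar>?p s t u - ?p s' t' u'\<bar> \<le> \<bar>((t' - \<rho> * s')\<^sup>2 - (t - \<rho> * s)\<^sup>2) / (2 * (resid \<rho>)\<^sup>2)\<bar> + \<bar>(u\<^sup>2 - u'\<^sup>2) / 2\<bar>"
    by linarith
  also have "\<bar>((t' - \<rho> * s')\<^sup>2 - (t - \<rho> * s)\<^sup>2) / (2 * (resid \<rho>)\<^sup>2)\<bar> \<le> 4 * M * (\<bar>s - s'\<bar> + \<bar>t - t'\<bar>) / (2 * (resid \<rho>)\<^sup>2)"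
    using divide_right_mono[OF q, of "2 * (resid \<rho>)\<^sup>2"] by (simp add: abs_minus_commute)
  also have "\<bar>(u\<^sup>2 - u'\<^sup>2) / 2\<bar> \<le> 2 * M * (\<bar>s - s'\<bar> + \<bar>t - t'\<bar>) / 2"
    using u2 by simp
  also have "4 * M * (\<bar>s - s'\<bar> + \<bar>t - t'\<bar>) / (2 * (resid \<rho>)\<^sup>2) + 2 * M * (\<bar>s - s'\<bar> + \<bar>t - t'\<bar>) / 2
     = (2 * M / (resid \<rho>)\<^sup>2 + M) * (\<bar>s - s'\<bar> + \<bar>t - t'\<bar>)"
    using resid_pos[OF rho] by (simp add: field_simps)
  finally have d: "\<bar>?p s t u - ?p s' t' u'\<bar> \<le> (2 * M / (resid \<rho>)\<^sup>2 + M) * (\<bar>s - s'\<bar> + \<bar>t - t'\<bar>)" by simp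
  have "\<bar>exp (?p s t u) - exp (?p s' t' u')\<bar> \<le> exp (M\<^sup>2 / 2) * \<bar>?p s t u - ?p s' t' u'\<bar>"
    by (intro exp_lipschitz pM uM)
  also have "\<dots> \<le> exp (M\<^sup>2 / 2) * ((2 * M / (resid \<rho>)\<^sup>2 + M) * (\<bar>s - s'\<bar> + \<bar>t - t'\<bar>))"
    using d by (intro mult_left_mono) auto
  finally show ?thesis by (simp add: mult.assoc)
qed

lemma std_normal_density_quotient:
  "std_normal_density ((t - \<rho> * s) / resid \<rho>) / std_normal_density s = cond_ratio1 \<rho> s t"
  "std_normal_density ((t - \<rho> * s) / resid \<rho>) / std_normal_density t = cond_ratio2 \<rho> s t"
proof -
  have "std_normal_density u / std_normal_density v = exp (- u\<^sup>2 / 2 + v\<^sup>2 / 2)" for u v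
  proof -
    have "std_normal_density u / std_normal_density v = exp (- u\<^sup>2 / 2) / exp (- v\<^sup>2 / 2)"
      by (simp add: std_normal_density_def)
    then show ?thesis unfolding exp_diff[symmetric] by simp
  qed
  then show "std_normal_density ((t - \<rho> * s) / resid \<rho>) / std_normal_density s = cond_ratio1 \<rho> s t"
    "std_normal_density ((t - \<rho> * s) / resid \<rho>) / std_normal_density t = cond_ratio2 \<rho> s t"
    unfolding cond_ratio1_def cond_ratio2_def by (simp_all add: power_divide mult.commute)
qed

text \<open>The density at the quantile of x appears once from \<open>DERIV_bvn_cdf\<close> and
  once, inverted, from the derivative of \<open>Phi_inv\<close>. What remains is the conditional
  probability of Y <= t given X = s, for the quantiles s and t of x and y.\<close>

lemma DERIV_gauss_copula:
  assumes "0 < x" "x < 1" 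
  shows "((\<lambda>x. gauss_copula \<rho> x y) has_real_derivative Phi ((Phi_inv y - \<rho> * Phi_inv x) / resid \<rho>)) (at x)"
proof -
  have "((\<lambda>x. bvn_cdf \<rho> (Phi_inv x) (Phi_inv y)) has_real_derivative
      (std_normal_density (Phi_inv x) * Phi ((Phi_inv y - \<rho> * Phi_inv x) / resid \<rho>)) * (1 / std_normal_density (Phi_inv x))) (at x)"
    by (rule DERIV_chain2[OF DERIV_bvn_cdf[OF rho] DERIV_Phi_inv[OF assms]])
  then show ?thesis
    using std_normal_density_pos[of "Phi_inv x"] by (simp add: gauss_copula_def)
qed

text \<open>The same first derivative is differentiated in its own argument, which gives the pure
  second derivative, and in the other argument, which gives the mixed one.\<close>

lemma DERIV_gauss_copula_grad:
  assumes "0 < x" "x < 1" 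
  shows "((\<lambda>x. Phi ((t - \<rho> * Phi_inv x) / resid \<rho>)) has_real_derivative - (\<rho> / resid \<rho>) * cond_ratio1 \<rho> (Phi_inv x) t) (at x)"
    and "((\<lambda>x. Phi ((Phi_inv x - \<rho> * s) / resid \<rho>)) has_real_derivative (1 / resid \<rho>) * cond_ratio2 \<rho> s (Phi_inv x)) (at x)"
  unfolding std_normal_density_quotient[symmetric]
  using resid_pos[OF rho] by (auto intro!: derivative_eq_intros DERIV_Phi_inv assms simp: field_simps)

text \<open>Up to the factor \<open>resid \<rho>\<close>, both sides are the joint density of the
  pair, disintegrated along one coordinate or along the other. It allows all three second
  derivatives of the copula to share the factor \<kappa>.\<close>

lemma std_normal_density_exchange:
  "std_normal_density s * std_normal_density ((t - \<rho> * s) / resid \<rho>) = std_normal_density t * std_normal_density ((s - \<rho> * t) / resid \<rho>)"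
proof -
  have "s\<^sup>2 + ((t - \<rho> * s) / resid \<rho>)\<^sup>2 = t\<^sup>2 + ((s - \<rho> * t) / resid \<rho>)\<^sup>2"
  proof -
    have "(resid \<rho>)\<^sup>2 * s\<^sup>2 + (t - \<rho> * s)\<^sup>2 = (resid \<rho>)\<^sup>2 * t\<^sup>2 + (s - \<rho> * t)\<^sup>2"
      unfolding resid_sq[OF rho] by (simp add: power2_eq_square algebra_simps)
    then show ?thesis using resid_pos[OF rho] by (simp add: power_divide field_simps)
  qed
  then have "exp (- s\<^sup>2 / 2 + - ((t - \<rho> * s) / resid \<rho>)\<^sup>2 / 2) = exp (- t\<^sup>2 / 2 + - ((s - \<rho> * t) / resid \<rho>)\<^sup>2 / 2)"
    by (intro arg_cong[of _ _ exp]) (simp add: field_simps)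
  then show ?thesis
    unfolding exp_add by (simp add: std_normal_density_def)
qed

lemma std_normal_density_le_1: "std_normal_density x \<le> 1"
proof -
  have "1 \<le> sqrt (2 * pi)" using pi_ge_two by (intro real_le_rsqrt) simp
  then have "1 / sqrt (2 * pi) * exp (- x\<^sup>2 / 2) \<le> 1 * 1"
    by (intro mult_mono) auto
  then show ?thesis by (simp add: std_normal_density_def)
qed

text \<open>The numbers \<alpha> and \<beta> are the derivatives of the quantiles, so \<alpha> (x' -
  x) and \<beta> (y' - y) are increments in quantile coordinates to first order. In them the second
  derivatives are -\<rho> \<kappa>, \<kappa> and -\<rho> \<kappa>. The slopes p and q stay
  anonymous, as the linear terms will average to zero, and L depends only on \<rho> and M.\<close>

lemma gauss_copula_taylor:
  defines "K \<equiv> \<lambda>M. {Phi (- M)..Phi M}"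
  obtains L where "L \<ge> 1"
    "\<And>x y. x \<in> K M \<Longrightarrow> y \<in> K M \<Longrightarrow> \<exists>p q \<alpha> \<beta> \<kappa>. \<bar>\<alpha>\<bar> \<le> L \<and> \<bar>\<beta>\<bar> \<le> L \<and> 0 \<le> \<kappa> \<and> \<kappa> \<le> L \<and>
      (\<forall>x'\<in>K M. \<forall>y'\<in>K M. gauss_copula \<rho> x' y' \<le> gauss_copula \<rho> x y + p * (x' - x) + q * (y' - y)
        + \<kappa> / 2 * (2 * (\<alpha> * (x' - x)) * (\<beta> * (y' - y)) - \<rho> * (\<alpha> * (x' - x))\<^sup>2 - \<rho> * (\<beta> * (y' - y))\<^sup>2)
        + L * (\<bar>x' - x\<bar> + \<bar>y' - y\<bar>) ^ 3)"
proof (cases "M < 0")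
  case True
  then have "K M = {}" by (auto simp: K_def)
  then show ?thesis using that[of 1] by auto
next
  case False
  then have M: "M \<ge> 0" by simp
  define c where "c = 1 / std_normal_density M"
  define L0 where "L0 = exp (M\<^sup>2 / 2) * (2 * M / (resid \<rho>)\<^sup>2 + M)"
  \<comment> \<open>A Lipschitz constant for the second derivatives as functions of x and y: L0 is
    the one in quantile coordinates, c comes from the quantile function, and
    \<open>resid \<rho>\<close> from the prefactors.\<close>
  define L1 where "L1 = L0 * c / resid \<rho>"
  define L where "L = L1 + c + 1 / resid \<rho> + 1"
  have c: "c > 0" by (simp add: c_def)
  have L0: "L0 \<ge> 0" using M resid_pos[OF rho] by (simp add: L0_def)
  have L1: "L1 \<ge> 0" using L0 c resid_pos[OF rho] by (simp add: L1_def)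
  have LL: "L1 \<le> L" "c \<le> L" "1 / resid \<rho> \<le> L" "1 \<le> L" using L1 c resid_pos[OF rho] by (simp_all add: L_def)
  have K01: "0 < x" "x < 1" if "x \<in> K M" for x
    using that Phi_pos[of "-M"] Phi_less_1[of M] by (auto simp: K_def)
  have QM: "\<bar>Phi_inv x\<bar> \<le> M" if "x \<in> K M" for x
  proof -
    have "Phi (Phi_inv x) = x" using K01[OF that] by simp
    then have "Phi (- M) \<le> Phi (Phi_inv x)" "Phi (Phi_inv x) \<le> Phi M" using that by (simp_all add: K_def)
    then show ?thesis by (simp add: abs_le_iff)
  qed
  have QL: "\<bar>Phi_inv x - Phi_inv x'\<bar> \<le> c * \<bar>x - x'\<bar>" if "x \<in> K M" "x' \<in> K M" for x x'
    using Phi_inv_lipschitz[of x M x'] that by (simp add: K_def c_def)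
  have fin: "L0 * (\<bar>Phi_inv x - Phi_inv x'\<bar> + \<bar>Phi_inv y - Phi_inv y'\<bar>) \<le> L1 * resid \<rho> * (\<bar>x - x'\<bar> + \<bar>y - y'\<bar>)"
    if "x \<in> K M" "x' \<in> K M" "y \<in> K M" "y' \<in> K M" for x x' y y'
  proof -
    have "L0 * (\<bar>Phi_inv x - Phi_inv x'\<bar> + \<bar>Phi_inv y - Phi_inv y'\<bar>) \<le> L0 * (c * \<bar>x - x'\<bar> + c * \<bar>y - y'\<bar>)"
      using QL that L0 by (intro mult_left_mono add_mono) auto
    also have "\<dots> = L1 * resid \<rho> * (\<bar>x - x'\<bar> + \<bar>y - y'\<bar>)" using resid_pos[OF rho] by (simp add: L1_def algebra_simps)
    finally show ?thesis .
  qed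
  have A: "\<bar>cond_ratio1 \<rho> (Phi_inv x) (Phi_inv y) - cond_ratio1 \<rho> (Phi_inv x') (Phi_inv y')\<bar> \<le> L1 * resid \<rho> * (\<bar>x - x'\<bar> + \<bar>y - y'\<bar>)"
    if "x \<in> K M" "x' \<in> K M" "y \<in> K M" "y' \<in> K M" for x x' y y'
    using exp_quad_lipschitz[of "Phi_inv x" M "Phi_inv y" "Phi_inv x'" "Phi_inv y'" "Phi_inv x" "Phi_inv x'"] QM that
      fin[OF that] by (auto simp: cond_ratio1_def L0_def)
  have B: "\<bar>cond_ratio2 \<rho> (Phi_inv x) (Phi_inv y) - cond_ratio2 \<rho> (Phi_inv x') (Phi_inv y')\<bar> \<le> L1 * resid \<rho> * (\<bar>x - x'\<bar> + \<bar>y - y'\<bar>)"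
    if "x \<in> K M" "x' \<in> K M" "y \<in> K M" "y' \<in> K M" for x x' y y'
    using exp_quad_lipschitz[of "Phi_inv x" M "Phi_inv y" "Phi_inv x'" "Phi_inv y'" "Phi_inv y" "Phi_inv y'"] QM that
      fin[OF that] by (auto simp: cond_ratio2_def L0_def)
  define gx where "gx x y = Phi ((Phi_inv y - \<rho> * Phi_inv x) / resid \<rho>)" for x y
  define hx where "hx x y = - (\<rho> / resid \<rho>) * cond_ratio1 \<rho> (Phi_inv x) (Phi_inv y)" for x y
  define hm where "hm x y = (1 / resid \<rho>) * cond_ratio2 \<rho> (Phi_inv x) (Phi_inv y)" for x y
  have hxL: "\<bar>hx x y - hx x' y'\<bar> \<le> L1 * (\<bar>x - x'\<bar> + \<bar>y - y'\<bar>)"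
    if "x \<in> K M" "x' \<in> K M" "y \<in> K M" "y' \<in> K M" for x x' y y'
  proof -
    have "\<bar>hx x y - hx x' y'\<bar> = \<bar>\<rho>\<bar> / resid \<rho> * \<bar>cond_ratio1 \<rho> (Phi_inv x) (Phi_inv y) - cond_ratio1 \<rho> (Phi_inv x') (Phi_inv y')\<bar>"
    proof -
      have "hx x y - hx x' y' = - (\<rho> / resid \<rho>) * (cond_ratio1 \<rho> (Phi_inv x) (Phi_inv y) - cond_ratio1 \<rho> (Phi_inv x') (Phi_inv y'))"
        by (simp add: hx_def algebra_simps)
      then show ?thesis using resid_pos[OF rho] by (simp add: abs_mult)
    qed
    also have "\<dots> \<le> 1 / resid \<rho> * (L1 * resid \<rho> * (\<bar>x - x'\<bar> + \<bar>y - y'\<bar>))"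
      using rho resid_pos[OF rho] A[OF that] by (intro mult_mono divide_right_mono) auto
    finally show ?thesis using resid_pos[OF rho] by simp
  qed
  have hmL: "\<bar>hm x y - hm x' y'\<bar> \<le> L1 * (\<bar>x - x'\<bar> + \<bar>y - y'\<bar>)"
    if "x \<in> K M" "x' \<in> K M" "y \<in> K M" "y' \<in> K M" for x x' y y'
  proof -
    have "\<bar>hm x y - hm x' y'\<bar> = 1 / resid \<rho> * \<bar>cond_ratio2 \<rho> (Phi_inv x) (Phi_inv y) - cond_ratio2 \<rho> (Phi_inv x') (Phi_inv y')\<bar>"
      using resid_pos[OF rho] by (simp add: hm_def abs_mult flip: right_diff_distrib diff_divide_distrib)
    also have "\<dots> \<le> 1 / resid \<rho> * (L1 * resid \<rho> * (\<bar>x - x'\<bar> + \<bar>y - y'\<bar>))"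
      using resid_pos[OF rho] B[OF that] by (intro mult_left_mono) auto
    finally show ?thesis using resid_pos[OF rho] by simp
  qed
  have D1: "((\<lambda>x. gauss_copula \<rho> x y) has_real_derivative gx x y) (at x)" if "x \<in> K M" for x y
    unfolding gx_def by (rule DERIV_gauss_copula[OF K01[OF that]])
  have D2: "((\<lambda>x. gx x y) has_real_derivative hx x y) (at x)" if "x \<in> K M" for x y
    unfolding gx_def hx_def by (rule DERIV_gauss_copula_grad(1)[OF K01[OF that]])
  have D3: "((\<lambda>y. gx x y) has_real_derivative hm x y) (at y)" if "y \<in> K M" for x y
    unfolding gx_def hm_def by (rule DERIV_gauss_copula_grad(2)[OF K01[OF that]])
  have T1: "gauss_copula \<rho> x' y \<le> gauss_copula \<rho> x y + gx x y * (x' - x) + hx x y * (x' - x)\<^sup>2 / 2 + L1 * \<bar>x' - x\<bar> ^ 3"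
    if "x \<in> K M" "x' \<in> K M" "y \<in> K M" for x x' y
  proof -
    have "\<bar>gauss_copula \<rho> x' y - gauss_copula \<rho> x y - gx x y * (x' - x) - hx x y * (x' - x)\<^sup>2 / 2\<bar> \<le> L1 * \<bar>x' - x\<bar> ^ 3"
    proof (rule taylor_second_order_lipschitz[of "Phi (-M)" "Phi M"])
      fix s t assume "s \<in> {Phi (-M)..Phi M}" "t \<in> {Phi (-M)..Phi M}"
      then show "\<bar>hx s y - hx t y\<bar> \<le> L1 * \<bar>s - t\<bar>"
        using hxL[of s t y y] that by (simp add: K_def)
    qed (use that D1 D2 L1 in \<open>simp_all add: K_def\<close>)
    then show ?thesis by linarith
  qed
  have T2: "\<bar>gx x y' - gx x y - hm x y * (y' - y)\<bar> \<le> L1 * \<bar>y' - y\<bar>\<^sup>2"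
    if "x \<in> K M" "y \<in> K M" "y' \<in> K M" for x y y'
  proof (rule taylor_first_order_lipschitz[of "Phi (-M)" "Phi M"])
    fix s t assume "s \<in> {Phi (-M)..Phi M}" "t \<in> {Phi (-M)..Phi M}"
    then show "\<bar>hm x s - hm x t\<bar> \<le> L1 * \<bar>s - t\<bar>"
      using hmL[of x x s t] that by (simp add: K_def)
  qed (use that D3 L1 in \<open>simp_all add: K_def\<close>)
  have T: "gauss_copula \<rho> x' y' \<le> gauss_copula \<rho> x y + gx x y * (x' - x) + gx y x * (y' - y)
      + (hx x y * (x' - x)\<^sup>2 + 2 * hm x y * (x' - x) * (y' - y) + hx y x * (y' - y)\<^sup>2) / 2
      + L1 * (\<bar>x' - x\<bar> + \<bar>y' - y\<bar>) ^ 3"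
    if xy: "x \<in> K M" "y \<in> K M" "x' \<in> K M" "y' \<in> K M" for x y x' y'
  proof -
    define a where "a = x' - x"
    define b where "b = y' - y"
    \<comment> \<open>The path first changes x while y' is held fixed, then changes y while x is
      held fixed. The mixed term arises from moving the slope in x back from y' to y.\<close>
    have 1: "gauss_copula \<rho> x' y' \<le> gauss_copula \<rho> x y' + gx x y' * a + hx x y' * a\<^sup>2 / 2 + L1 * \<bar>a\<bar> ^ 3"
      using T1[of x x' y'] xy by (simp add: a_def)
    have 2: "gauss_copula \<rho> x y' \<le> gauss_copula \<rho> x y + gx y x * b + hx y x * b\<^sup>2 / 2 + L1 * \<bar>b\<bar> ^ 3"
      using T1[of y y' x] xy gauss_copula_commute[OF rho, of x] by (simp add: b_def)
    have "gx x y' * a - gx x y * a - hm x y * b * a \<le> \<bar>gx x y' - gx x y - hm x y * b\<bar> * \<bar>a\<bar>"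
      unfolding abs_mult[symmetric] by (simp add: algebra_simps)
    also have "\<dots> \<le> L1 * \<bar>b\<bar>\<^sup>2 * \<bar>a\<bar>"
      using T2[of x y y'] xy by (intro mult_right_mono) (auto simp: b_def)
    finally have 3: "gx x y' * a \<le> gx x y * a + hm x y * b * a + L1 * \<bar>b\<bar>\<^sup>2 * \<bar>a\<bar>" by linarith
    have "hx x y' * a\<^sup>2 / 2 \<le> (hx x y + L1 * \<bar>b\<bar>) * a\<^sup>2 / 2"
      using hxL[of x x y' y] xy by (intro divide_right_mono mult_right_mono) (auto simp: b_def)
    then have 4: "hx x y' * a\<^sup>2 / 2 \<le> hx x y * a\<^sup>2 / 2 + L1 * \<bar>b\<bar> * \<bar>a\<bar>\<^sup>2 / 2"
      by (simp add: algebra_simps add_divide_distrib)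
    \<comment> \<open>The four error terms are part of the expansion of the cube; what is left over
      is nonnegative.\<close>
    have cube: "L1 * (2 * v\<^sup>2 * u + 5 / 2 * v * u\<^sup>2)
        = L1 * (u + v) ^ 3 - (L1 * u ^ 3 + L1 * v ^ 3 + L1 * v\<^sup>2 * u + L1 * v * u\<^sup>2 / 2)" for u v
      by (simp add: power2_eq_square power3_eq_cube algebra_simps)
    have "0 \<le> L1 * (2 * \<bar>b\<bar>\<^sup>2 * \<bar>a\<bar> + 5 / 2 * \<bar>b\<bar> * \<bar>a\<bar>\<^sup>2)"
      using L1 by (intro mult_nonneg_nonneg) auto
    also have "\<dots> = L1 * (\<bar>a\<bar> + \<bar>b\<bar>) ^ 3 - (L1 * \<bar>a\<bar> ^ 3 + L1 * \<bar>b\<bar> ^ 3 + L1 * \<bar>b\<bar>\<^sup>2 * \<bar>a\<bar> + L1 * \<bar>b\<bar> * \<bar>a\<bar>\<^sup>2 / 2)"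
      by (rule cube)
    finally have 5: "L1 * \<bar>a\<bar> ^ 3 + L1 * \<bar>b\<bar> ^ 3 + L1 * \<bar>b\<bar>\<^sup>2 * \<bar>a\<bar> + L1 * \<bar>b\<bar> * \<bar>a\<bar>\<^sup>2 / 2 \<le> L1 * (\<bar>a\<bar> + \<bar>b\<bar>) ^ 3"
      by simp
    have 6: "(hx x y * a\<^sup>2 + 2 * hm x y * a * b + hx y x * b\<^sup>2) / 2 = hx x y * a\<^sup>2 / 2 + hm x y * b * a + hx y x * b\<^sup>2 / 2"
      by (simp add: algebra_simps add_divide_distrib)
    show ?thesis
      using 1 2 3 4 5 unfolding a_def[symmetric] b_def[symmetric] 6 by linarith
  qed
  show ?thesis
  proof (rule that[of L])
    fix x y assume xy: "x \<in> K M" "y \<in> K M"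
    define s where "s = Phi_inv x"
    define t where "t = Phi_inv y"
    define \<alpha> where "\<alpha> = 1 / std_normal_density s"
    define \<beta> where "\<beta> = 1 / std_normal_density t"
    \<comment> \<open>The density of the correlated pair at (s, t).\<close>
    define \<kappa> where "\<kappa> = std_normal_density s * std_normal_density ((t - \<rho> * s) / resid \<rho>) / resid \<rho>"
    have nz [simp]: "std_normal_density z \<noteq> 0" for z
      using std_normal_density_pos[of z] by linarith
    have "\<alpha> \<le> c" "\<beta> \<le> c"
      using QM xy unfolding \<alpha>_def \<beta>_def c_def s_def t_def
      by (intro divide_left_mono std_normal_density_mono; simp)+
    then have ab: "\<bar>\<alpha>\<bar> \<le> L" "\<bar>\<beta>\<bar> \<le> L"
      using LL by (simp_all add: \<alpha>_def \<beta>_def)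
    have "\<kappa> \<le> 1 * 1 / resid \<rho>"
      unfolding \<kappa>_def using resid_pos[OF rho] by (intro divide_right_mono mult_mono std_normal_density_le_1) auto
    then have k: "0 \<le> \<kappa>" "\<kappa> \<le> L" using LL resid_pos[OF rho] by (simp_all add: \<kappa>_def)
    have h1: "hx x y = - \<kappa> * \<rho> * \<alpha>\<^sup>2"
      using resid_pos[OF rho] unfolding hx_def s_def[symmetric] t_def[symmetric] std_normal_density_quotient[symmetric] \<kappa>_def \<alpha>_def
      by (simp add: field_simps power2_eq_square)
    have h2: "hm x y = \<kappa> * \<alpha> * \<beta>"
      using resid_pos[OF rho] unfolding hm_def s_def[symmetric] t_def[symmetric] std_normal_density_quotient[symmetric] \<kappa>_def \<alpha>_def \<beta>_def
      by (simp add: field_simps power2_eq_square)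
    have h3: "hx y x = - \<kappa> * \<rho> * \<beta>\<^sup>2"
      using resid_pos[OF rho] unfolding hx_def s_def[symmetric] t_def[symmetric] std_normal_density_quotient[symmetric] \<kappa>_def \<beta>_def
        std_normal_density_exchange[of s t]
      by (simp add: field_simps power2_eq_square)
    have tay: "gauss_copula \<rho> x' y' \<le> gauss_copula \<rho> x y + gx x y * (x' - x) + gx y x * (y' - y)
        + \<kappa> / 2 * (2 * (\<alpha> * (x' - x)) * (\<beta> * (y' - y)) - \<rho> * (\<alpha> * (x' - x))\<^sup>2 - \<rho> * (\<beta> * (y' - y))\<^sup>2)
        + L * (\<bar>x' - x\<bar> + \<bar>y' - y\<bar>) ^ 3" if "x' \<in> K M" "y' \<in> K M" for x' y'
    proof -
      have "(hx x y * (x' - x)\<^sup>2 + 2 * hm x y * (x' - x) * (y' - y) + hx y x * (y' - y)\<^sup>2) / 2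
         = \<kappa> / 2 * (2 * (\<alpha> * (x' - x)) * (\<beta> * (y' - y)) - \<rho> * (\<alpha> * (x' - x))\<^sup>2 - \<rho> * (\<beta> * (y' - y))\<^sup>2)"
      proof -
        have "(- \<kappa> * \<rho> * \<alpha>\<^sup>2 * a\<^sup>2 + 2 * (\<kappa> * \<alpha> * \<beta>) * a * b + - \<kappa> * \<rho> * \<beta>\<^sup>2 * b\<^sup>2) / 2
          = \<kappa> / 2 * (2 * (\<alpha> * a) * (\<beta> * b) - \<rho> * (\<alpha> * a)\<^sup>2 - \<rho> * (\<beta> * b)\<^sup>2)" for a b
          by (simp add: power2_eq_square field_simps)
        then show ?thesis unfolding h1 h2 h3 .
      qed
      moreover have "L1 * (\<bar>x' - x\<bar> + \<bar>y' - y\<bar>) ^ 3 \<le> L * (\<bar>x' - x\<bar> + \<bar>y' - y\<bar>) ^ 3"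
        using LL by (intro mult_right_mono) auto
      ultimately show ?thesis using T[OF xy that] by linarith
    qed
    show "\<exists>p q \<alpha> \<beta> \<kappa>. \<bar>\<alpha>\<bar> \<le> L \<and> \<bar>\<beta>\<bar> \<le> L \<and> 0 \<le> \<kappa> \<and> \<kappa> \<le> L \<and>
      (\<forall>x'\<in>K M. \<forall>y'\<in>K M. gauss_copula \<rho> x' y' \<le> gauss_copula \<rho> x y + p * (x' - x) + q * (y' - y)
        + \<kappa> / 2 * (2 * (\<alpha> * (x' - x)) * (\<beta> * (y' - y)) - \<rho> * (\<alpha> * (x' - x))\<^sup>2 - \<rho> * (\<beta> * (y' - y))\<^sup>2)
        + L * (\<bar>x' - x\<bar> + \<bar>y' - y\<bar>) ^ 3)"
      by (rule exI[of _ "gx x y"], rule exI[of _ "gx y x"], rule exI[of _ \<alpha>],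
          rule exI[of _ \<beta>], rule exI[of _ \<kappa>], use ab k tay in simp)
  qed (use LL in auto)
qed

end

section \<open>One step of the interpolation\<close>

text \<open>The map \<open>T\<close> will be \<open>fst\<close> or \<open>corr \<rho>\<close>, so
  both members of the correlated pair are served. Increments are measured from the mean m, since the
  copula will be expanded there. The increment has size sqrt h, and it differs from its linear part
  by size h only. As \<open>R p\<close> is at least 1, lower powers of it are absorbed into higher
  ones.\<close>

lemma increment_bounds:
  fixes w :: "'a::euclidean_space \<Rightarrow> real" and T :: "'p::euclidean_space \<Rightarrow> 'a"
  assumes [measurable]: "w \<in> borel_measurable borel" "T \<in> borel_measurable borel"
    and w: "\<And>x. w x \<in> {0..1}"
    and D: "\<And>v. \<bar>w (x + v) - w x - D \<bullet> v\<bar> \<le> C * (norm v)\<^sup>2"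
    and T: "\<And>p. norm (T p) \<le> 2 * norm p"
    and DT: "integrable gauss (\<lambda>p. D \<bullet> T p)" "(\<integral>p. D \<bullet> T p \<partial>gauss) = 0"
    and h: "0 < h" "h \<le> 1"
  defines "m \<equiv> \<integral>p. w (x + sqrt h *\<^sub>R T p) \<partial>gauss"
    and "R \<equiv> \<lambda>p. 1 + norm p"
    and "E \<equiv> 4 * C * (1 + (\<integral>p. (1 + norm p)\<^sup>2 \<partial>(gauss::'p measure)))"
  shows "\<bar>w (x + sqrt h *\<^sub>R T p) - m - sqrt h * (D \<bullet> T p)\<bar> \<le> h * E * (R p)\<^sup>2"
    and "\<bar>sqrt h * (D \<bullet> T p)\<bar> \<le> sqrt h * (2 * (1 + C) + E) * (R p)\<^sup>2"
    and "\<bar>w (x + sqrt h *\<^sub>R T p) - m\<bar> \<le> sqrt h * (2 * (1 + C) + E) * (R p)\<^sup>2"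
proof -
  define \<mu> where "\<mu> = (\<integral>p. (R p)\<^sup>2 \<partial>(gauss::'p measure))"
  have iR: "integrable gauss (\<lambda>p::'p. (R p)\<^sup>2)" unfolding R_def by (rule integrable_gauss_norm_pow)
  have R1: "1 \<le> R p" for p by (simp add: R_def)
  have R2: "R p \<le> (R p)\<^sup>2" "1 \<le> (R p)\<^sup>2" for p
    using R1[of p] self_le_power[of "R p" 2] by (auto intro: one_le_power)
  have C: "C \<ge> 0"
  proof -
    obtain b :: 'a where "b \<in> Basis" using nonempty_Basis by blast
    then show ?thesis using order_trans[OF abs_ge_zero D[of b]] by simp
  qed
  have \<mu>0: "\<mu> \<ge> 0" by (simp add: \<mu>_def)
  have E: "E = 4 * C * (1 + \<mu>)" by (simp add: E_def \<mu>_def R_def)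
  have E0: "E \<ge> 0" using C \<mu>0 by (simp add: E)
  have TR: "norm (T p) \<le> 2 * R p" for p using T[of p] by (simp add: R_def)
  let ?W = "\<lambda>p. w (x + sqrt h *\<^sub>R T p)"
  have iW: "integrable gauss ?W"
    using w by (intro integrable_gauss_bounded[of _ 1]) auto
  have e: "\<bar>?W p - w x - sqrt h * (D \<bullet> T p)\<bar> \<le> 4 * C * h * (R p)\<^sup>2" for p
  proof -
    have "\<bar>?W p - w x - sqrt h * (D \<bullet> T p)\<bar> \<le> C * (norm (sqrt h *\<^sub>R T p))\<^sup>2"
      using D[of "sqrt h *\<^sub>R T p"] by simp
    also have "\<dots> \<le> C * (sqrt h * (2 * R p))\<^sup>2"
      using TR[of p] h C by (intro mult_left_mono power_mono) (auto intro: mult_left_mono)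
    also have "\<dots> = 4 * C * h * (R p)\<^sup>2" using h by (simp add: power_mult_distrib)
    finally show ?thesis .
  qed
  \<comment> \<open>The linear part has mean zero, so passing from \<open>w x\<close> to the mean m
    costs only the integrated quadratic error, of order h.\<close>
  have mx: "\<bar>m - w x\<bar> \<le> 4 * C * h * \<mu>"
  proof -
    have "m - w x = (\<integral>p. ?W p - w x - sqrt h * (D \<bullet> T p) \<partial>gauss)"
      using iW DT by (simp add: m_def)
    also have "\<bar>\<dots>\<bar> \<le> (\<integral>p. \<bar>?W p - w x - sqrt h * (D \<bullet> T p)\<bar> \<partial>gauss)" by (rule integral_abs_bound)
    also have "\<dots> \<le> (\<integral>p. 4 * C * h * (R p)\<^sup>2 \<partial>gauss)"
      using iW DT(1) iR e by (intro integral_mono integrable_abs Bochner_Integration.integrable_diff integrable_mult_right) auto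
    finally show ?thesis using iR by (simp add: \<mu>_def)
  qed
  show 1: "\<bar>?W p - m - sqrt h * (D \<bullet> T p)\<bar> \<le> h * E * (R p)\<^sup>2" for p
  proof -
    have "\<bar>?W p - m - sqrt h * (D \<bullet> T p)\<bar> \<le> 4 * C * h * (R p)\<^sup>2 + 4 * C * h * \<mu> * 1"
      using e[of p] mx by linarith
    also have "\<dots> \<le> 4 * C * h * (R p)\<^sup>2 + 4 * C * h * \<mu> * (R p)\<^sup>2"
      using C h \<mu>0 R2[of p] by (intro add_left_mono mult_left_mono) auto
    finally show ?thesis by (simp add: E algebra_simps)
  qed
  \<comment> \<open>A unit step in the direction of D changes w by at most 1, because w has values
    between 0 and 1, and the quadratic error of that step is at most C.\<close>
  have nD: "norm D \<le> 1 + C"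
  proof (cases "D = 0")
    case False
    have "D \<bullet> (D /\<^sub>R norm D) = norm D"
      using False by (simp add: dot_square_norm power2_eq_square)
    moreover have "\<bar>w (x + D /\<^sub>R norm D) - w x\<bar> \<le> 1"
      using w[of x] w[of "x + D /\<^sub>R norm D"] by auto
    ultimately show ?thesis using D[of "D /\<^sub>R norm D"] False by simp
  qed (use C in auto)
  have 2: "\<bar>sqrt h * (D \<bullet> T p)\<bar> \<le> sqrt h * (2 * (1 + C)) * (R p)\<^sup>2" for p
  proof -
    have "\<bar>D \<bullet> T p\<bar> \<le> norm D * norm (T p)" by (rule Cauchy_Schwarz_ineq2)
    also have "\<dots> \<le> (1 + C) * (2 * R p)" using nD TR[of p] C by (intro mult_mono) auto
    also have "\<dots> \<le> (1 + C) * (2 * (R p)\<^sup>2)" using R2[of p] C by (intro mult_left_mono) auto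
    finally have "sqrt h * \<bar>D \<bullet> T p\<bar> \<le> sqrt h * ((1 + C) * (2 * (R p)\<^sup>2))"
      using h by (intro mult_left_mono) auto
    then show ?thesis using h by (simp add: abs_mult algebra_simps)
  qed
  have "0 \<le> sqrt h * E * (R p)\<^sup>2" for p using h E0 by simp
  then show "\<bar>sqrt h * (D \<bullet> T p)\<bar> \<le> sqrt h * (2 * (1 + C) + E) * (R p)\<^sup>2"
    using 2[of p] by (simp add: distrib_left distrib_right add_increasing2)
  have "h \<le> sqrt h" using h by (intro real_le_rsqrt) (simp add: power2_eq_square mult_left_le)
  then have "h * E * (R p)\<^sup>2 \<le> sqrt h * E * (R p)\<^sup>2" using E0 by (intro mult_right_mono) auto
  moreover have "sqrt h * (2 * (1 + C) + E) * (R p)\<^sup>2 = sqrt h * (2 * (1 + C)) * (R p)\<^sup>2 + sqrt h * E * (R p)\<^sup>2"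
    by (simp add: algebra_simps)
  ultimately show "\<bar>?W p - m\<bar> \<le> sqrt h * (2 * (1 + C) + E) * (R p)\<^sup>2"
    using 1[of p] 2[of p] by linarith
qed

text \<open>The increments are replaced by their linear parts. Each product changes by at most 2 P
  S, and the weights of the three terms add up to at most 4. With P of order sqrt h and S of order h
  the loss is of order h^(3/2).\<close>

lemma quadratic_form_perturb:
  fixes A B A0 B0 P S \<rho> :: real
  assumes "\<bar>A\<bar> \<le> P" "\<bar>A0\<bar> \<le> P" "\<bar>B\<bar> \<le> P" "\<bar>B0\<bar> \<le> P" "\<bar>A - A0\<bar> \<le> S" "\<bar>B - B0\<bar> \<le> S"
    and rho: "0 \<le> \<rho>" "\<rho> \<le> 1"
  shows "2 * A * B - \<rho> * A\<^sup>2 - \<rho> * B\<^sup>2 \<le> 2 * A0 * B0 - \<rho> * A0\<^sup>2 - \<rho> * B0\<^sup>2 + 8 * (P * S)"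
proof -
  have m: "x * y \<le> P * S" if "\<bar>x\<bar> \<le> P" "\<bar>y\<bar> \<le> S" for x y
  proof -
    have "x * y \<le> \<bar>x\<bar> * \<bar>y\<bar>" by (simp flip: abs_mult)
    also have "\<dots> \<le> P * S" using that by (intro mult_mono) auto
    finally show ?thesis .
  qed
  have PS: "0 \<le> P * S" using assms(1,5) by (intro mult_nonneg_nonneg) linarith+
  have sq: "- \<rho> * x\<^sup>2 + \<rho> * y\<^sup>2 \<le> 2 * (P * S)" if "\<bar>x\<bar> \<le> P" "\<bar>y\<bar> \<le> P" "\<bar>x - y\<bar> \<le> S" for x y
  proof -
    have "y * (y - x) \<le> P * S" "x * (y - x) \<le> P * S" using that by (auto intro!: m)
    then have "y\<^sup>2 - x\<^sup>2 \<le> 2 * (P * S)" by (simp add: power2_eq_square algebra_simps)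
    then have "\<rho> * (y\<^sup>2 - x\<^sup>2) \<le> \<rho> * (2 * (P * S))" using rho by (intro mult_left_mono)
    also have "\<dots> \<le> 1 * (2 * (P * S))" using rho PS by (intro mult_right_mono) auto
    finally show ?thesis by (simp add: algebra_simps)
  qed
  have "A * (B - B0) \<le> P * S" "B0 * (A - A0) \<le> P * S" using assms by (auto intro!: m)
  then have "A * B - A0 * B0 \<le> 2 * (P * S)" by (simp add: algebra_simps)
  then show ?thesis using sq[of A A0] sq[of B B0] assms by (simp add: algebra_simps)
qed

section \<open>Correlated pairs and the one-step inequality\<close>

lemma integral_gauss_fst:
  fixes f :: "'a::euclidean_space \<Rightarrow> real"
  assumes [measurable]: "f \<in> borel_measurable borel" and "\<And>x. \<bar>f x\<bar> \<le> B"
  shows "(\<integral>p. f (fst p) \<partial>(gauss::('a \<times> 'b::euclidean_space) measure)) = (\<integral>x. f x \<partial>gauss)"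
  using assms by (subst integral_gauss_pair) (auto intro!: integrable_gauss_bounded)

text \<open>For a Gaussian p = (x, z) this is y = \<rho> x + \<open>resid \<rho>\<close> z, so
  (\<open>fst p\<close>, \<open>corr \<rho> p\<close>) is the correlated pair. Both components are
  linear in p, hence an independent increment of p splits off from both at once.\<close>

definition corr :: "real \<Rightarrow> 'a::euclidean_space \<times> 'a \<Rightarrow> 'a" where
  "corr \<rho> p = \<rho> *\<^sub>R fst p + resid \<rho> *\<^sub>R snd p"

lemma borel_measurable_corr [measurable]: "corr \<rho> \<in> borel_measurable borel"
  unfolding corr_def[abs_def] by (intro borel_measurable_continuous_onI continuous_intros)

lemma corr_linear: "corr \<rho> (a + b) = corr \<rho> a + corr \<rho> b" "corr \<rho> (c *\<^sub>R a) = c *\<^sub>R corr \<rho> a"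
  by (simp_all add: corr_def algebra_simps)

context
  fixes \<rho> :: real
  assumes rho: "0 \<le> \<rho>" "\<rho> < 1"
begin

lemma integral_gauss_corr:
  fixes f :: "'a::euclidean_space \<Rightarrow> real"
  assumes [measurable]: "f \<in> borel_measurable borel" and b: "\<And>x. \<bar>f x\<bar> \<le> B"
  shows "(\<integral>p. f (corr \<rho> p) \<partial>gauss) = (\<integral>x. f x \<partial>gauss)"
proof -
  have "(\<integral>p. f (corr \<rho> p) \<partial>gauss) = (\<integral>x. \<integral>z. f (\<rho> *\<^sub>R x + resid \<rho> *\<^sub>R z) \<partial>gauss \<partial>gauss)"
    using b by (subst integral_gauss_pair) (auto intro!: integrable_gauss_bounded simp: corr_def)
  also have "\<dots> = (\<integral>z. f (sqrt (\<rho>\<^sup>2 + (resid \<rho>)\<^sup>2) *\<^sub>R z) \<partial>gauss)"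
    using b rho by (intro integral_gauss_conv) auto
  finally show ?thesis by (simp add: resid_sq[OF rho])
qed

lemma norm_corr: "norm (corr \<rho> p) \<le> 2 * norm p"
proof -
  have "resid \<rho> \<le> 1" using rho by (simp add: resid_def)
  have "norm (corr \<rho> p) \<le> \<rho> * norm (fst p) + resid \<rho> * norm (snd p)"
    using rho resid_pos[OF rho] norm_triangle_ineq[of "\<rho> *\<^sub>R fst p" "resid \<rho> *\<^sub>R snd p"] by (simp add: corr_def)
  also have "\<dots> \<le> 1 * norm p + 1 * norm p"
    using rho resid_pos[OF rho] \<open>resid \<rho> \<le> 1\<close> norm_fst_le[of "fst p" "snd p"] norm_snd_le[of "snd p" "fst p"]
    by (intro add_mono mult_mono) auto
  finally show ?thesis by simp
qed

lemma inner_corr: "D \<bullet> corr \<rho> p = (\<rho> *\<^sub>R D, resid \<rho> *\<^sub>R D) \<bullet> p"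
  by (cases p) (simp add: corr_def inner_simps)

lemma inner_fst: "D \<bullet> fst p = (D, 0) \<bullet> p"
  by (cases p) simp

text \<open>The copula is expanded at the means m and n of the two random arguments: the linear
  terms integrate to zero, the expected quadratic term is nonpositive, and all errors are of order
  h^(3/2). It matters that K depends on the functions, points and step length only through M and C,
  since the errors are summed over many steps.\<close>

lemma gauss_copula_step:
  fixes M C :: real
  obtains K where "K \<ge> 0" "\<And>(w::'a::euclidean_space \<Rightarrow> real) z x y D D' h.
    w \<in> borel_measurable borel \<Longrightarrow> z \<in> borel_measurable borel \<Longrightarrow>
    (\<And>x. w x \<in> {Phi (-M)..Phi M}) \<Longrightarrow> (\<And>x. z x \<in> {Phi (-M)..Phi M}) \<Longrightarrow>
    (\<And>v. \<bar>w (x + v) - w x - D \<bullet> v\<bar> \<le> C * (norm v)\<^sup>2) \<Longrightarrow>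
    (\<And>v. \<bar>z (y + v) - z y - D' \<bullet> v\<bar> \<le> C * (norm v)\<^sup>2) \<Longrightarrow>
    0 < h \<Longrightarrow> h \<le> 1 \<Longrightarrow>
    (\<integral>p. gauss_copula \<rho> (w (x + sqrt h *\<^sub>R fst p)) (z (y + sqrt h *\<^sub>R corr \<rho> p)) \<partial>gauss)
      \<le> gauss_copula \<rho> (\<integral>p. w (x + sqrt h *\<^sub>R p) \<partial>gauss) (\<integral>p. z (y + sqrt h *\<^sub>R p) \<partial>gauss) + K * (h * sqrt h)"
proof -
  obtain L where L: "L \<ge> 1" and
    Jt: "\<And>x y. x \<in> {Phi (-M)..Phi M} \<Longrightarrow> y \<in> {Phi (-M)..Phi M} \<Longrightarrow> \<exists>p q \<alpha> \<beta> \<kappa>. \<bar>\<alpha>\<bar> \<le> L \<and> \<bar>\<beta>\<bar> \<le> L \<and> 0 \<le> \<kappa> \<and> \<kappa> \<le> L \<and>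
      (\<forall>x'\<in>{Phi (-M)..Phi M}. \<forall>y'\<in>{Phi (-M)..Phi M}. gauss_copula \<rho> x' y' \<le> gauss_copula \<rho> x y + p * (x' - x) + q * (y' - y)
        + \<kappa> / 2 * (2 * (\<alpha> * (x' - x)) * (\<beta> * (y' - y)) - \<rho> * (\<alpha> * (x' - x))\<^sup>2 - \<rho> * (\<beta> * (y' - y))\<^sup>2)
        + L * (\<bar>x' - x\<bar> + \<bar>y' - y\<bar>) ^ 3)"
    using gauss_copula_taylor[OF rho, of M] by metis
  define R where "R p = 1 + norm p" for p :: "'a \<times> 'a"
  define E where "E = 4 * C * (1 + (\<integral>p. (1 + norm p)\<^sup>2 \<partial>(gauss::('a\<times>'a) measure)))"
  define G where "G = 2 * (1 + C) + E"
  \<comment> \<open>The first summand comes from replacing increments by linear parts (\<kappa> / 2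
    times 8 P S, with an L inside each of P and S and \<kappa> <= L), the second from the cubic
    remainder of the copula. The former carries the fourth power of R, the latter the sixth, hence
    the sixth moment below.\<close>
  define K0 where "K0 = 4 * L ^ 3 * G * E + 8 * L * G ^ 3"
  define \<mu> where "\<mu> = (\<integral>p. (R p) ^ 6 \<partial>(gauss::('a\<times>'a) measure))"
  have R1: "1 \<le> R p" for p by (simp add: R_def)
  have iR: "integrable gauss (\<lambda>p. (R p) ^ 6)" unfolding R_def by (rule integrable_gauss_norm_pow)
  show ?thesis
  \<comment> \<open>The absolute value makes the constant nonnegative for every C; that C is
    nonnegative follows only once a function with such a Taylor bound is given.\<close>
  proof (rule that[of "\<bar>K0 * \<mu>\<bar>"])
    fix w z :: "'a \<Rightarrow> real" and x y D D' :: 'a and h :: real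
    assume [measurable]: "w \<in> borel_measurable borel" "z \<in> borel_measurable borel"
      and w: "\<And>x. w x \<in> {Phi (-M)..Phi M}" and z: "\<And>x. z x \<in> {Phi (-M)..Phi M}"
      and Dw: "\<And>v. \<bar>w (x + v) - w x - D \<bullet> v\<bar> \<le> C * (norm v)\<^sup>2"
      and Dz: "\<And>v. \<bar>z (y + v) - z y - D' \<bullet> v\<bar> \<le> C * (norm v)\<^sup>2"
      and h: "0 < h" "h \<le> 1"
    have C: "C \<ge> 0"
    proof -
      obtain b :: 'a where "b \<in> Basis" using nonempty_Basis by blast
      then show ?thesis using order_trans[OF abs_ge_zero Dw[of b]] by simp
    qed
    have E0: "E \<ge> 0" using C unfolding E_def by (intro mult_nonneg_nonneg add_nonneg_nonneg integral_nonneg_AE) auto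
    have G0: "G \<ge> 0" using C E0 by (simp add: G_def)
    define W where "W p = w (x + sqrt h *\<^sub>R fst p)" for p :: "'a \<times> 'a"
    define Z where "Z p = z (y + sqrt h *\<^sub>R corr \<rho> p)" for p :: "'a \<times> 'a"
    define m where "m = (\<integral>p. W p \<partial>gauss)"
    define n where "n = (\<integral>p. Z p \<partial>gauss)"
    have [measurable]: "W \<in> borel_measurable borel" "Z \<in> borel_measurable borel"
      unfolding W_def[abs_def] Z_def[abs_def] by measurable
    have range01: "{Phi (-M)..Phi M} \<subseteq> {0..1}"
      using Phi_nonneg[of "-M"] Phi_le_1[of M] by (auto intro: order_trans)
    have w01: "w x \<in> {0..1}" and z01: "z x \<in> {0..1}" for x
      using w[of x] z[of x] range01 by blast+
    have WK: "W p \<in> {Phi (-M)..Phi M}" and ZK: "Z p \<in> {Phi (-M)..Phi M}" for p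
      using w z unfolding W_def Z_def by blast+
    have WZ1: "\<bar>W p\<bar> \<le> 1" "\<bar>Z p\<bar> \<le> 1" for p
      using w01[of "x + sqrt h *\<^sub>R fst p"] z01[of "y + sqrt h *\<^sub>R corr \<rho> p"] by (auto simp: W_def Z_def)
    have iW: "integrable gauss W" "integrable gauss Z"
      using WZ1 by (auto intro!: integrable_gauss_bounded[of _ 1])
    have mK: "m \<in> {Phi (-M)..Phi M}" "n \<in> {Phi (-M)..Phi M}"
      using WK ZK iW unfolding m_def n_def by (auto intro!: gauss.integral_ge_const gauss.integral_le_const)
    have m_eq: "m = (\<integral>p. w (x + sqrt h *\<^sub>R p) \<partial>gauss)"
      unfolding m_def W_def using w01 by (intro integral_gauss_fst[of _ 1]) auto
    have n_eq: "n = (\<integral>p. z (y + sqrt h *\<^sub>R p) \<partial>gauss)"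
      unfolding n_def Z_def using z01 by (intro integral_gauss_corr[of "\<lambda>p. z (y + sqrt h *\<^sub>R p)" 1]) auto
    define a0 where "a0 p = sqrt h * (D \<bullet> fst p)" for p :: "'a \<times> 'a"
    define b0 where "b0 p = sqrt h * (D' \<bullet> corr \<rho> p)" for p :: "'a \<times> 'a"
    have incW: "\<bar>W p - m - a0 p\<bar> \<le> h * E * (R p)\<^sup>2" "\<bar>a0 p\<bar> \<le> sqrt h * G * (R p)\<^sup>2" "\<bar>W p - m\<bar> \<le> sqrt h * G * (R p)\<^sup>2" for p
    proof -
      have f: "norm (fst p) \<le> 2 * norm p" for p :: "'a \<times> 'a" using order_trans[OF norm_fst_le[of "fst p" "snd p"], of "2 * norm p"] by simp
      have i: "integrable gauss (\<lambda>p::'a\<times>'a. D \<bullet> fst p)" "(\<integral>p. D \<bullet> fst p \<partial>(gauss::('a\<times>'a) measure)) = 0"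
        unfolding inner_fst by (simp_all only: integrable_gauss_inner integral_gauss_inner)
      note inc = increment_bounds[of w fst x D C h p, OF _ _ w01 Dw f i h]
      show "\<bar>W p - m - a0 p\<bar> \<le> h * E * (R p)\<^sup>2" "\<bar>a0 p\<bar> \<le> sqrt h * G * (R p)\<^sup>2" "\<bar>W p - m\<bar> \<le> sqrt h * G * (R p)\<^sup>2"
        using inc by (simp_all add: W_def m_def a0_def E_def R_def G_def)
    qed
    have incZ: "\<bar>Z p - n - b0 p\<bar> \<le> h * E * (R p)\<^sup>2" "\<bar>b0 p\<bar> \<le> sqrt h * G * (R p)\<^sup>2" "\<bar>Z p - n\<bar> \<le> sqrt h * G * (R p)\<^sup>2" for p
    proof -
      have i: "integrable gauss (\<lambda>p::'a\<times>'a. D' \<bullet> corr \<rho> p)" "(\<integral>p. D' \<bullet> corr \<rho> p \<partial>(gauss::('a\<times>'a) measure)) = 0"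
        unfolding inner_corr by (simp_all only: integrable_gauss_inner integral_gauss_inner)
      note inc = increment_bounds[of z "corr \<rho>" y D' C h p, OF _ _ z01 Dz norm_corr i h]
      show "\<bar>Z p - n - b0 p\<bar> \<le> h * E * (R p)\<^sup>2" "\<bar>b0 p\<bar> \<le> sqrt h * G * (R p)\<^sup>2" "\<bar>Z p - n\<bar> \<le> sqrt h * G * (R p)\<^sup>2"
        using inc by (simp_all add: Z_def n_def b0_def E_def R_def G_def)
    qed
    obtain p q \<alpha> \<beta> \<kappa> where ab: "\<bar>\<alpha>\<bar> \<le> L" "\<bar>\<beta>\<bar> \<le> L" and k: "0 \<le> \<kappa>" "\<kappa> \<le> L"
      and Jb: "\<And>x' y'. x' \<in> {Phi (-M)..Phi M} \<Longrightarrow> y' \<in> {Phi (-M)..Phi M} \<Longrightarrow> gauss_copula \<rho> x' y' \<le> gauss_copula \<rho> m n + p * (x' - m) + q * (y' - n)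
        + \<kappa> / 2 * (2 * (\<alpha> * (x' - m)) * (\<beta> * (y' - n)) - \<rho> * (\<alpha> * (x' - m))\<^sup>2 - \<rho> * (\<beta> * (y' - n))\<^sup>2)
        + L * (\<bar>x' - m\<bar> + \<bar>y' - n\<bar>) ^ 3"
      using Jt[OF mK] by blast
    define Q0 where "Q0 u = 2 * (\<alpha> * a0 u) * (\<beta> * b0 u) - \<rho> * (\<alpha> * a0 u)\<^sup>2 - \<rho> * (\<beta> * b0 u)\<^sup>2" for u
    have pw: "gauss_copula \<rho> (W u) (Z u) \<le> gauss_copula \<rho> m n + p * (W u - m) + q * (Z u - n) + \<kappa> / 2 * Q0 u + K0 * (h * sqrt h) * (R u) ^ 6" for u
    proof -
      let ?P = "L * (sqrt h * G * (R u)\<^sup>2)" and ?S = "L * (h * E * (R u)\<^sup>2)"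
      have mm: "\<bar>c * v\<bar> \<le> L * B" if "\<bar>c\<bar> \<le> L" "\<bar>v\<bar> \<le> B" for c v B
        unfolding abs_mult using that L by (intro mult_mono) auto
      have "2 * (\<alpha> * (W u - m)) * (\<beta> * (Z u - n)) - \<rho> * (\<alpha> * (W u - m))\<^sup>2 - \<rho> * (\<beta> * (Z u - n))\<^sup>2 \<le> Q0 u + 8 * (?P * ?S)"
        unfolding Q0_def
      proof (rule quadratic_form_perturb)
        show "\<bar>\<alpha> * (W u - m) - \<alpha> * a0 u\<bar> \<le> ?S" unfolding right_diff_distrib[symmetric]
          using ab incW(1)[of u] by (intro mm) auto
        show "\<bar>\<beta> * (Z u - n) - \<beta> * b0 u\<bar> \<le> ?S" unfolding right_diff_distrib[symmetric]
          using ab incZ(1)[of u] by (intro mm) auto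
      qed (use ab incW(2,3)[of u] incZ(2,3)[of u] rho in \<open>auto intro!: mm\<close>)
      then have "\<kappa> / 2 * (2 * (\<alpha> * (W u - m)) * (\<beta> * (Z u - n)) - \<rho> * (\<alpha> * (W u - m))\<^sup>2 - \<rho> * (\<beta> * (Z u - n))\<^sup>2)
          \<le> \<kappa> / 2 * (Q0 u + 8 * (?P * ?S))"
        using k by (intro mult_left_mono) auto
      also have "\<dots> = \<kappa> / 2 * Q0 u + \<kappa> * (4 * (?P * ?S))" by (simp add: algebra_simps)
      also have "\<kappa> * (4 * (?P * ?S)) \<le> L * (4 * (?P * ?S))"
        using k L G0 E0 h R1[of u] by (intro mult_right_mono) auto
      also have "L * (4 * (?P * ?S)) = 4 * L ^ 3 * G * E * (h * sqrt h) * R u ^ 4"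
        by (simp add: power_numeral_reduce mult_ac)
      also have "\<dots> \<le> 4 * L ^ 3 * G * E * (h * sqrt h) * R u ^ 6"
        using L G0 E0 h R1[of u] by (intro mult_left_mono power_increasing) auto
      finally have 1: "\<kappa> / 2 * (2 * (\<alpha> * (W u - m)) * (\<beta> * (Z u - n)) - \<rho> * (\<alpha> * (W u - m))\<^sup>2 - \<rho> * (\<beta> * (Z u - n))\<^sup>2)
          \<le> \<kappa> / 2 * Q0 u + 4 * L ^ 3 * G * E * (h * sqrt h) * R u ^ 6" by simp
      have "L * (\<bar>W u - m\<bar> + \<bar>Z u - n\<bar>) ^ 3 \<le> L * (sqrt h * G * (R u)\<^sup>2 + sqrt h * G * (R u)\<^sup>2) ^ 3"
        using L incW(3)[of u] incZ(3)[of u] by (intro mult_left_mono power_mono add_mono) auto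
      also have "\<dots> = 8 * L * G ^ 3 * (sqrt h * sqrt h * sqrt h) * R u ^ 6"
        by (simp add: power_numeral_reduce mult_ac)
      also have "sqrt h * sqrt h = h" using h by simp
      finally have 2: "L * (\<bar>W u - m\<bar> + \<bar>Z u - n\<bar>) ^ 3 \<le> 8 * L * G ^ 3 * (h * sqrt h) * R u ^ 6" .
      have "K0 * (h * sqrt h) * R u ^ 6 = 4 * L ^ 3 * G * E * (h * sqrt h) * R u ^ 6 + 8 * L * G ^ 3 * (h * sqrt h) * R u ^ 6"
        by (simp add: K0_def algebra_simps)
      then show ?thesis using Jb[OF WK ZK, of u u] 1 2 by linarith
    qed
    have aa: "\<alpha> * a0 u = ((\<alpha> * sqrt h) *\<^sub>R D, 0) \<bullet> u" for u
      by (cases u) (simp add: a0_def)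
    have bb: "\<beta> * b0 u = ((\<beta> * sqrt h * \<rho>) *\<^sub>R D', (\<beta> * sqrt h * resid \<rho>) *\<^sub>R D') \<bullet> u" for u
      by (cases u) (simp add: b0_def corr_def inner_simps algebra_simps)
    have Q0_eq: "Q0 u = 2 * ((\<alpha> * a0 u) * (\<beta> * b0 u)) - \<rho> * ((\<alpha> * a0 u) * (\<alpha> * a0 u)) - \<rho> * ((\<beta> * b0 u) * (\<beta> * b0 u))" for u
      by (simp add: Q0_def power2_eq_square)
    have iQ0: "integrable gauss Q0"
      unfolding Q0_eq[abs_def] aa bb
      by (intro Bochner_Integration.integrable_diff integrable_mult_right integrable_gauss_inner_mult)
    have "(\<integral>u. Q0 u \<partial>gauss) = 2 * (((\<alpha> * sqrt h) *\<^sub>R D, 0) \<bullet> ((\<beta> * sqrt h * \<rho>) *\<^sub>R D', (\<beta> * sqrt h * resid \<rho>) *\<^sub>R D'))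
       - \<rho> * (((\<alpha> * sqrt h) *\<^sub>R D, 0) \<bullet> ((\<alpha> * sqrt h) *\<^sub>R D, 0::'a))
       - \<rho> * (((\<beta> * sqrt h * \<rho>) *\<^sub>R D', (\<beta> * sqrt h * resid \<rho>) *\<^sub>R D') \<bullet> ((\<beta> * sqrt h * \<rho>) *\<^sub>R D', (\<beta> * sqrt h * resid \<rho>) *\<^sub>R D'))"
      unfolding Q0_eq aa bb
      by (simp only: Bochner_Integration.integral_diff integrable_mult_right integrable_gauss_inner_mult
          Bochner_Integration.integrable_diff integral_mult_right_zero integral_gauss_inner_mult)
    \<comment> \<open>With E[x_i y_i] = \<rho> the expectation is -\<rho> h |\<alpha> D - \<beta>
      D'|^2. Here the correlation of the increments meets the parameter of the copula; the last
      summand is zero because \<open>(resid \<rho>)\<^sup>2 = 1 - \<rho>\<^sup>2\<close>.\<close>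
    also have "\<dots> = - \<rho> * (sqrt h * sqrt h) * (2 * 0 + (\<alpha> *\<^sub>R D - \<beta> *\<^sub>R D') \<bullet> (\<alpha> *\<^sub>R D - \<beta> *\<^sub>R D') )
       + \<rho> * (sqrt h * sqrt h) * \<beta>\<^sup>2 * (D' \<bullet> D') * (1 - \<rho>\<^sup>2 - (resid \<rho>)\<^sup>2)"
      by (simp add: inner_simps inner_commute power2_eq_square algebra_simps del: real_sqrt_mult_self)
    also have "\<dots> \<le> 0" using rho by (simp add: resid_sq[OF rho])
    finally have Q0: "(\<integral>u. Q0 u \<partial>gauss) \<le> 0" .
    have "(\<integral>p. gauss_copula \<rho> (W p) (Z p) \<partial>gauss)
       \<le> (\<integral>u. gauss_copula \<rho> m n + p * (W u - m) + q * (Z u - n) + \<kappa> / 2 * Q0 u + K0 * (h * sqrt h) * (R u) ^ 6 \<partial>gauss)"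
    proof (rule integral_mono)
      show "integrable gauss (\<lambda>p. gauss_copula \<rho> (W p) (Z p))"
      proof (rule integrable_gauss_bounded[of _ 1])
        show "(\<lambda>p. gauss_copula \<rho> (W p) (Z p)) \<in> borel_measurable borel"
          by (intro borel_measurable_gauss_copula[OF rho]) measurable
        show "\<bar>gauss_copula \<rho> (W p) (Z p)\<bar> \<le> 1" for p
          using gauss_copula_bounds[OF rho] by (simp add: abs_le_iff order_trans[of "- gauss_copula \<rho> (W p) (Z p)" 0])
      qed
      show "integrable gauss (\<lambda>u. gauss_copula \<rho> m n + p * (W u - m) + q * (Z u - n) + \<kappa> / 2 * Q0 u + K0 * (h * sqrt h) * (R u) ^ 6)"
        by (intro Bochner_Integration.integrable_add integrable_mult_right Bochner_Integration.integrable_diff iW iQ0 iR gauss.integrable_const)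
    qed (rule pw)
    also have "\<dots> = gauss_copula \<rho> m n + \<kappa> / 2 * (\<integral>u. Q0 u \<partial>gauss) + K0 * (h * sqrt h) * \<mu>"
      using iW iQ0 iR by (simp add: m_def[symmetric] n_def[symmetric] \<mu>_def)
    also have "\<dots> \<le> gauss_copula \<rho> m n + 0 + \<bar>K0 * \<mu>\<bar> * (h * sqrt h)"
    proof -
      have "K0 * \<mu> * (h * sqrt h) \<le> \<bar>K0 * \<mu>\<bar> * (h * sqrt h)" using h by (intro mult_right_mono) auto
      moreover have "\<kappa> / 2 * (\<integral>u. Q0 u \<partial>gauss) \<le> 0" using k Q0 by (simp add: mult_nonneg_nonpos)
      ultimately show ?thesis by (simp add: mult_ac)
    qed
    finally show "(\<integral>p. gauss_copula \<rho> (w (x + sqrt h *\<^sub>R fst p)) (z (y + sqrt h *\<^sub>R corr \<rho> p)) \<partial>gauss)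
      \<le> gauss_copula \<rho> (\<integral>p. w (x + sqrt h *\<^sub>R p) \<partial>gauss) (\<integral>p. z (y + sqrt h *\<^sub>R p) \<partial>gauss) + \<bar>K0 * \<mu>\<bar> * (h * sqrt h)"
      unfolding m_eq[symmetric] n_eq[symmetric] by (simp add: W_def Z_def)
  qed simp
qed

end

section \<open>Borell's inequality\<close>

lemma Phi_range_abs_le: "x \<in> {Phi (-M)..Phi M} \<Longrightarrow> \<bar>x\<bar> \<le> 1"
  using Phi_nonneg[of "-M"] Phi_le_1[of M] unfolding atLeastAtMost_iff abs_le_iff by linarith

text \<open>At each single t the points have the law of two correlated Brownian motions at time t.
  Only these one-time laws enter, so no process is constructed.\<close>

definition interp :: "real \<Rightarrow> ('a::euclidean_space \<Rightarrow> real) \<Rightarrow> ('a \<Rightarrow> real) \<Rightarrow> real \<Rightarrow> real" where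
  "interp \<rho> f g t = (\<integral>p. gauss_copula \<rho> (heat (1 - t) f (sqrt t *\<^sub>R fst p)) (heat (1 - t) g (sqrt t *\<^sub>R corr \<rho> p)) \<partial>gauss)"

context
  fixes \<rho> :: real and f g :: "'a::euclidean_space \<Rightarrow> real" and M :: real
  assumes rho: "0 \<le> \<rho>" "\<rho> < 1"
    and f [measurable]: "f \<in> borel_measurable borel" and fM: "\<And>x. f x \<in> {Phi (-M)..Phi M}"
    and g [measurable]: "g \<in> borel_measurable borel" and gM: "\<And>x. g x \<in> {Phi (-M)..Phi M}"
begin

lemma abs_fg_le: "\<bar>f x\<bar> \<le> 1" "\<bar>g x\<bar> \<le> 1"
  using Phi_range_abs_le fM gM by blast+

lemma abs_heat_fg_le: "\<bar>heat \<tau> f x\<bar> \<le> 1" "\<bar>heat \<tau> g x\<bar> \<le> 1"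
  using Phi_range_abs_le heat_bounds[OF f fM] heat_bounds[OF g gM] by blast+

lemma abs_gauss_copula_le: "\<bar>gauss_copula \<rho> x y\<bar> \<le> 1"
  using gauss_copula_bounds[OF rho] by (simp add: abs_le_iff order_trans[of "- gauss_copula \<rho> x y" 0])

lemma measurable_gauss_copula_heat:
  assumes [measurable]: "a \<in> borel_measurable borel" "b \<in> borel_measurable borel"
  shows "(\<lambda>p. gauss_copula \<rho> (heat s f (a p)) (heat s g (b p))) \<in> borel_measurable borel"
  by (intro borel_measurable_gauss_copula[OF rho]) measurable

text \<open>In law, sqrt(t + h) p is sqrt t q + sqrt h p with independent p and q. For fixed q the
  one-step inequality applies to the inner integral, and the means appearing in it are values of
  \<open>heat (1 - t)\<close> by the semigroup law.\<close>

lemma interp_step: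
  assumes "\<delta> > 0"
  obtains K where "K \<ge> 0" "\<And>t h. 0 \<le> t \<Longrightarrow> 0 < h \<Longrightarrow> h \<le> 1 \<Longrightarrow> t + h \<le> 1 - \<delta> \<Longrightarrow> interp \<rho> f g (t + h) \<le> interp \<rho> f g t + K * (h * sqrt h)"
proof -
  obtain K where K: "K \<ge> 0" and step: "\<And>(w::'a \<Rightarrow> real) z x y D D' h.
    w \<in> borel_measurable borel \<Longrightarrow> z \<in> borel_measurable borel \<Longrightarrow>
    (\<And>x. w x \<in> {Phi (-M)..Phi M}) \<Longrightarrow> (\<And>x. z x \<in> {Phi (-M)..Phi M}) \<Longrightarrow>
    (\<And>v. \<bar>w (x + v) - w x - D \<bullet> v\<bar> \<le> 3 / \<delta> * (norm v)\<^sup>2) \<Longrightarrow>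
    (\<And>v. \<bar>z (y + v) - z y - D' \<bullet> v\<bar> \<le> 3 / \<delta> * (norm v)\<^sup>2) \<Longrightarrow>
    0 < h \<Longrightarrow> h \<le> 1 \<Longrightarrow>
    (\<integral>p. gauss_copula \<rho> (w (x + sqrt h *\<^sub>R fst p)) (z (y + sqrt h *\<^sub>R corr \<rho> p)) \<partial>gauss)
      \<le> gauss_copula \<rho> (\<integral>p. w (x + sqrt h *\<^sub>R p) \<partial>gauss) (\<integral>p. z (y + sqrt h *\<^sub>R p) \<partial>gauss) + K * (h * sqrt h)"
    by (rule gauss_copula_step[OF rho, of M "3 / \<delta>", where 'a='a]) blast
  show ?thesis
  proof (rule that[OF K])
    fix t h :: real assume t: "0 \<le> t" and h: "0 < h" "h \<le> 1" and th: "t + h \<le> 1 - \<delta>"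
    \<comment> \<open>The smoothing left at the end of the step. It is at least \<delta>, which
      makes the Taylor constant 3 / \<delta> uniform in t and h.\<close>
    define \<tau> where "\<tau> = 1 - t - h"
    have \<tau>: "\<tau> \<ge> \<delta>" "\<tau> > 0" using th \<open>\<delta> > 0\<close> by (simp_all add: \<tau>_def)
    let ?G = "\<lambda>p. gauss_copula \<rho> (heat \<tau> f (fst p)) (heat \<tau> g (corr \<rho> p))"
    have G [measurable]: "?G \<in> borel_measurable borel" by (intro measurable_gauss_copula_heat) measurable
    have taylor: "\<exists>D. \<forall>v. \<bar>heat \<tau> k (x + v) - heat \<tau> k x - D \<bullet> v\<bar> \<le> 3 / \<delta> * (norm v)\<^sup>2"
      if k [measurable]: "k \<in> borel_measurable borel" "\<And>x. \<bar>k x\<bar> \<le> 1" for k :: "'a \<Rightarrow> real" and x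
    proof -
      obtain D where D: "\<And>v. \<bar>heat \<tau> k (x + v) - heat \<tau> k x - D \<bullet> v\<bar> \<le> 3 / \<tau> * (norm v)\<^sup>2"
        using heat_taylor[OF k \<tau>(2), of x] by blast
      have "3 / \<tau> * (norm v)\<^sup>2 \<le> 3 / \<delta> * (norm v)\<^sup>2" for v :: 'a
        using \<tau> \<open>\<delta> > 0\<close> by (intro mult_right_mono divide_left_mono) auto
      with D show ?thesis by (meson order_trans)
    qed
    have "interp \<rho> f g (t + h) = (\<integral>p. ?G (sqrt ((sqrt t)\<^sup>2 + (sqrt h)\<^sup>2) *\<^sub>R p) \<partial>gauss)"
      using t h by (simp add: interp_def \<tau>_def corr_linear diff_diff_eq)
    also have "\<dots> = (\<integral>q. \<integral>p. ?G (sqrt t *\<^sub>R q + sqrt h *\<^sub>R p) \<partial>gauss \<partial>gauss)"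
      using t abs_gauss_copula_le by (intro integral_gauss_conv[symmetric, of _ 1]) auto
    also have "\<dots> \<le> (\<integral>q. gauss_copula \<rho> (heat (1 - t) f (sqrt t *\<^sub>R fst q)) (heat (1 - t) g (sqrt t *\<^sub>R corr \<rho> q)) + K * (h * sqrt h) \<partial>gauss)"
    proof (rule integral_mono)
      show "integrable gauss (\<lambda>q. \<integral>p. ?G (sqrt t *\<^sub>R q + sqrt h *\<^sub>R p) \<partial>gauss)"
      proof (rule integrable_gauss_bounded[of _ 1])
        have "(\<lambda>q. heat h ?G (sqrt t *\<^sub>R q)) \<in> borel_measurable borel" by measurable
        then show "(\<lambda>q. \<integral>p. ?G (sqrt t *\<^sub>R q + sqrt h *\<^sub>R p) \<partial>gauss) \<in> borel_measurable borel"
          by (simp add: heat_def)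
        show "\<bar>\<integral>p. ?G (sqrt t *\<^sub>R q + sqrt h *\<^sub>R p) \<partial>gauss\<bar> \<le> 1" for q
          by (intro abs_integral_gauss_le abs_gauss_copula_le measurable_compose[OF _ G]) measurable
      qed
      show "integrable gauss (\<lambda>q. gauss_copula \<rho> (heat (1 - t) f (sqrt t *\<^sub>R fst q)) (heat (1 - t) g (sqrt t *\<^sub>R corr \<rho> q)) + K * (h * sqrt h))"
        by (intro Bochner_Integration.integrable_add gauss.integrable_const
            integrable_gauss_bounded[of _ 1] measurable_gauss_copula_heat abs_gauss_copula_le) measurable
      fix q :: "'a \<times> 'a"
      obtain D where D: "\<And>v. \<bar>heat \<tau> f (sqrt t *\<^sub>R fst q + v) - heat \<tau> f (sqrt t *\<^sub>R fst q) - D \<bullet> v\<bar> \<le> 3 / \<delta> * (norm v)\<^sup>2"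
        using taylor[OF f abs_fg_le(1)] by blast
      obtain D' where D': "\<And>v. \<bar>heat \<tau> g (sqrt t *\<^sub>R corr \<rho> q + v) - heat \<tau> g (sqrt t *\<^sub>R corr \<rho> q) - D' \<bullet> v\<bar> \<le> 3 / \<delta> * (norm v)\<^sup>2"
        using taylor[OF g abs_fg_le(2)] by blast
      have eq: "(\<integral>p. heat \<tau> k (x + sqrt h *\<^sub>R p) \<partial>gauss) = heat (1 - t) k x"
        if "k \<in> borel_measurable borel" "\<And>x. \<bar>k x\<bar> \<le> 1" for k :: "'a \<Rightarrow> real" and x
        using heat_heat[OF that, of h \<tau> x] h \<tau> by (simp add: heat_def \<tau>_def)
      have "(\<integral>p. gauss_copula \<rho> (heat \<tau> f (sqrt t *\<^sub>R fst q + sqrt h *\<^sub>R fst p)) (heat \<tau> g (sqrt t *\<^sub>R corr \<rho> q + sqrt h *\<^sub>R corr \<rho> p)) \<partial>gauss)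
        \<le> gauss_copula \<rho> (\<integral>p. heat \<tau> f (sqrt t *\<^sub>R fst q + sqrt h *\<^sub>R p) \<partial>gauss) (\<integral>p. heat \<tau> g (sqrt t *\<^sub>R corr \<rho> q + sqrt h *\<^sub>R p) \<partial>gauss) + K * (h * sqrt h)"
        by (rule step[OF _ _ heat_bounds[OF f fM] heat_bounds[OF g gM] D D' h]) measurable
      then show "(\<integral>p. ?G (sqrt t *\<^sub>R q + sqrt h *\<^sub>R p) \<partial>gauss)
        \<le> gauss_copula \<rho> (heat (1 - t) f (sqrt t *\<^sub>R fst q)) (heat (1 - t) g (sqrt t *\<^sub>R corr \<rho> q)) + K * (h * sqrt h)"
        unfolding eq[OF f abs_fg_le(1)] eq[OF g abs_fg_le(2)] by (simp add: corr_linear)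
    qed
    also have "\<dots> = interp \<rho> f g t + K * (h * sqrt h)"
    proof -
      have "integrable gauss (\<lambda>q. gauss_copula \<rho> (heat (1 - t) f (sqrt t *\<^sub>R fst q)) (heat (1 - t) g (sqrt t *\<^sub>R corr \<rho> q)))"
        by (intro integrable_gauss_bounded[of _ 1] measurable_gauss_copula_heat abs_gauss_copula_le) measurable
      then show ?thesis by (simp add: interp_def)
    qed
    finally show "interp \<rho> f g (t + h) \<le> interp \<rho> f g t + K * (h * sqrt h)" .
  qed
qed

text \<open>With N equal steps the accumulated error is N times K (T / N)^(3/2), which vanishes as N
  grows.\<close>

lemma interp_le_interp_0:
  assumes \<delta>: "0 < \<delta>" "\<delta> \<le> 1"
  shows "interp \<rho> f g (1 - \<delta>) \<le> interp \<rho> f g 0"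
proof (cases "\<delta> = 1")
  case False
  define T where "T = 1 - \<delta>"
  have T: "0 < T" "T < 1" using \<delta> False by (auto simp: T_def)
  obtain K where K: "K \<ge> 0" and step: "\<And>t h. 0 \<le> t \<Longrightarrow> 0 < h \<Longrightarrow> h \<le> 1 \<Longrightarrow> t + h \<le> 1 - \<delta> \<Longrightarrow> interp \<rho> f g (t + h) \<le> interp \<rho> f g t + K * (h * sqrt h)"
    using interp_step[OF \<delta>(1)] by blast
  have bound: "interp \<rho> f g T \<le> interp \<rho> f g 0 + K * T * sqrt (T / real N)" if "N > 0" for N :: nat
  proof -
    define h where "h = T / real N"
    have hN: "real N * h = T" using that by (simp add: h_def)
    have h: "0 < h" "h \<le> 1"
    proof -
      show "0 < h" using T that by (simp add: h_def)
      have "T \<le> real N" using T that by linarith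
      then show "h \<le> 1" using that by (simp add: h_def)
    qed
    have "interp \<rho> f g (real k * h) \<le> interp \<rho> f g 0 + real k * (K * (h * sqrt h))" if "k \<le> N" for k
      using that
    proof (induction k)
      case (Suc k)
      have "real (Suc k) * h \<le> real N * h" using Suc h by (intro mult_right_mono) auto
      then have "interp \<rho> f g (real k * h + h) \<le> interp \<rho> f g (real k * h) + K * (h * sqrt h)"
        using h hN by (intro step) (auto simp: T_def algebra_simps)
      then show ?case using Suc by (simp add: algebra_simps)
    qed simp
    from this[of N] have "interp \<rho> f g (real N * h) \<le> interp \<rho> f g 0 + K * (real N * h) * sqrt h" by (simp add: mult_ac)
    then show ?thesis unfolding hN by (simp add: h_def)
  qed
  have "(\<lambda>N. interp \<rho> f g 0 + K * T * sqrt (T / real N)) \<longlonglongrightarrow> interp \<rho> f g 0 + K * T * sqrt 0"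
    by (intro tendsto_intros lim_const_over_n)
  then have "interp \<rho> f g T \<le> interp \<rho> f g 0"
    using bound by (intro tendsto_lowerbound[of _ "interp \<rho> f g 0"]) (auto intro!: eventually_sequentiallyI[of 1])
  then show ?thesis by (simp add: T_def)
qed simp

lemma interp_0: "interp \<rho> f g 0 = gauss_copula \<rho> (\<integral>x. f x \<partial>gauss) (\<integral>x. g x \<partial>gauss)"
  by (simp add: interp_def heat_def)

text \<open>Bounding the copula below by the product leaves the mean of f and g at two noisy points.
  Each of these is standard Gaussian, as T + \<delta> = 1, and since the added noises are
  independent their correlation is \<rho> T. The proof makes this explicit by integrating out the
  noises one at a time.\<close>

lemma interp_ge:
  assumes \<delta>: "0 < \<delta>" "\<delta> \<le> 1"
  defines "T \<equiv> 1 - \<delta>"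
  shows "(\<integral>x. f x * heat (1 - (\<rho> * T)\<^sup>2) g ((\<rho> * T) *\<^sub>R x) \<partial>gauss) \<le> interp \<rho> f g T"
proof -
  define c where "c = sqrt T"
  define d where "d = sqrt \<delta>"
  define r where "r = resid \<rho>"
  have cd: "c\<^sup>2 = T" "d\<^sup>2 = \<delta>" "c \<ge> 0" "d > 0" using \<delta> by (auto simp: c_def d_def T_def)
  have r: "r > 0" "r\<^sup>2 = 1 - \<rho>\<^sup>2" using resid_pos[OF rho] resid_sq[OF rho] by (simp_all add: r_def)
  have T: "T \<ge> 0" using \<delta> by (simp add: T_def)
  have r2: "\<rho>\<^sup>2 \<le> 1" using rho by (simp add: power_le_one)
  \<comment> \<open>The function g averaged over everything independent of x: the part z of y
    contributes the variance \<open>T * r\<^sup>2\<close>, the smoothing of g contributes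
    \<delta>.\<close>
  define G where "G = heat (T * r\<^sup>2 + \<delta>) g"
  have Gm [measurable]: "G \<in> borel_measurable borel" by (simp add: G_def)
  have G1: "\<bar>G x\<bar> \<le> 1" for x unfolding G_def by (rule abs_heat_fg_le)
  have e1: "(\<integral>z. heat \<delta> g (c *\<^sub>R (\<rho> *\<^sub>R x + r *\<^sub>R z)) \<partial>gauss) = G ((c * \<rho>) *\<^sub>R x)" for x
  proof -
    have "(\<integral>z. heat \<delta> g (c *\<^sub>R (\<rho> *\<^sub>R x + r *\<^sub>R z)) \<partial>gauss) = heat (T * r\<^sup>2) (heat \<delta> g) ((c * \<rho>) *\<^sub>R x)"
      unfolding heat_def[of "T * r\<^sup>2"] using r by (simp add: algebra_simps real_sqrt_mult c_def)
    also have "\<dots> = G ((c * \<rho>) *\<^sub>R x)"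
      unfolding G_def using \<delta> T by (intro heat_heat[OF g abs_fg_le(2)]) auto
    finally show ?thesis .
  qed
  have e2: "(\<integral>v. G ((c * \<rho>) *\<^sub>R (c *\<^sub>R u - d *\<^sub>R v)) \<partial>gauss) = heat (1 - (\<rho> * T)\<^sup>2) g ((\<rho> * T) *\<^sub>R u)" for u
  proof -
    have "(\<integral>v. G ((c * \<rho>) *\<^sub>R (c *\<^sub>R u - d *\<^sub>R v)) \<partial>gauss) = (\<integral>v. G ((\<rho> * T) *\<^sub>R u + (c * \<rho> * d) *\<^sub>R v) \<partial>gauss)"
      by (subst integral_gauss_uminus[symmetric]) (auto simp: algebra_simps power2_eq_square simp flip: cd(1))
    also have "c * \<rho> * d = sqrt (T * \<rho>\<^sup>2 * \<delta>)"
      using rho by (simp add: real_sqrt_mult c_def d_def)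
    also have "(\<integral>v. G ((\<rho> * T) *\<^sub>R u + sqrt (T * \<rho>\<^sup>2 * \<delta>) *\<^sub>R v) \<partial>gauss) = heat (T * \<rho>\<^sup>2 * \<delta>) G ((\<rho> * T) *\<^sub>R u)"
      by (simp add: heat_def)
    also have "\<dots> = heat (T * \<rho>\<^sup>2 * \<delta> + (T * r\<^sup>2 + \<delta>)) g ((\<rho> * T) *\<^sub>R u)"
      unfolding G_def using \<delta> T by (intro heat_heat[OF g abs_fg_le(2)]) auto
    also have "T * \<rho>\<^sup>2 * \<delta> + (T * r\<^sup>2 + \<delta>) = 1 - (\<rho> * T)\<^sup>2"
      unfolding r by (simp add: T_def power2_eq_square algebra_simps)
    finally show ?thesis .
  qed
  have bm: "\<bar>a * b\<bar> \<le> 1" if "\<bar>a\<bar> \<le> 1" "\<bar>b\<bar> \<le> 1" for a b :: real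
    using that by (simp add: abs_mult mult_le_one)
  let ?R = "\<lambda>z::'a\<times>'a. (c *\<^sub>R fst z + d *\<^sub>R snd z, c *\<^sub>R snd z - d *\<^sub>R fst z)"
  have [measurable]: "?R \<in> borel_measurable borel"
    by (intro borel_measurable_continuous_onI continuous_intros)
  let ?F = "\<lambda>p::'a\<times>'a. f (fst p) * G ((c * \<rho>) *\<^sub>R (c *\<^sub>R fst p - d *\<^sub>R snd p))"
  have "(\<integral>x. f x * heat (1 - (\<rho> * T)\<^sup>2) g ((\<rho> * T) *\<^sub>R x) \<partial>gauss) = (\<integral>p. ?F p \<partial>gauss)"
    using abs_fg_le G1 by (subst integral_gauss_pair) (auto intro!: integrable_gauss_bounded[of _ 1] bm simp: e2)
  \<comment> \<open>The rotation with cosine sqrt T and sine sqrt \<delta> makes the noisy argument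
    of f the first block, and x is recovered from the two new blocks. Integrating out the second one
    adds the variance \<open>T * \<rho>\<^sup>2 * \<delta>\<close>, for a total of 1 - (\<rho>
    T)^2.\<close>
  also have "\<dots> = (\<integral>p. ?F p \<partial>distr gauss borel ?R)"
    using cd by (subst distr_gauss_rot) (auto simp: T_def)
  also have "\<dots> = (\<integral>p. ?F (?R p) \<partial>gauss)"
    by (subst integral_distr) auto
  also have "\<dots> = (\<integral>p. f (c *\<^sub>R fst p + d *\<^sub>R snd p) * G ((c * \<rho>) *\<^sub>R fst p) \<partial>gauss)"
  proof (intro Bochner_Integration.integral_cong refl)
    fix p :: "'a \<times> 'a"
    have "c *\<^sub>R (c *\<^sub>R fst p + d *\<^sub>R snd p) - d *\<^sub>R (c *\<^sub>R snd p - d *\<^sub>R fst p) = (c\<^sup>2 + d\<^sup>2) *\<^sub>R fst p"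
      by (simp add: algebra_simps power2_eq_square)
    also have "\<dots> = fst p" by (simp add: cd T_def)
    finally show "?F (?R p) = f (c *\<^sub>R fst p + d *\<^sub>R snd p) * G ((c * \<rho>) *\<^sub>R fst p)" by simp
  qed
  also have "\<dots> = (\<integral>x. heat \<delta> f (c *\<^sub>R x) * G ((c * \<rho>) *\<^sub>R x) \<partial>gauss)"
    using abs_fg_le G1 by (subst integral_gauss_pair) (auto intro!: integrable_gauss_bounded[of _ 1] bm simp: heat_def d_def)
  also have "\<dots> = (\<integral>x. \<integral>z. heat \<delta> f (c *\<^sub>R x) * heat \<delta> g (c *\<^sub>R (\<rho> *\<^sub>R x + r *\<^sub>R z)) \<partial>gauss \<partial>gauss)"
    by (simp only: integral_mult_right_zero e1)
  also have "\<dots> = (\<integral>p. heat \<delta> f (c *\<^sub>R fst p) * heat \<delta> g (c *\<^sub>R corr \<rho> p) \<partial>gauss)"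
    using abs_heat_fg_le
    by (subst integral_gauss_pair) (auto intro!: integrable_gauss_bounded[of _ 1] bm simp: corr_def r_def)
  also have "\<dots> \<le> (\<integral>p. gauss_copula \<rho> (heat \<delta> f (c *\<^sub>R fst p)) (heat \<delta> g (c *\<^sub>R corr \<rho> p)) \<partial>gauss)"
  proof (rule integral_mono)
    show "integrable gauss (\<lambda>p. heat \<delta> f (c *\<^sub>R fst p) * heat \<delta> g (c *\<^sub>R corr \<rho> p))"
      using abs_heat_fg_le by (auto intro!: integrable_gauss_bounded[of _ 1] bm)
    show "integrable gauss (\<lambda>p. gauss_copula \<rho> (heat \<delta> f (c *\<^sub>R fst p)) (heat \<delta> g (c *\<^sub>R corr \<rho> p)))"
      by (intro integrable_gauss_bounded[of _ 1] measurable_gauss_copula_heat abs_gauss_copula_le) measurable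
    have in01: "heat \<delta> f x \<in> {0<..<1}" "heat \<delta> g x \<in> {0<..<1}" for x
      using heat_bounds[OF f fM, of \<delta> x] heat_bounds[OF g gM, of \<delta> x] Phi_pos[of "-M"] Phi_less_1[of M]
      by auto
    show "heat \<delta> f (c *\<^sub>R fst p) * heat \<delta> g (c *\<^sub>R corr \<rho> p) \<le> gauss_copula \<rho> (heat \<delta> f (c *\<^sub>R fst p)) (heat \<delta> g (c *\<^sub>R corr \<rho> p))" for p
      by (rule gauss_copula_ge_mult[OF rho in01])
  qed
  also have "\<dots> = interp \<rho> f g T" by (simp add: interp_def c_def T_def)
  finally show ?thesis .
qed

lemma borell_truncated:
  assumes "0 \<le> T" "T < 1"
  shows "(\<integral>x. f x * heat (1 - (\<rho> * T)\<^sup>2) g ((\<rho> * T) *\<^sub>R x) \<partial>gauss) \<le> gauss_copula \<rho> (\<integral>x. f x \<partial>gauss) (\<integral>x. g x \<partial>gauss)"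
  using interp_ge[of "1 - T"] interp_le_interp_0[of "1 - T"] assms by (simp add: interp_0)

end

text \<open>The values of f and g are squeezed into a truncated range by an affine map within
  \<epsilon> of the identity. Both sides move by at most 2 \<epsilon>, the right one by the
  Lipschitz bound of the copula, which is available because both means lie strictly between 0 and
  1.\<close>

lemma borell_interior:
  fixes f g :: "'a::euclidean_space \<Rightarrow> real"
  assumes rho: "0 \<le> \<rho>" "\<rho> < 1"
    and f [measurable]: "f \<in> borel_measurable borel" and f01: "\<And>x. f x \<in> {0..1}"
    and g [measurable]: "g \<in> borel_measurable borel" and g01: "\<And>x. g x \<in> {0..1}"
    and T: "0 \<le> T" "T < 1"
    and mn: "(\<integral>x. f x \<partial>gauss) \<in> {0<..<1}" "(\<integral>x. g x \<partial>gauss) \<in> {0<..<1}"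
  shows "(\<integral>x. f x * heat (1 - (\<rho> * T)\<^sup>2) g ((\<rho> * T) *\<^sub>R x) \<partial>gauss) \<le> gauss_copula \<rho> (\<integral>x. f x \<partial>gauss) (\<integral>x. g x \<partial>gauss)"
proof (rule field_le_epsilon)
  fix e :: real assume "e > 0"
  then have "eventually (\<lambda>s. Phi s < min (e / 4) (1/2)) at_bot"
    using Phi_at_bot by (intro order_tendstoD) auto
  then obtain s where s: "Phi s < e / 4" "Phi s < 1/2"
    by (auto simp: eventually_at_bot_linorder)
  define M where "M = - s"
  define \<epsilon> where "\<epsilon> = Phi (- M)"
  have eps: "\<epsilon> < e / 4" "\<epsilon> < 1/2" "0 < \<epsilon>" "Phi M = 1 - \<epsilon>"
    using s Phi_pos Phi_less_1 Phi_minus[of M] by (auto simp: \<epsilon>_def M_def)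
  \<comment> \<open>This maps the unit interval onto the one from \<epsilon> to 1 - \<epsilon>,
    whose ends are \<open>Phi (-M)\<close> and \<open>Phi M\<close>. Being affine, it commutes with
    integration, hence with means and with the semigroup.\<close>
  define tr where "tr y = \<epsilon> + (1 - 2 * \<epsilon>) * y" for y :: real
  have tr: "tr y \<in> {Phi (-M)..Phi M}" "\<bar>tr y - y\<bar> \<le> \<epsilon>" if "y \<in> {0..1}" for y
  proof -
    have "(1 - 2 * \<epsilon>) * y \<le> (1 - 2 * \<epsilon>) * 1" "0 \<le> (1 - 2 * \<epsilon>) * y"
      using that eps by (auto intro!: mult_left_mono mult_nonneg_nonneg)
    then show "tr y \<in> {Phi (-M)..Phi M}"
      using eps(4) by (auto simp: tr_def \<epsilon>_def)
    have "tr y - y = \<epsilon> * (1 - 2 * y)" by (simp add: tr_def algebra_simps)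
    then show "\<bar>tr y - y\<bar> \<le> \<epsilon>" using that eps by (simp add: abs_mult abs_le_iff mult_left_le)
  qed
  have trm [measurable]: "(\<lambda>x. tr (k x)) \<in> borel_measurable borel" if [measurable]: "k \<in> borel_measurable borel" for k :: "'a \<Rightarrow> real"
    unfolding tr_def by measurable
  have ik: "integrable gauss k" if "k \<in> borel_measurable borel" "\<And>x. k x \<in> {0..1}" for k :: "'a \<Rightarrow> real"
    using that by (intro integrable_gauss_bounded[of _ 1]) (auto simp: abs_le_iff intro: order_trans[of _ 0])
  have trint: "(\<integral>x. tr (k x) \<partial>gauss) = tr (\<integral>x. k x \<partial>gauss)" if "k \<in> borel_measurable borel" "\<And>x. k x \<in> {0..1}" for k :: "'a \<Rightarrow> real"
    using ik[OF that] by (simp add: tr_def)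
  let ?U = "\<lambda>k x. heat (1 - (\<rho> * T)\<^sup>2) k ((\<rho> * T) *\<^sub>R x)"
  have Utr: "?U (\<lambda>x. tr (g x)) x = tr (?U g x)" for x
    unfolding heat_def by (rule trint) (use g01 in auto)
  have U01: "?U g x \<in> {0..1}" for x using g g01 by (rule heat_bounds)
  have close: "\<bar>a * b - tr a * tr b\<bar> \<le> 2 * \<epsilon>" if "a \<in> {0..1}" "b \<in> {0..1}" for a b
  proof -
    have tb: "\<bar>tr b\<bar> \<le> 1" using tr(1)[OF that(2)] by (rule Phi_range_abs_le)
    have "\<bar>a * b - tr a * tr b\<bar> = \<bar>a * (b - tr b) + (a - tr a) * tr b\<bar>" by (simp add: algebra_simps)
    also have "\<dots> \<le> \<bar>a\<bar> * \<bar>b - tr b\<bar> + \<bar>a - tr a\<bar> * \<bar>tr b\<bar>"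
      unfolding abs_mult[symmetric] by (rule abs_triangle_ineq)
    also have "\<dots> \<le> 1 * \<epsilon> + \<epsilon> * 1"
      using that tr(2)[of a] tr(2)[of b] tb eps by (intro add_mono mult_mono) (auto simp: abs_minus_commute)
    finally show ?thesis by simp
  qed
  have i1: "integrable gauss (\<lambda>x. f x * ?U g x)"
  proof (rule ik)
    show "f x * ?U g x \<in> {0..1}" for x using f01[of x] U01[of x] by (auto intro: mult_le_one)
  qed measurable
  have i2: "integrable gauss (\<lambda>x. tr (f x) * tr (?U g x))"
  proof (rule integrable_gauss_bounded[of _ 1])
    show "\<bar>tr (f x) * tr (?U g x)\<bar> \<le> 1" for x
      using Phi_range_abs_le[OF tr(1)[OF f01[of x]]] Phi_range_abs_le[OF tr(1)[OF U01[of x]]]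
      by (simp add: abs_mult mult_le_one)
  qed (unfold tr_def, measurable)
  have "(\<integral>x. f x * ?U g x \<partial>gauss) \<le> (\<integral>x. tr (f x) * tr (?U g x) + 2 * \<epsilon> \<partial>gauss)"
  proof (rule integral_mono[OF i1])
    show "integrable gauss (\<lambda>x. tr (f x) * tr (?U g x) + 2 * \<epsilon>)"
      by (intro Bochner_Integration.integrable_add i2 gauss.integrable_const)
    show "f x * ?U g x \<le> tr (f x) * tr (?U g x) + 2 * \<epsilon>" for x
      using close[OF f01[of x] U01[of x]] by linarith
  qed
  also have "\<dots> = (\<integral>x. tr (f x) * ?U (\<lambda>x. tr (g x)) x \<partial>gauss) + 2 * \<epsilon>"
    unfolding Utr using i2 by simp
  also have "(\<integral>x. tr (f x) * ?U (\<lambda>x. tr (g x)) x \<partial>gauss) \<le> gauss_copula \<rho> (\<integral>x. tr (f x) \<partial>gauss) (\<integral>x. tr (g x) \<partial>gauss)"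
    by (rule borell_truncated[OF rho, of _ M]) (use tr f01 g01 T in auto)
  also have "\<dots> = gauss_copula \<rho> (tr (\<integral>x. f x \<partial>gauss)) (tr (\<integral>x. g x \<partial>gauss))"
    using trint[OF f f01] trint[OF g g01] by simp
  also have "\<dots> \<le> gauss_copula \<rho> (\<integral>x. f x \<partial>gauss) (\<integral>x. g x \<partial>gauss) + 2 * \<epsilon>"
  proof -
    have t01: "tr y \<in> {0<..<1}" if "y \<in> {0<..<1}" for y
    proof -
      have "y \<in> {0..1}" using that by simp
      from tr(1)[OF this] show ?thesis using eps by (auto simp: \<epsilon>_def)
    qed
    have "\<bar>gauss_copula \<rho> (tr (\<integral>x. f x \<partial>gauss)) (tr (\<integral>x. g x \<partial>gauss)) - gauss_copula \<rho> (\<integral>x. f x \<partial>gauss) (\<integral>x. g x \<partial>gauss)\<bar>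
      \<le> \<bar>tr (\<integral>x. f x \<partial>gauss) - (\<integral>x. f x \<partial>gauss)\<bar> + \<bar>tr (\<integral>x. g x \<partial>gauss) - (\<integral>x. g x \<partial>gauss)\<bar>"
      by (rule gauss_copula_lipschitz[OF rho]) (use mn t01 in auto)
    also have "\<dots> \<le> \<epsilon> + \<epsilon>" using mn by (intro add_mono tr) auto
    finally show ?thesis by linarith
  qed
  finally show "(\<integral>x. f x * ?U g x \<partial>gauss) \<le> gauss_copula \<rho> (\<integral>x. f x \<partial>gauss) (\<integral>x. g x \<partial>gauss) + e"
    using eps by linarith
qed

lemma tendsto_bvn_cdf:
  assumes "0 \<le> \<rho>" "\<rho> < 1" "R \<longlonglongrightarrow> \<rho>"
  shows "(\<lambda>k. bvn_cdf (R k) s t) \<longlonglongrightarrow> bvn_cdf \<rho> s t"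
  unfolding bvn_cdf_def resid_def
proof (rule integral_dominated_convergence[where w="\<lambda>_. 1"])
  have r: "sqrt (1 - \<rho>\<^sup>2) \<noteq> 0" using assms by (simp add: abs_square_eq_1)
  show "AE a in gauss1. (\<lambda>k. indicator {..s} a * Phi ((t - R k * a) / sqrt (1 - (R k)\<^sup>2))) \<longlonglongrightarrow> indicator {..s} a * Phi ((t - \<rho> * a) / sqrt (1 - \<rho>\<^sup>2))"
    using r by (intro AE_I2 tendsto_intros isCont_tendsto_compose[OF isCont_Phi] assms(3)) auto
qed (auto simp: indicator_def)

text \<open>The previous bound with copula parameter R > \<rho> and stopping time \<rho> / R has
  correlation exactly \<rho> on the left, and the right side is continuous in R.\<close>

theorem borell:
  fixes f g :: "'a::euclidean_space \<Rightarrow> real"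
  assumes rho: "0 \<le> \<rho>" "\<rho> < 1"
    and f: "f \<in> borel_measurable borel" "\<And>x. f x \<in> {0..1}"
    and g: "g \<in> borel_measurable borel" "\<And>x. g x \<in> {0..1}"
    and st: "(\<integral>x. f x \<partial>gauss) = Phi s" "(\<integral>x. g x \<partial>gauss) = Phi t"
  shows "(\<integral>x. f x * heat (1 - \<rho>\<^sup>2) g (\<rho> *\<^sub>R x) \<partial>gauss) \<le> bvn_cdf \<rho> s t"
proof -
  \<comment> \<open>The two successors keep the reciprocal strictly below 1, so that already the
    first R is less than 1.\<close>
  define R where "R k = \<rho> + (1 - \<rho>) * inverse (real (Suc (Suc k)))" for k
  have R: "R \<longlonglongrightarrow> \<rho>"
  proof -
    have "(\<lambda>k. inverse (real (Suc (Suc k)))) \<longlonglongrightarrow> 0"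
      using LIMSEQ_Suc[OF LIMSEQ_inverse_real_of_nat] .
    then have "R \<longlonglongrightarrow> \<rho> + (1 - \<rho>) * 0" unfolding R_def by (intro tendsto_intros)
    then show ?thesis by simp
  qed
  have bnd: "(\<integral>x. f x * heat (1 - \<rho>\<^sup>2) g (\<rho> *\<^sub>R x) \<partial>gauss) \<le> bvn_cdf (R k) s t" for k
  proof -
    have i: "0 < inverse (real (Suc (Suc k)))" "inverse (real (Suc (Suc k))) < 1"
      by (auto simp: inverse_less_1_iff)
    have R1: "\<rho> < R k" "R k < 1"
    proof -
      show "\<rho> < R k" using rho i(1) by (simp add: R_def del: of_nat_Suc)
      have "(1 - \<rho>) * inverse (real (Suc (Suc k))) < (1 - \<rho>) * 1"
        using rho i(2) by (intro mult_strict_left_mono) auto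
      then show "R k < 1" by (simp add: R_def del: of_nat_Suc)
    qed
    have RT: "R k * (\<rho> / R k) = \<rho>" using rho R1 by simp
    have "(\<integral>x. f x * heat (1 - (R k * (\<rho> / R k))\<^sup>2) g ((R k * (\<rho> / R k)) *\<^sub>R x) \<partial>gauss)
      \<le> gauss_copula (R k) (\<integral>x. f x \<partial>gauss) (\<integral>x. g x \<partial>gauss)"
      using rho R1 f g by (intro borell_interior) (auto simp: st Phi_pos Phi_less_1)
    then show ?thesis
      unfolding RT st using rho R1 by (simp add: gauss_copula_def)
  qed
  show ?thesis
    by (rule LIMSEQ_le_const[OF tendsto_bvn_cdf[OF rho R]]) (use bnd in auto)
qed

section \<open>From the hinge functions to the entropy\<close>

lemma integral_gauss_inner_fun:
  fixes e :: "'a::euclidean_space" and k :: "real \<Rightarrow> real"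
  assumes "norm e = 1" and [measurable]: "k \<in> borel_measurable borel"
  shows "(\<integral>x. k (e \<bullet> x) \<partial>gauss) = (\<integral>a. k a \<partial>gauss1)"
proof -
  have "(\<integral>x. k (e \<bullet> x) \<partial>gauss) = (\<integral>a. k a \<partial>distr gauss borel (\<lambda>x. e \<bullet> x))"
    by (subst integral_distr) auto
  then show ?thesis by (simp only: distr_gauss_inner[OF assms(1)])
qed

text \<open>With g the indicator of the set where u exceeds c, the hinge function of u equals g (u -
  c), so its integral is a correlation of g and f minus c times the measure of that set. The right
  side is one-dimensional because the noisy indicator of a halfspace depends on a single
  direction.\<close>

lemma hinge_le_halfspace:
  fixes f :: "'a::euclidean_space \<Rightarrow> real"
  assumes rho: "0 \<le> \<rho>" "\<rho> < 1"
    and f [measurable]: "f \<in> borel_measurable borel" and f01: "\<And>x. f x \<in> {0..1}"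
    and m: "(\<integral>x. f x \<partial>gauss) = Phi s"
  shows "(\<integral>x. max 0 (heat (1 - \<rho>\<^sup>2) f (\<rho> *\<^sub>R x) - c) \<partial>gauss)
    \<le> (\<integral>a. max 0 (Phi ((s - \<rho> * a) / sqrt (1 - \<rho>\<^sup>2)) - c) \<partial>gauss1)" (is "_ \<le> ?rhs")
proof -
  define u where "u x = heat (1 - \<rho>\<^sup>2) f (\<rho> *\<^sub>R x)" for x
  define v where "v a = Phi ((s - \<rho> * a) / sqrt (1 - \<rho>\<^sup>2))" for a
  define g where "g = (indicator {x. u x > c} :: 'a \<Rightarrow> real)"
  have [measurable]: "u \<in> borel_measurable borel" unfolding u_def[abs_def] by measurable
  have [measurable]: "v \<in> borel_measurable borel" unfolding v_def[abs_def] by measurable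
  have g [measurable]: "g \<in> borel_measurable borel" unfolding g_def by measurable
  have g01: "g x \<in> {0..1}" for x by (simp add: g_def indicator_def)
  have u01: "u x \<in> {0..1}" for x unfolding u_def by (rule heat_bounds[OF f f01])
  have v01: "v a \<in> {0..1}" for a by (simp add: v_def)
  have max_eq: "max 0 (u x - c) = g x * (u x - c)" for x by (auto simp: g_def indicator_def)
  have ig: "integrable gauss g" using g01 by (intro integrable_gauss_bounded[of _ 1]) auto
  have iu: "integrable gauss u" using u01 by (intro integrable_gauss_bounded[of _ 1]) auto
  have iv: "integrable gauss1 v" using v01 by (intro integrable_gauss_bounded[of _ 1]) auto
  have igu: "integrable gauss (\<lambda>x. g x * u x)"
  proof (rule integrable_gauss_bounded[of _ 1])
    show "\<bar>g x * u x\<bar> \<le> 1" for x using g01[of x] u01[of x] by (simp add: abs_mult mult_le_one)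
  qed measurable
  have imv: "integrable gauss1 (\<lambda>a. max 0 (v a - c))"
  proof (rule integrable_gauss_bounded[of _ "1 + \<bar>c\<bar>"])
    show "\<bar>max 0 (v a - c)\<bar> \<le> 1 + \<bar>c\<bar>" for a using v01[of a] by (auto simp: max_def)
  qed measurable
  have rhs: "?rhs = (\<integral>a. max 0 (v a - c) \<partial>gauss1)" by (simp add: v_def)
  have rhs0: "0 \<le> ?rhs" by (intro integral_nonneg_AE AE_I2) simp
  define n where "n = (\<integral>x. g x \<partial>gauss)"
  have n: "0 \<le> n" "n \<le> 1"
    using g01 ig unfolding n_def by (auto intro!: gauss.integral_ge_const gauss.integral_le_const)
  have lhs: "(\<integral>x. max 0 (u x - c) \<partial>gauss) = (\<integral>x. g x * u x \<partial>gauss) - c * n"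
    unfolding max_eq right_diff_distrib using igu ig by (simp add: n_def mult.commute)
  \<comment> \<open>Measures 0 and 1 have no finite quantile. In the first case the hinge integral
    vanishes; in the second it is at most the mean of u - c, and u has the same mean as v.\<close>
  consider "n = 0" | "n = 1" | "0 < n" "n < 1" using n by linarith
  then have "(\<integral>x. max 0 (u x - c) \<partial>gauss) \<le> ?rhs"
  proof cases
    case 1
    have "(\<integral>x. g x * u x \<partial>gauss) \<le> (\<integral>x. g x \<partial>gauss)"
      using igu ig g01 u01 by (intro integral_mono) (auto intro: mult_left_le)
    then have "(\<integral>x. g x * u x \<partial>gauss) \<le> 0" using 1 by (simp add: n_def)
    moreover have "(\<integral>x. max 0 (u x - c) \<partial>gauss) = (\<integral>x. g x * u x \<partial>gauss)" using lhs 1 by simp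
    ultimately show ?thesis using rhs0 by linarith
  next
    case 2
    have "(\<integral>x. g x * u x \<partial>gauss) \<le> (\<integral>x. u x \<partial>gauss)"
      using igu iu g01 u01 by (intro integral_mono) (auto intro: mult_left_le_one_le)
    also have "\<dots> = Phi s"
    proof -
      have "(\<integral>x. u x \<partial>gauss) = (\<integral>z. f (sqrt (\<rho>\<^sup>2 + (sqrt (1 - \<rho>\<^sup>2))\<^sup>2) *\<^sub>R z) \<partial>gauss)"
        unfolding u_def heat_def using f01 rho by (intro integral_gauss_conv[of _ 1]) (auto simp: abs_le_iff intro: order_trans[of _ 0])
      then show ?thesis using rho by (simp add: m power_le_one)
    qed
    also have "\<dots> = (\<integral>a. v a \<partial>gauss1)"
      using integral_Phi_affine[OF rho, of s] by (simp add: v_def resid_def)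
    finally have "(\<integral>x. max 0 (u x - c) \<partial>gauss) \<le> (\<integral>a. v a - c \<partial>gauss1)"
      using lhs 2 iv by simp
    also have "\<dots> \<le> ?rhs" unfolding rhs using iv imv by (intro integral_mono) auto
    finally show ?thesis .
  next
    case 3
    then obtain t where t: "n = Phi t" using Phi_surj by blast
    have ii: "integrable gauss1 (\<lambda>a. indicator {..t} a * v a)" "integrable gauss1 (\<lambda>a. indicator {..t} a * c)"
      using v01 by (auto intro!: integrable_gauss_bounded[of _ "1 + \<bar>c\<bar>"] simp: indicator_def add_increasing2)
    \<comment> \<open>The level set takes the first place and f the second, so that the semigroup
      acts on f. The half-line up to t is fixed by its measure alone; \<open>max 0 (v a - c)\<close>
      dominates the resulting integrand whatever t is.\<close>
    have "(\<integral>x. g x * u x \<partial>gauss) \<le> bvn_cdf \<rho> t s"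
      unfolding u_def using borell[OF rho g g01 f f01 _ m, of t] t by (simp add: n_def)
    also have "\<dots> = (\<integral>a. indicator {..t} a * v a \<partial>gauss1)" by (simp add: bvn_cdf_def v_def resid_def)
    finally have "(\<integral>x. max 0 (u x - c) \<partial>gauss) \<le> (\<integral>a. indicator {..t} a * v a - indicator {..t} a * c \<partial>gauss1)"
      using ii lhs t by (simp add: Phi_def)
    also have "\<dots> \<le> ?rhs" unfolding rhs using ii imv
      by (intro integral_mono Bochner_Integration.integrable_diff) (auto simp: indicator_def)
    finally show ?thesis .
  qed
  then show ?thesis by (simp add: u_def)
qed

section \<open>Binary entropy as a mixture of hinge functions\<close>

lemma bin_entropy_eq:
  assumes "0 < v" "v < 1"
  shows "ln 2 * bin_entropy v = - v * ln v - (1 - v) * ln (1 - v)"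
  using assms by (simp add: bin_entropy_def log_def ln_div field_simps)

text \<open>The inequality -x ln x <= 1 - x, used for v and for 1 - v, gives bounds that add up to
  1. Boundedness makes the entropy integrable.\<close>

lemma bin_entropy_bounds:
  assumes "v \<in> {0..1}"
  shows "0 \<le> ln 2 * bin_entropy v" "ln 2 * bin_entropy v \<le> 1"
proof -
  have "0 \<le> ln 2 * bin_entropy v \<and> ln 2 * bin_entropy v \<le> 1"
  proof (cases "v = 0 \<or> v = 1")
    case False
    with assms have v: "0 < v" "v < 1" by auto
    have l: "x * ln x \<le> 0 \<and> x - 1 \<le> x * ln x" if "0 < x" "x < 1" for x :: real
    proof -
      have "ln (1 / x) \<le> 1 / x - 1" using that by (intro ln_le_minus_one) auto
      then have "- ln x \<le> 1 / x - 1" using that by (simp add: ln_div)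
      then have "x * - ln x \<le> x * (1 / x - 1)" using that by (intro mult_left_mono) auto
      moreover have "x * ln x \<le> 0" using that by (simp add: mult_nonneg_nonpos)
      ultimately show ?thesis using that by (simp add: right_diff_distrib)
    qed
    have "v * ln v \<le> 0" "v - 1 \<le> v * ln v" "(1 - v) * ln (1 - v) \<le> 0" "- v \<le> (1 - v) * ln (1 - v)"
      using l[of v] l[of "1 - v"] v by simp_all
    moreover have "ln 2 * bin_entropy v = - (v * ln v) - (1 - v) * ln (1 - v)"
      by (simp add: bin_entropy_eq[OF v])
    ultimately show ?thesis by linarith
  qed (auto simp: bin_entropy_def)
  then show "0 \<le> ln 2 * bin_entropy v" "ln 2 * bin_entropy v \<le> 1" by auto
qed

lemma borel_measurable_bin_entropy [measurable]: "bin_entropy \<in> borel_measurable borel"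
  unfolding bin_entropy_def[abs_def] by measurable

text \<open>In natural units the second derivative of the entropy is -1 / (c (1 - c)), and the
  entropy vanishes at 0 and 1, so it is recovered from its second derivative. The integrand is
  nonnegative, which later allows Fubini without integrability conditions.\<close>

lemma nn_integral_entropy_kernel:
  assumes v01: "v \<in> {0..1}"
  shows "(\<integral>\<^sup>+c. ennreal ((min v c - v * c) / (c * (1 - c))) * indicator {0<..<1} c \<partial>lborel) = ennreal (ln 2 * bin_entropy v)"
proof (cases "v = 0 \<or> v = 1")
  case True
  then have "(min v c - v * c) / (c * (1 - c)) = 0" if "c \<in> {0<..<1}" for c :: real using that by auto
  then have "(\<integral>\<^sup>+c. ennreal ((min v c - v * c) / (c * (1 - c))) * indicator {0<..<1} c \<partial>lborel) = (\<integral>\<^sup>+c. 0 \<partial>(lborel::real measure))"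
    by (intro nn_integral_cong) (auto simp: indicator_def)
  then show ?thesis using True by (auto simp: bin_entropy_def)
next
  case False
  with v01 have v: "0 < v" "v < 1" by auto
  \<comment> \<open>On either side of v one factor of the denominator cancels, and both pieces have
    logarithmic antiderivatives. The points 0, 1 and v are excluded as a null set.\<close>
  have "AE c in lborel. ennreal ((min v c - v * c) / (c * (1 - c))) * indicator {0<..<1} c
     = ennreal ((1 - v) / (1 - c)) * indicator {0..v} c + ennreal (v / c) * indicator {v..1} c"
    using AE_lborel_singleton[of 0] AE_lborel_singleton[of 1] AE_lborel_singleton[of v]
  proof eventually_elim
    case (elim c)
    consider "c < 0 \<or> c > 1" | "0 < c" "c < v" | "v < c" "c < 1" using elim by linarith
    then show ?case
    proof cases
      case 2
      then have "(min v c - v * c) / (c * (1 - c)) = (1 - v) / (1 - c)" using v by (simp add: min_def field_simps)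
      then show ?thesis using 2 v by simp
    next
      case 3
      then have "(min v c - v * c) / (c * (1 - c)) = v / c" using v by (simp add: min_def field_simps)
      then show ?thesis using 3 v by simp
    qed (use v in auto)
  qed
  then have "(\<integral>\<^sup>+c. ennreal ((min v c - v * c) / (c * (1 - c))) * indicator {0<..<1} c \<partial>lborel)
     = (\<integral>\<^sup>+c. ennreal ((1 - v) / (1 - c)) * indicator {0..v} c + ennreal (v / c) * indicator {v..1} c \<partial>lborel)"
    by (rule nn_integral_cong_AE)
  also have "\<dots> = (\<integral>\<^sup>+c. ennreal ((1 - v) / (1 - c)) * indicator {0..v} c \<partial>lborel) + (\<integral>\<^sup>+c. ennreal (v / c) * indicator {v..1} c \<partial>lborel)"
    by (rule nn_integral_add) auto
  also have "(\<integral>\<^sup>+c. ennreal ((1 - v) / (1 - c)) * indicator {0..v} c \<partial>lborel) = ennreal (- (1 - v) * ln (1 - v) - - (1 - v) * ln (1 - 0))"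
    using v by (intro nn_integral_FTC_Icc[where F="\<lambda>c. - (1 - v) * ln (1 - c)"]) (auto intro!: derivative_eq_intros simp: field_simps)
  also have "(\<integral>\<^sup>+c. ennreal (v / c) * indicator {v..1} c \<partial>lborel) = ennreal (v * ln 1 - v * ln v)"
    using v by (intro nn_integral_FTC_Icc[where F="\<lambda>c. v * ln c"]) (auto intro!: derivative_eq_intros)
  also have "ennreal (- (1 - v) * ln (1 - v) - - (1 - v) * ln (1 - 0)) + ennreal (v * ln 1 - v * ln v) = ennreal (ln 2 * bin_entropy v)"
  proof -
    have "0 \<le> - (1 - v) * ln (1 - v)" "0 \<le> - v * ln v"
      using v by (intro mult_nonpos_nonpos; simp)+
    then have "ennreal (- (1 - v) * ln (1 - v)) + ennreal (- v * ln v) = ennreal (- (1 - v) * ln (1 - v) + - v * ln v)"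
      by (rule ennreal_plus[symmetric])
    moreover have "ln 2 * bin_entropy v = - (1 - v) * ln (1 - v) + - v * ln v"
      unfolding bin_entropy_eq[OF v] by (simp add: algebra_simps)
    ultimately show ?thesis by simp
  qed
  finally show ?thesis .
qed

text \<open>\<open>min v c - v * c\<close> is the Green function of the second derivative on \<open>{0..1}\<close>, so this
  integrates the hinge functions against \<open>- bin_entropy''\<close>.\<close>
lemma nn_integral_entropy_eq:
  fixes u :: "'a::euclidean_space \<Rightarrow> real"
  assumes [measurable]: "u \<in> borel_measurable borel" and u01: "\<And>x. u x \<in> {0..1}"
  shows "(\<integral>\<^sup>+x. ennreal (ln 2 * bin_entropy (u x)) \<partial>gauss)
    = (\<integral>\<^sup>+c. ennreal (((1 - c) * (\<integral>x. u x \<partial>gauss) - (\<integral>x. max 0 (u x - c) \<partial>gauss)) / (c * (1 - c))) * indicator {0<..<1} c \<partial>lborel)"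
proof -
  interpret pair_sigma_finite "gauss :: 'a measure" "lborel :: real measure" ..
  let ?k = "\<lambda>x c. ennreal ((min (u x) c - u x * c) / (c * (1 - c))) * indicator {0<..<1} c"
  have "(\<integral>\<^sup>+x. ennreal (ln 2 * bin_entropy (u x)) \<partial>gauss) = (\<integral>\<^sup>+x. \<integral>\<^sup>+c. ?k x c \<partial>lborel \<partial>gauss)"
    using u01 by (simp add: nn_integral_entropy_kernel)
  also have "\<dots> = (\<integral>\<^sup>+c. \<integral>\<^sup>+x. ?k x c \<partial>gauss \<partial>lborel)"
    by (rule Fubini'[symmetric]) measurable
  also have "\<dots> = (\<integral>\<^sup>+c. ennreal (((1 - c) * (\<integral>x. u x \<partial>gauss) - (\<integral>x. max 0 (u x - c) \<partial>gauss)) / (c * (1 - c))) * indicator {0<..<1} c \<partial>lborel)"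
  proof (rule nn_integral_cong)
    fix c :: real
    show "(\<integral>\<^sup>+x. ?k x c \<partial>gauss) = ennreal (((1 - c) * (\<integral>x. u x \<partial>gauss) - (\<integral>x. max 0 (u x - c) \<partial>gauss)) / (c * (1 - c))) * indicator {0<..<1} c"
    proof (cases "c \<in> {0<..<1}")
      case True
      have iu: "integrable gauss u" using u01 by (intro integrable_gauss_bounded[of _ 1]) auto
      have im: "integrable gauss (\<lambda>x. max 0 (u x - c))"
      proof (rule integrable_gauss_bounded[of _ 1])
        show "\<bar>max 0 (u x - c)\<bar> \<le> 1" for x using u01[of x] True by (simp add: max_def)
      qed measurable
      \<comment> \<open>The kernel is a linear function of u minus a hinge function, so after
        integration only the mean and the hinge integrals of u remain.\<close>
      have eq: "min (u x) c - u x * c = (1 - c) * u x - max 0 (u x - c)" for x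
        by (auto simp: min_def max_def algebra_simps)
      have nn: "0 \<le> (min (u x) c - u x * c) / (c * (1 - c))" for x
      proof -
        have "u x * c \<le> u x" "u x * c \<le> c" using u01[of x] True by (auto intro: mult_left_le mult_left_le_one_le)
        then show ?thesis using True by simp
      qed
      have "(\<integral>\<^sup>+x. ?k x c \<partial>gauss) = (\<integral>\<^sup>+x. ennreal ((min (u x) c - u x * c) / (c * (1 - c))) \<partial>gauss)"
        using True by simp
      also have "\<dots> = ennreal (\<integral>x. (min (u x) c - u x * c) / (c * (1 - c)) \<partial>gauss)"
        using iu im nn unfolding eq by (intro nn_integral_eq_integral) auto
      also have "(\<integral>x. (min (u x) c - u x * c) / (c * (1 - c)) \<partial>gauss) = ((1 - c) * (\<integral>x. u x \<partial>gauss) - (\<integral>x. max 0 (u x - c) \<partial>gauss)) / (c * (1 - c))"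
        unfolding eq using iu im by simp
      finally show ?thesis using True by simp
    qed simp
  qed
  finally show ?thesis .
qed

lemma integral_bin_entropy_eq:
  fixes u :: "'a::euclidean_space \<Rightarrow> real"
  assumes [measurable]: "u \<in> borel_measurable borel" and u01: "\<And>x. u x \<in> {0..1}"
  shows "ennreal (ln 2 * (\<integral>x. bin_entropy (u x) \<partial>gauss)) = (\<integral>\<^sup>+x. ennreal (ln 2 * bin_entropy (u x)) \<partial>gauss)"
proof -
  have "integrable gauss (\<lambda>x. ln 2 * bin_entropy (u x))"
    using bin_entropy_bounds u01 by (intro integrable_gauss_bounded[of _ 1]) (auto simp: abs_le_iff intro: order_trans[of _ 0])
  then show ?thesis
    using bin_entropy_bounds(1)[OF u01] by (subst nn_integral_eq_integral) auto
qed

text \<open>In the integral representation the hinge integral enters with a minus sign and a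
  positive weight, and the remaining term depends on the mean only. Larger hinge integrals thus mean
  smaller entropy. The two functions may live on different spaces, since v will be a one-dimensional
  profile.\<close>

lemma entropy_mono_of_hinge:
  fixes u :: "'a::euclidean_space \<Rightarrow> real" and v :: "'b::euclidean_space \<Rightarrow> real"
  assumes u: "u \<in> borel_measurable borel" "\<And>x. u x \<in> {0..1}"
    and v: "v \<in> borel_measurable borel" "\<And>x. v x \<in> {0..1}"
    and mean: "(\<integral>x. u x \<partial>gauss) = (\<integral>x. v x \<partial>gauss)"
    and hinge: "\<And>c. (\<integral>x. max 0 (u x - c) \<partial>gauss) \<le> (\<integral>x. max 0 (v x - c) \<partial>gauss)"
  shows "(\<integral>x. bin_entropy (v x) \<partial>gauss) \<le> (\<integral>x. bin_entropy (u x) \<partial>gauss)"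
proof -
  have "ennreal (ln 2 * (\<integral>x. bin_entropy (v x) \<partial>gauss)) \<le> ennreal (ln 2 * (\<integral>x. bin_entropy (u x) \<partial>gauss))"
    unfolding integral_bin_entropy_eq[OF u] integral_bin_entropy_eq[OF v]
      nn_integral_entropy_eq[OF u] nn_integral_entropy_eq[OF v] mean
    using hinge by (intro nn_integral_mono) (auto simp: indicator_def intro!: ennreal_leI divide_right_mono diff_left_mono)
  moreover have "0 \<le> ln 2 * (\<integral>x. bin_entropy (u x) \<partial>gauss)"
  proof -
    have "0 \<le> bin_entropy (u x)" for x
      using bin_entropy_bounds(1)[OF u(2)[of x]] by (simp add: zero_le_mult_iff)
    then show ?thesis by (intro mult_nonneg_nonneg integral_nonneg_AE AE_I2) auto
  qed
  ultimately show ?thesis by simp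
qed

section \<open>Conditional entropy of a halfspace\<close>

lemma OU_eq_heat: "OU \<rho> f x = heat (1 - \<rho>\<^sup>2) f (\<rho> *\<^sub>R x)"
  by (simp add: OU_def heat_def std_gauss_eq_gauss)

theorem theorem1:
  fixes f :: "real ^ 'n \<Rightarrow> real" and \<eta> :: "(real ^ 'n) set" and \<rho> :: real
  assumes f_meas: "f \<in> borel_measurable borel"
    and f_bool: "\<And>x. f x \<in> {0, 1}"
    and rho: "0 \<le> \<rho>" "\<rho> < 1"
    and hs: "halfspace \<eta>"
    and mean: "(\<integral>x. indicator \<eta> x \<partial>std_gauss) = (\<integral>x. f x \<partial>std_gauss)"
  shows "- cond_entropy \<rho> f \<le> - cond_entropy \<rho> (indicator \<eta>)"
proof -
  obtain a t where a: "a \<noteq> 0" and \<eta>: "\<eta> = {x. a \<bullet> x \<ge> t}" using hs by (auto simp: halfspace_def)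
  \<comment> \<open>The sign is reversed so that the halfspace becomes the set where
    \<open>e \<bullet> x\<close> is at most s, in line with the lower tails measured by
    \<open>Phi\<close>.\<close>
  define e where "e = - (a /\<^sub>R norm a)"
  define s where "s = - t / norm a"
  have e: "norm e = 1" using a by (simp add: e_def)
  have ind: "indicator \<eta> x = (indicator {..s} (e \<bullet> x) :: real)" for x
    using a by (auto simp: \<eta> e_def s_def indicator_def field_simps)
  have m: "(\<integral>x. f x \<partial>gauss) = Phi s"
    using mean integral_gauss_inner_fun[OF e, of "indicator {..s}"]
    by (simp add: std_gauss_eq_gauss ind Phi_def)
  have f01: "f x \<in> {0..1}" for x using f_bool[of x] by auto
  \<comment> \<open>The profile of the noisy indicator along e, the same function that bounds the
    hinge integrals in \<open>hinge_le_halfspace\<close>.\<close>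
  define v where "v a = Phi ((s - \<rho> * a) / sqrt (1 - \<rho>\<^sup>2))" for a
  have v: "v \<in> borel_measurable borel" unfolding v_def[abs_def] by measurable
  have v01: "v a \<in> {0..1}" for a by (simp add: v_def)
  have r: "sqrt (1 - \<rho>\<^sup>2) > 0" using resid_pos[OF rho] by (simp add: resid_def)
  have U\<eta>: "OU \<rho> (indicator \<eta>) x = v (e \<bullet> x)" for x
  proof -
    have "OU \<rho> (indicator \<eta>) x = (\<integral>z. indicator {..s} (\<rho> * (e \<bullet> x) + sqrt (1 - \<rho>\<^sup>2) * (e \<bullet> z)) \<partial>gauss)"
      by (simp add: OU_def std_gauss_eq_gauss ind inner_simps)
    also have "\<dots> = v (e \<bullet> x)"
      using integral_gauss_inner_fun[OF e, of "\<lambda>z. indicator {..s} (\<rho> * (e \<bullet> x) + sqrt (1 - \<rho>\<^sup>2) * z)"]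
        integral_gauss1_affine(1)[OF r, of s "\<rho> * (e \<bullet> x)"]
      by (simp add: v_def)
    finally show ?thesis .
  qed
  let ?u = "\<lambda>x. heat (1 - \<rho>\<^sup>2) f (\<rho> *\<^sub>R x)"
  have um: "?u \<in> borel_measurable borel" using f_meas by measurable
  have u01: "?u x \<in> {0..1}" for x using f_meas f01 by (rule heat_bounds)
  have umean: "(\<integral>x. ?u x \<partial>gauss) = Phi s"
  proof -
    have "(\<integral>x. ?u x \<partial>gauss) = (\<integral>z. f (sqrt (\<rho>\<^sup>2 + (sqrt (1 - \<rho>\<^sup>2))\<^sup>2) *\<^sub>R z) \<partial>gauss)"
      unfolding heat_def using f_meas f01 rho by (intro integral_gauss_conv[of _ 1]) (auto simp: abs_le_iff intro: order_trans[of _ 0])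
    then show ?thesis using rho by (simp add: m power_le_one)
  qed
  have vmean: "(\<integral>a. v a \<partial>gauss1) = Phi s"
    using integral_Phi_affine[OF rho, of s] by (simp add: v_def resid_def)
  have "(\<integral>a. bin_entropy (v a) \<partial>gauss1) \<le> (\<integral>x. bin_entropy (?u x) \<partial>gauss)"
  proof (intro entropy_mono_of_hinge um u01 v v01)
    show "(\<integral>x. ?u x \<partial>gauss) = (\<integral>a. v a \<partial>gauss1)" unfolding umean vmean ..
    show "(\<integral>x. max 0 (?u x - c) \<partial>gauss) \<le> (\<integral>a. max 0 (v a - c) \<partial>gauss1)" for c
      unfolding v_def by (rule hinge_le_halfspace[OF rho f_meas f01 m])
  qed
  moreover have "cond_entropy \<rho> (indicator \<eta>) = (\<integral>a. bin_entropy (v a) \<partial>gauss1)"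
    using integral_gauss_inner_fun[OF e, of "\<lambda>a. bin_entropy (v a)"] v
    by (simp add: cond_entropy_def std_gauss_eq_gauss U\<eta>)
  ultimately show ?thesis
    by (simp add: cond_entropy_def std_gauss_eq_gauss OU_eq_heat)
qed

end
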